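(* Let $F$ and $G$ be locally convex Souslin topological vector spaces. Let $Z$ be a zero-mean Gaussian $G$-valued random variable whose Cameron-Martin space $H_{\mu_Z}$ is infinite-dimensional, let $X$ be an $F$-valued random variable, and let $\gamma$ be a non-negative real random variable whose distribution has no atom at zero. Suppose that $\gamma$, $X$ and $Z$ are statistically independent. Let $L:F\to G$ be a continuous mapping such that $L(F)\subset H_{\mu_Z}$. Let $\{e_i\}_{i=1}^\infty$ be an orthonormal basis of $H_{\mu_Z}$ such that $C_Z^{-1}e_i\in G'$ for all $i$, where $C_Z$ is the covariance operator of $Z$. Then the essentially unique posterior distribution of $X$ given a sample $y$ of $Y=L(X)+\gamma Z$ has a version $$\mu(A,y)=\frac{\int_A\exp\left(\langle y,\gamma_y^{-2}C_Z^{-1}L(x)\rangle-\frac{1}{2\gamma_y^2}\|L(x)\|_{H_{\mu_Z}}^2\right)d\mu_X(x)}{\int_F\exp\left(\langle y,\gamma_y^{-2}C_Z^{-1}L(x)\rangle-\frac{1}{2\gamma_y^2}\|L(x)\|_{H_{\mu_Z}}^2\right)d\mu_X(x)}$$ (for Borel sets $A\subset F$) for all $y\in G$ such that the limit $$\gamma_y=\left(\lim_{n\to\infty}\frac1n\sum_{i=1}^n\langle y,C_Z^{-1}e_i\rangle^2\right)^{1/2}$$ exists and does not vanish.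
   Context: A Souslin space is a Hausdorff topological space that is the image of a complete separable metric space under a continuous mapping. Random variables are defined on a complete probability space $(\Omega,\Sigma,P)$; $\mathcal F,\mathcal G$ are the Borel $\sigma$-algebras of $F,G$; $\mu_V=P\circ V^{-1}$ denotes the image measure of a random variable $V$. $G'$ is the topological dual of $G$ and $\langle\cdot,\cdot\rangle$ the duality. The covariance operator of the zero-mean Gaussian $Z$ is given by $\langle C_Z\phi,\psi\rangle=\mathbf E[\langle Z,\phi\rangle\langle Z,\psi\rangle]$, $\phi,\psi\in G'$. $H_{\mu_Z}\subset G$ is the Cameron-Martin space of $\mu_Z$ (a Hilbert space); $G'$ is (via restriction) dense in $H_{\mu_Z}'$, and $C_Z$ extends to the Riesz isometric isomorphism $C_Z:H_{\mu_Z}'\to H_{\mu_Z}$, whose inverse is $C_Z^{-1}$. When $h\in H_{\mu_Z}$ and $C_Z^{-1}h$ is not in $G'$, $\langle y,C_Z^{-1}h\rangle$ denotes a measurable extension of the duality, namely the limit in $L^2(\mu_Z)$ (and correspondingly in $L^2(\mu_{aZ})$ for scaled measures, $a>0$) of $\langle y,\phi_n\rangle$ with $\phi_n\in G'$, $\phi_n\to C_Z^{-1}h$ in $H_{\mu_Z}'$. A solution of the statistical inverse problem of estimating the distribution of $X$ given $Y$ is a mapping $\mu:\mathcal F\times G\to[0,1]$ such that (1) $\mu(U,Y(\omega))=\mathbf E[1_U(X)|Y^{-1}(\mathcal G)](\omega)$ $P$-a.s. for every $U\in\mathcal F$; (2) $y\mapsto\mu(U,y)$ is $\mu_Y$-measurable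 (measurable with respect to the $\mu_Y$-completion of $\mathcal G$) for every $U\in\mathcal F$; (3) $\mu(\cdot,y)$ is a probability measure on $(F,\mathcal F)$ for every $y\in G$. The measures $\mu(\cdot,y)$ are the posterior distributions. The solution (posterior distribution) is essentially unique if any other solution agrees with it on $\mathcal F\times C$ for some $C$ in the $\mu_Y$-completion of $\mathcal G$ with $\mu_Y(C)=1$; "has a version" means that there is a solution of the displayed form.
   Formalization: The denominator can be infinite at exceptional y with γ_y > 0, so the formula is proved at all such y for a suitably chosen jointly measurable version of ⟨y, C_Z^{-1}L(x)⟩, and for every jointly measurable version at those y where the denominator is finite. *)

theory Defs
  imports "HOL-Probability.Probability"
begin

class locally_convex_tvs = real_vector + topological_ab_group_add +
  assumes tendsto_scaleR_Pair:
    "LIM p (nhds c \<times>\<^sub>F nhds a). fst p *\<^sub>R snd p :> nhds (c *\<^sub>R a)"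
  and convex_nhds_base_raw:
    "open U \<Longrightarrow> 0 \<in> U \<Longrightarrow> \<exists>V. open V \<and>
       (\<forall>x\<in>V. \<forall>y\<in>V. \<forall>u\<ge>0. \<forall>v\<ge>0. u + v = 1 \<longrightarrow> u *\<^sub>R x + v *\<^sub>R y \<in> V) \<and>
       0 \<in> V \<and> V \<subseteq> U"

lemma convex_nhds_base:
  fixes U :: "'a::locally_convex_tvs set"
  assumes "open U" "0 \<in> U"
  shows "\<exists>V. open V \<and> convex V \<and> 0 \<in> V \<and> V \<subseteq> U"
  unfolding convex_def using convex_nhds_base_raw[OF assms] .

text \<open>A separable metric space has at most continuum many points, so taking the points of the
  complete separable metric space from the type of reals (with an arbitrary metric on an arbitrary
  set of reals) is no restriction.\<close>

definition souslin_space :: "'a topology \<Rightarrow> bool" where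
  "souslin_space T \<longleftrightarrow> Hausdorff_space T \<and>
     (\<exists>(m :: real metric) f. mcomplete_of m \<and> separable_space (mtopology_of m) \<and>
        continuous_map (mtopology_of m) T f \<and> f ` mspace m = topspace T)"

definition top_dual :: "('g::locally_convex_tvs \<Rightarrow> real) set" where
  "top_dual = {\<phi>. linear \<phi> \<and> continuous_on UNIV \<phi>}"

text \<open>Dirac measures count as degenerate Gaussian measures.\<close>

definition centered_gaussian_real :: "real measure \<Rightarrow> bool" where
  "centered_gaussian_real \<nu> \<longleftrightarrow>
     (\<exists>\<sigma>>0. \<nu> = density lborel (\<lambda>t. ennreal (normal_density 0 \<sigma> t))) \<or> \<nu> = return borel 0"

definition centered_gaussian :: "'g::locally_convex_tvs measure \<Rightarrow> bool" where
  "centered_gaussian \<mu> \<longleftrightarrow> prob_space \<mu> \<and> sets \<mu> = sets borel \<and>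
     (\<forall>\<phi>\<in>top_dual. centered_gaussian_real (distr \<mu> borel \<phi>))"

text \<open>\<open>cov_maps \<mu> \<phi> h\<close> says that the covariance operator \<open>C\<close> of the centered measure \<open>\<mu>\<close>, given by
  \<open>\<langle>C \<phi>, \<psi>\<rangle> = \<integral> \<langle>y, \<phi>\<rangle> \<langle>y, \<psi>\<rangle> d\<mu>(y)\<close>, satisfies \<open>C \<phi> = h\<close>. The relation determines \<open>h\<close>
  in a Hausdorff locally convex space. It determines \<open>\<phi>\<close> only up to \<open>\<mu>\<close>-null sets when \<open>\<mu>\<close> does
  not have full support.\<close>

definition cov_maps :: "'g::locally_convex_tvs measure \<Rightarrow> ('g \<Rightarrow> real) \<Rightarrow> 'g \<Rightarrow> bool" where
  "cov_maps \<mu> \<phi> h \<longleftrightarrow> \<phi> \<in> top_dual \<and> (\<forall>\<psi>\<in>top_dual. \<psi> h = (\<integral>y. \<phi> y * \<psi> y \<partial>\<mu>))"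

text \<open>The Cameron-Martin space of a centered Gaussian measure: the vectors \<open>h\<close> for which
  \<open>\<parallel>h\<parallel> = sup {\<phi>(h) | \<phi> \<in> G', \<integral> \<phi>\<^sup>2 d\<mu> \<le> 1}\<close> is finite. The norm is Hilbertian, and
  its inner product is recovered by polarization.\<close>

definition cov_ball :: "'g::locally_convex_tvs measure \<Rightarrow> ('g \<Rightarrow> real) set" where
  "cov_ball \<mu> = {\<phi>\<in>top_dual. (\<integral>y. (\<phi> y)\<^sup>2 \<partial>\<mu>) \<le> 1}"

definition cm_space :: "'g::locally_convex_tvs measure \<Rightarrow> 'g set" where
  "cm_space \<mu> = {h. bdd_above ((\<lambda>\<phi>. \<phi> h) ` cov_ball \<mu>)}"

definition cm_norm :: "'g::locally_convex_tvs measure \<Rightarrow> 'g \<Rightarrow> real" where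
  "cm_norm \<mu> h = (SUP \<phi>\<in>cov_ball \<mu>. \<phi> h)"

definition cm_inner :: "'g::locally_convex_tvs measure \<Rightarrow> 'g \<Rightarrow> 'g \<Rightarrow> real" where
  "cm_inner \<mu> h k = ((cm_norm \<mu> (h + k))\<^sup>2 - (cm_norm \<mu> (h - k))\<^sup>2) / 4"

definition cm_orthonormal_basis :: "'g::locally_convex_tvs measure \<Rightarrow> (nat \<Rightarrow> 'g) \<Rightarrow> bool" where
  "cm_orthonormal_basis \<mu> e \<longleftrightarrow> range e \<subseteq> cm_space \<mu> \<and>
     (\<forall>i j. cm_inner \<mu> (e i) (e j) = (if i = j then 1 else 0)) \<and>
     (\<forall>h\<in>cm_space \<mu>. \<forall>\<epsilon>>0. \<exists>s\<in>span (range e). cm_norm \<mu> (h - s) < \<epsilon>)"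

text \<open>The extension of the covariance operator to the dual \<open>H'\<close> of the Cameron-Martin space \<open>H\<close> is
  the Riesz isomorphism onto \<open>H\<close>, hence its inverse sends \<open>h\<close> to the functional
  \<open>cm_inner \<mu> h\<close> on \<open>H\<close>. The next predicate is convergence \<open>\<phi>\<^sub>n \<rightarrow> C\<^sup>-\<^sup>1 h\<close> in the norm of \<open>H'\<close>.\<close>

definition tendsto_cov_inv ::
  "'g::locally_convex_tvs measure \<Rightarrow> (nat \<Rightarrow> 'g \<Rightarrow> real) \<Rightarrow> 'g \<Rightarrow> bool" where
  "tendsto_cov_inv \<mu> \<phi> h \<longleftrightarrow>
     (\<lambda>n. SUP k\<in>{k\<in>cm_space \<mu>. cm_norm \<mu> k \<le> 1}. \<bar>\<phi> n k - cm_inner \<mu> h k\<bar>) \<longlonglongrightarrow> 0"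

text \<open>\<open>D h y\<close> plays the role of \<open>\<langle>y, C\<^sup>-\<^sup>1 h\<rangle>\<close>. For each \<open>h\<close> this is an element of \<open>L\<^sup>2\<close> of all
  scaled measures \<open>\<mu>\<^sub>a\<close> (the image of \<open>\<mu>\<close> under \<open>z \<mapsto> a z\<close>, \<open>a > 0\<close>), so pointwise values depend
  on the chosen version. The versions considered are those for which \<open>\<langle>y, C\<^sup>-\<^sup>1 L(x)\<rangle>\<close> is
  jointly measurable in \<open>(x, y)\<close>.\<close>

definition duality_version ::
  "'g::locally_convex_tvs measure \<Rightarrow> ('f::topological_space \<Rightarrow> 'g) \<Rightarrow> ('g \<Rightarrow> 'g \<Rightarrow> real) \<Rightarrow> bool" where
  "duality_version \<mu> L D \<longleftrightarrow>
     (\<lambda>(x, y). D (L x) y) \<in> borel_measurable (borel \<Otimes>\<^sub>M borel) \<and>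
     (\<forall>h\<in>cm_space \<mu>. D h \<in> borel_measurable borel \<and>
        (\<exists>\<phi>. (\<forall>n. \<phi> n \<in> top_dual) \<and> tendsto_cov_inv \<mu> \<phi> h \<and>
          (\<forall>a>0. (\<lambda>n. \<integral>\<^sup>+y. ennreal ((\<phi> n y - D h y)\<^sup>2) \<partial>distr \<mu> borel (\<lambda>z. a *\<^sub>R z))
                   \<longlonglongrightarrow> 0)))"

definition indep_rvs3 ::
  "'w measure \<Rightarrow> ('w \<Rightarrow> 'a::topological_space) \<Rightarrow> ('w \<Rightarrow> 'b::topological_space) \<Rightarrow>
   ('w \<Rightarrow> 'c::topological_space) \<Rightarrow> bool" where
  "indep_rvs3 M U V W \<longleftrightarrow> prob_space.indep_sets M
     (\<lambda>i. [{U -` A \<inter> space M | A. A \<in> sets borel},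
           {V -` A \<inter> space M | A. A \<in> sets borel},
           {W -` A \<inter> space M | A. A \<in> sets borel}] ! i) {0, 1, 2}"

text \<open>A solution \<open>\<mu>(U, y)\<close> is represented as \<open>measure (\<kappa> y) U\<close>.\<close>

definition posterior_solution ::
  "'w measure \<Rightarrow> ('w \<Rightarrow> 'f::topological_space) \<Rightarrow> ('w \<Rightarrow> 'g::topological_space) \<Rightarrow>
   ('g \<Rightarrow> 'f measure) \<Rightarrow> bool" where
  "posterior_solution M X Y \<kappa> \<longleftrightarrow>
     (\<forall>U\<in>sets borel. AE \<omega> in M. measure (\<kappa> (Y \<omega>)) U =
        real_cond_exp M (vimage_algebra (space M) Y borel) (\<lambda>\<omega>. indicator U (X \<omega>)) \<omega>) \<and>
     (\<forall>U\<in>sets borel. (\<lambda>y. measure (\<kappa> y) U) \<in> borel_measurable (completion (distr M borel Y))) \<and>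
     (\<forall>y. prob_space (\<kappa> y) \<and> sets (\<kappa> y) = sets borel)"

definition essentially_unique_posterior ::
  "'w measure \<Rightarrow> ('w \<Rightarrow> 'f::topological_space) \<Rightarrow> ('w \<Rightarrow> 'g::topological_space) \<Rightarrow>
   ('g \<Rightarrow> 'f measure) \<Rightarrow> bool" where
  "essentially_unique_posterior M X Y \<kappa> \<longleftrightarrow>
     (\<forall>\<kappa>'. posterior_solution M X Y \<kappa>' \<longrightarrow>
       (\<exists>C\<in>sets (completion (distr M borel Y)).
          measure (completion (distr M borel Y)) C = 1 \<and>
          (\<forall>y\<in>C. \<forall>U\<in>sets borel. measure (\<kappa>' y) U = measure (\<kappa> y) U)))"

text \<open>\<open>c i\<close> stands for the functional \<open>C\<^sup>-\<^sup>1 e\<^sub>i\<close>; indices start at 0 and the value at \<open>n = 0\<close>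
  is irrelevant for the limit.\<close>

definition square_average :: "(nat \<Rightarrow> 'g \<Rightarrow> real) \<Rightarrow> 'g \<Rightarrow> nat \<Rightarrow> real" where
  "square_average c y n = (\<Sum>i<n. (c i y)\<^sup>2) / real n"

definition noise_level :: "(nat \<Rightarrow> 'g \<Rightarrow> real) \<Rightarrow> 'g \<Rightarrow> real" where
  "noise_level c y = sqrt (lim (square_average c y))"

definition noise_level_positive :: "(nat \<Rightarrow> 'g \<Rightarrow> real) \<Rightarrow> 'g \<Rightarrow> bool" where
  "noise_level_positive c y \<longleftrightarrow> convergent (square_average c y) \<and> noise_level c y \<noteq> 0"

text \<open>The factor \<open>\<gamma>\<^sub>y\<^sup>-\<^sup>2\<close> is pulled out of the duality by linearity.\<close>

definition likelihood ::
  "'g::locally_convex_tvs measure \<Rightarrow> ('f \<Rightarrow> 'g) \<Rightarrow> ('g \<Rightarrow> 'g \<Rightarrow> real) \<Rightarrow> real \<Rightarrow> 'g \<Rightarrow> 'f \<Rightarrow> real" where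
  "likelihood \<mu> L D g y x =
     exp (D (L x) y / g\<^sup>2 - (cm_norm \<mu> (L x))\<^sup>2 / (2 * g\<^sup>2))"

text \<open>On how the formula for the posterior is to be read. For a fixed version \<open>D\<close> the denominator
  \<open>\<integral> likelihood d\<mu>\<^sub>X\<close> may be infinite at exceptional \<open>y\<close>, even if \<open>\<gamma>\<^sub>y\<close> exists and is positive and
  every \<open>C\<^sup>-\<^sup>1 L(x)\<close> is in \<open>G'\<close>: take i.i.d. standard normal coordinates on \<open>\<real>\<^sup>\<nat>\<close>, let \<open>L(X)\<close> be
  the indicator sequence of \<open>{1..k}\<close> with probability proportional to \<open>1 / k\<^sup>2\<close>, and
  \<open>y = (1, 1, ...)\<close>. There the quotient is not defined. Therefore one can either choose the version
  such that the quotient is defined for all \<open>y\<close> with positive \<open>\<gamma>\<^sub>y\<close>, or keep an arbitrary version and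
  use the formula wherever the quotient is defined.\<close>

end

theory Submission
  imports Defs "HOL-Library.Discrete_Functions"
begin

text \<open>Conditionally on \<open>\<gamma> = s > 0\<close> and \<open>X = x\<close>, the observation is the noise \<open>s Z\<close> shifted by the
  Cameron-Martin vector \<open>L x\<close>, so its law has the density
  \<open>exp (\<langle>y, C\<^sup>-\<^sup>1 L x\<rangle> / s\<^sup>2 - \<parallel>L x\<parallel>\<^sup>2 / (2 s\<^sup>2))\<close> with respect to the law of \<open>s Z\<close>. By the law of large
  numbers for the orthonormal variables \<open>c i\<close>, almost every \<open>y\<close> under the law of \<open>s Z\<close> has noise level
  \<open>s\<close>. Hence \<open>s\<close> can be replaced by a function of \<open>y\<close>, the joint law of \<open>X\<close> and \<open>Y\<close> has a density with
  respect to the product of the laws of \<open>X\<close> and \<open>\<gamma> Z\<close>, and Bayes' formula gives the posterior.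

  The space \<open>G\<close> need be neither complete nor metrizable. The Borel sets are generated by countably many
  functionals (Hahn-Banach and Lusin's separation theorem), so finite measures are determined by their
  characteristic functionals. That the covariance element of a functional lies in \<open>G\<close> is
  obtained from Lusin's theorem as well, by a self-independence argument.\<close>

section \<open>Separation of points by continuous functionals\<close>

text \<open>The pairing of \<open>y\<close> with the inverse covariance of \<open>h\<close> is only
  an L2 class, so the Cameron-Martin formula has to hold for limits of functionals. Its hypothesis
  is therefore put as the joint characteristic function of such a limit with the functionals of the
  dual: this survives L2 limits, and it is enough to split \<open>z\<close> into two independent
  parts.

  The formula for the posterior involves \<open>y\<close> alone, so null sets that depend on the
  state or on the amplitude need care. The set of \<open>z\<close> on which the noise level of
  \<open>s z\<close> differs from \<open>s\<close> does not depend on the state; hence the integral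
  over the state is made the innermost one before \<open>s\<close> is replaced. Null sets for
  different \<open>s\<close> are never united, because the law of \<open>\<gamma>\<close> is
  integrated over last. Behind this is the mutual singularity of the laws of \<open>s Z\<close> for
  distinct \<open>s\<close>: one function of \<open>y\<close> can agree with the right density under
  each of them.

  The natural candidate for a covariance element is the vector integral of \<open>\<phi> z\<close>
  times \<open>z\<close>, whose existence is a matter of completeness. Two points with the same
  residual but different values of \<open>\<phi>\<close> take its place.\<close>

definition sublinear :: "('a::real_vector \<Rightarrow> real) \<Rightarrow> bool" where
  "sublinear q \<longleftrightarrow> (\<forall>x y. q (x + y) \<le> q x + q y) \<and> (\<forall>x. \<forall>t>0. q (t *\<^sub>R x) = t * q x)"

lemma sublinear_add: "sublinear q \<Longrightarrow> q (x + y) \<le> q x + q y"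
  and sublinear_scaleR: "sublinear q \<Longrightarrow> 0 < t \<Longrightarrow> q (t *\<^sub>R x) = t * q x"
  by (auto simp: sublinear_def)

lemma sublinear_zero: "sublinear q \<Longrightarrow> q 0 = 0"
  using sublinear_scaleR[of q 2 0] by simp

lemma sublinear_minus: "sublinear q \<Longrightarrow> - q (- x) \<le> q x"
  using sublinear_add[of q x "- x"] sublinear_zero[of q] by simp

lemma sublinearI:
  assumes "\<And>x y. q (x + y) \<le> q x + q y" "\<And>x t. 0 < t \<Longrightarrow> q (t *\<^sub>R x) \<le> t * q x"
  shows "sublinear q"
  unfolding sublinear_def
proof (intro conjI allI impI)
  fix x :: 'a and t :: real assume t: "0 < t"
  have "q (inverse t *\<^sub>R (t *\<^sub>R x)) \<le> inverse t * q (t *\<^sub>R x)"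
    using t by (intro assms(2)) auto
  then have "t * q x \<le> q (t *\<^sub>R x)"
    using t by (simp add: field_simps)
  then show "q (t *\<^sub>R x) = t * q x" using assms(2)[OF t, of x] by simp
qed (rule assms)

text \<open>The lowering step of Hahn-Banach: an infimum along the ray spanned by \<open>y\<close>,
  kept finite by the bound \<open>- q (- v)\<close>. The parameters \<open>t = 0\<close> and
  \<open>t = 1\<close> of the infimum give the two estimates.\<close>

lemma sublinear_lower:
  fixes q :: "'a::real_vector \<Rightarrow> real"
  assumes q: "sublinear q"
  shows "\<exists>q'. sublinear q' \<and> (\<forall>v. q' v \<le> q v) \<and> (\<forall>v. q' v \<le> q (v + y) - q y)"
proof -
  define q' where "q' v = (INF t\<in>{0..}. q (v + t *\<^sub>R y) - t * q y)" for v
  have low: "- q (- v) \<le> q (v + t *\<^sub>R y) - t * q y" if "0 \<le> t" for v t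
  proof (cases "t = 0")
    case False
    then have "t * q y = q (t *\<^sub>R y)" using that by (simp add: sublinear_scaleR[OF q])
    also have "\<dots> \<le> q (v + t *\<^sub>R y) + q (- v)"
      using sublinear_add[OF q, of "v + t *\<^sub>R y" "- v"] by simp
    finally show ?thesis by simp
  qed (use sublinear_minus[OF q] in simp)
  have bdd: "bdd_below ((\<lambda>t. q (v + t *\<^sub>R y) - t * q y) ` {0..})" for v
    using low by (intro bdd_belowI2) auto
  have le: "q' v \<le> q (v + t *\<^sub>R y) - t * q y" if "0 \<le> t" for v t
    unfolding q'_def using bdd that by (intro cINF_lower) auto
  have ge: "m \<le> q' v" if "\<And>t. 0 \<le> t \<Longrightarrow> m \<le> q (v + t *\<^sub>R y) - t * q y" for v m
    unfolding q'_def using that by (intro cINF_greatest) auto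
  have "sublinear q'"
  proof (rule sublinearI)
    fix v w
    have "q' (v + w) - (q (v + t *\<^sub>R y) - t * q y) \<le> q' w" if t: "0 \<le> t" for t
    proof (rule ge)
      fix u :: real assume u: "0 \<le> u"
      have "q' (v + w) \<le> q (v + w + (t + u) *\<^sub>R y) - (t + u) * q y"
        using t u by (intro le) auto
      also have "q (v + w + (t + u) *\<^sub>R y) = q ((v + t *\<^sub>R y) + (w + u *\<^sub>R y))"
        by (simp add: algebra_simps)
      also have "\<dots> \<le> q (v + t *\<^sub>R y) + q (w + u *\<^sub>R y)" by (rule sublinear_add[OF q])
      finally show "q' (v + w) - (q (v + t *\<^sub>R y) - t * q y) \<le> q (w + u *\<^sub>R y) - u * q y"
        by (simp add: algebra_simps)
    qed
    then have "q' (v + w) - q' w \<le> q' v"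
      by (intro ge) (simp add: algebra_simps)
    then show "q' (v + w) \<le> q' v + q' w" by simp
  next
    fix v and s :: real assume s: "0 < s"
    have "q' (s *\<^sub>R v) / s \<le> q' v"
    proof (rule ge)
      fix t :: real assume t: "0 \<le> t"
      have "q' (s *\<^sub>R v) \<le> q (s *\<^sub>R v + (s * t) *\<^sub>R y) - (s * t) * q y"
        using s t by (intro le) auto
      also have "q (s *\<^sub>R v + (s * t) *\<^sub>R y) = q (s *\<^sub>R (v + t *\<^sub>R y))"
        by (simp add: algebra_simps)
      also have "\<dots> = s * q (v + t *\<^sub>R y)" by (rule sublinear_scaleR[OF q s])
      finally show "q' (s *\<^sub>R v) / s \<le> q (v + t *\<^sub>R y) - t * q y"
        using s by (simp add: field_simps)
    qed
    then show "q' (s *\<^sub>R v) \<le> s * q' v" using s by (simp add: field_simps)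
  qed
  moreover have "q' v \<le> q v" for v using le[of 0 v] by simp
  moreover have "q' v \<le> q (v + y) - q y" for v using le[of 1 v] by simp
  ultimately show ?thesis by blast
qed

text \<open>A minimal sublinear functional is linear, since lowering it in the direction \<open>y\<close> changes
  nothing.\<close>

lemma hahn_banach:
  fixes p :: "'a::real_vector \<Rightarrow> real"
  assumes p: "sublinear p"
  shows "\<exists>f. linear f \<and> (\<forall>v. f v \<le> p v) \<and> f x = p x"
proof -
  \<comment> \<open>Lowering in the direction \<open>x\<close> before Zorn's lemma is applied forces
    \<open>f (- x) \<le> - p x\<close> for every \<open>f\<close> below \<open>p'\<close>, which by
    linearity is the missing half of \<open>f x = p x\<close>.\<close>
  obtain p' where p': "sublinear p'" "\<And>v. p' v \<le> p v" "\<And>v. p' v \<le> p (v + x) - p x"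
    using sublinear_lower[OF p, of x] by blast
  define A where "A = {q. sublinear q \<and> (\<forall>v. q v \<le> p' v)}"
  let ?P = "\<lambda>a b :: 'a \<Rightarrow> real. \<forall>v. b v \<le> a v"
  have "\<exists>m\<in>A. \<forall>a\<in>A. ?P m a \<longrightarrow> a = m"
  proof (rule predicate_Zorn)
    have "a = b" if "?P a b" "?P b a" for a b
      using that by (intro ext order_antisym) auto
    then show "partial_order_on A (relation_of ?P A)"
      unfolding partial_order_on_def preorder_on_def refl_on_def relation_of_def trans_def antisym_def
      by (blast intro: order_trans)
  next
    fix C assume C: "C \<in> Chains (relation_of ?P A)"
    show "\<exists>u\<in>A. \<forall>a\<in>C. ?P a u"
    proof (cases "C = {}")
      case True
      then show ?thesis using p' by (auto simp: A_def)
    next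
      case False
      have CA: "C \<subseteq> A" and tot: "\<And>a b. a \<in> C \<Longrightarrow> b \<in> C \<Longrightarrow> ?P a b \<or> ?P b a"
        using C by (auto simp: Chains_def relation_of_def)
      define u where "u v = (INF q\<in>C. q v)" for v
      have bdd: "bdd_below ((\<lambda>q. q v) ` C)" for v
      proof (rule bdd_belowI2)
        fix q assume "q \<in> C"
        then have "sublinear q" "q (- v) \<le> p' (- v)" using CA by (auto simp: A_def)
        then show "- p' (- v) \<le> q v" using sublinear_minus[of q v] by simp
      qed
      have le: "u v \<le> q v" if "q \<in> C" for q v
        unfolding u_def using bdd that by (intro cINF_lower) auto
      have ge: "m \<le> u v" if "\<And>q. q \<in> C \<Longrightarrow> m \<le> q v" for m v
        unfolding u_def using that False by (intro cINF_greatest) auto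
      have "sublinear u"
      proof (rule sublinearI)
        fix v w
        have "u (v + w) - q v \<le> u w" if q: "q \<in> C" for q
        proof (rule ge)
          fix r assume r: "r \<in> C"
          obtain s where s: "s \<in> C" "s v \<le> q v" "s w \<le> r w"
            using tot[OF q r] q r by blast
          have "u (v + w) \<le> s v + s w"
            using le[OF s(1), of "v + w"] sublinear_add[of s v w] s(1) CA by (force simp: A_def)
          then show "u (v + w) - q v \<le> r w" using s by simp
        qed
        then have "u (v + w) - u w \<le> u v"
          by (intro ge) (simp add: algebra_simps)
        then show "u (v + w) \<le> u v + u w" by simp
      next
        fix v and s :: real assume s: "0 < s"
        have "u (s *\<^sub>R v) / s \<le> u v"
        proof (rule ge)
          fix q assume q: "q \<in> C"
          then have "q (s *\<^sub>R v) = s * q v" using CA s by (auto simp: A_def sublinear_scaleR)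
          then show "u (s *\<^sub>R v) / s \<le> q v" using le[OF q, of "s *\<^sub>R v"] s by (simp add: field_simps)
        qed
        then show "u (s *\<^sub>R v) \<le> s * u v" using s by (simp add: field_simps)
      qed
      moreover have "u v \<le> p' v" for v
      proof -
        obtain q where "q \<in> C" using False by auto
        then show ?thesis using le[of q v] CA by (auto simp: A_def intro: order_trans)
      qed
      ultimately have "u \<in> A" by (simp add: A_def)
      then show ?thesis using le by auto
    qed
  qed
  then obtain f where f: "f \<in> A" and min: "\<And>a. a \<in> A \<Longrightarrow> ?P f a \<Longrightarrow> a = f" by blast
  have fs: "sublinear f" and fp: "\<And>v. f v \<le> p' v" using f by (auto simp: A_def)
  have add: "f (v + y) = f v + f y" for v y
  proof -
    obtain f' where f': "sublinear f'" "\<And>v. f' v \<le> f v" "\<And>v. f' v \<le> f (v + y) - f y"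
      using sublinear_lower[OF fs, of y] by blast
    have "f' = f"
      using f' fp by (intro min) (auto simp: A_def intro: order_trans)
    then show ?thesis using f'(3)[of v] sublinear_add[OF fs, of v y] by simp
  qed
  have minus: "f (- v) = - f v" for v
    using add[of v "- v"] sublinear_zero[OF fs] by simp
  have "linear f"
  proof (rule linearI)
    fix r :: real and v
    consider "r > 0" | "r = 0" | "r < 0" by linarith
    then show "f (r *\<^sub>R v) = r *\<^sub>R f v"
    proof cases
      case 3
      have "f ((- r) *\<^sub>R v) = (- r) * f v" using 3 by (intro sublinear_scaleR[OF fs]) auto
      then show ?thesis using minus[of "r *\<^sub>R v"] by simp
    qed (simp_all add: sublinear_scaleR[OF fs] sublinear_zero[OF fs])
  qed (rule add)
  moreover have "f v \<le> p v" for v using fp p'(2) order_trans by blast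
  moreover have "f x = p x"
  proof (rule antisym)
    show "f x \<le> p x" by fact
    have "f (- x) \<le> p 0 - p x" using fp[of "- x"] p'(3)[of "- x"] by simp
    then show "p x \<le> f x" using minus[of x] sublinear_zero[OF p] by simp
  qed
  ultimately show ?thesis by blast
qed

lemma tendsto_scaleR_tvs:
  fixes a :: "'a::locally_convex_tvs"
  assumes "(f \<longlongrightarrow> c) F" "(g \<longlongrightarrow> a) F"
  shows "((\<lambda>x. f x *\<^sub>R g x) \<longlongrightarrow> c *\<^sub>R a) F"
  using filterlim_compose[OF tendsto_scaleR_Pair[of c a], of "\<lambda>x. (f x, g x)" F] assms
  by (simp add: filterlim_Pair)

lemma continuous_on_scaleR_tvs:
  "continuous_on UNIV (\<lambda>x::'a::locally_convex_tvs. c *\<^sub>R x)"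
  by (auto simp: continuous_on_def intro!: tendsto_scaleR_tvs)

lemma continuous_on_add_tvs:
  "continuous_on UNIV (\<lambda>x::'a::locally_convex_tvs. a + x)"
  by (auto simp: continuous_on_def intro!: tendsto_add)

lemma open_scaleR_tvs:
  fixes U :: "'a::locally_convex_tvs set"
  assumes "open U" "c \<noteq> 0" shows "open {x. c *\<^sub>R x \<in> U}"
  using open_vimage[OF assms(1) continuous_on_scaleR_tvs[of c]] by (simp add: vimage_def)

lemma linear_bounded_above_continuous:
  fixes f :: "'a::locally_convex_tvs \<Rightarrow> real"
  assumes f: "linear f" and W: "open W" "0 \<in> W" "\<And>x. x \<in> W \<Longrightarrow> \<bar>f x\<bar> \<le> 1"
  shows "continuous_on UNIV f"
proof -
  have "f \<midarrow>x\<rightarrow> f x" for x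
  proof (rule tendstoI)
    fix e :: real assume e: "0 < e"
    \<comment> \<open>The factor \<open>2 / e\<close> turns the bound 1 on \<open>W\<close> into
      \<open>e / 2\<close>, which is strictly below \<open>e\<close>.\<close>
    define U where "U = {y. (2 / e) *\<^sub>R (- x + y) \<in> W}"
    have "open ((\<lambda>y. - x + y) -` {z. (2 / e) *\<^sub>R z \<in> W})"
      using e W(1) by (intro open_vimage open_scaleR_tvs continuous_on_add_tvs) auto
    then have "open U" by (simp add: U_def vimage_def)
    moreover have "x \<in> U" using W by (simp add: U_def)
    moreover have "dist (f y) (f x) < e" if "y \<in> U" for y
    proof -
      have "\<bar>f ((2 / e) *\<^sub>R (- x + y))\<bar> \<le> 1" using that W by (simp add: U_def)
      also have "f ((2 / e) *\<^sub>R (- x + y)) = (2 / e) * (f y - f x)"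
        by (simp add: linear_scale[OF f] linear_diff[OF f])
      finally show ?thesis using e by (simp add: abs_mult dist_real_def field_simps)
    qed
    ultimately show "\<forall>\<^sub>F y in at x. dist (f y) (f x) < e"
      unfolding eventually_at_topological by blast
  qed
  then show ?thesis by (auto simp: continuous_on_def)
qed

text \<open>Geometric Hahn-Banach: \<open>p\<close> below is the Minkowski gauge of a convex
  neighbourhood \<open>W0\<close> of 0 that misses \<open>x\<close>, so \<open>p x\<close> is at
  least 1 and the dominated functional with \<open>f x = p x\<close> does not vanish at
  \<open>x\<close>. Domination by \<open>p\<close> bounds \<open>f\<close> from above only, so
  continuity is read off the symmetric set of those \<open>y\<close> for which \<open>y\<close> and
  \<open>- y\<close> lie in \<open>W0\<close>.\<close>

theorem top_dual_separates:
  fixes x :: "'a::locally_convex_tvs"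
  assumes H: "Hausdorff_space (euclidean :: 'a topology)" and x: "x \<noteq> 0"
  shows "\<exists>\<phi>\<in>top_dual. \<phi> x \<noteq> 0"
proof -
  obtain U V :: "'a set" where UV: "open U" "open V" "x \<in> V" "0 \<in> U" "U \<inter> V = {}"
    using H x unfolding Hausdorff_space_def disjnt_def by (metis UNIV_I open_openin topspace_euclidean)
  obtain W0 where W0: "open W0" "convex W0" "0 \<in> W0" "W0 \<subseteq> U"
    using convex_nhds_base[of U] UV by auto
  have abs: "\<exists>t>0. inverse t *\<^sub>R y \<in> W0" for y
  proof -
    have "((\<lambda>s. s *\<^sub>R y) \<longlongrightarrow> 0 *\<^sub>R y) (at_right 0)"
      by (intro tendsto_scaleR_tvs tendsto_const tendsto_ident_at)
    then have "\<forall>\<^sub>F s in at_right 0. s *\<^sub>R y \<in> W0" using W0 by (simp add: tendsto_def)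
    moreover have "\<forall>\<^sub>F s in at_right (0::real). 0 < s" by (simp add: eventually_at_right_less)
    ultimately have "\<forall>\<^sub>F s in at_right (0::real). 0 < s \<and> s *\<^sub>R y \<in> W0" by eventually_elim auto
    then obtain s :: real where "0 < s" "s *\<^sub>R y \<in> W0"
      using eventually_happens'[OF trivial_limit_at_right_real] by blast
    then show ?thesis by (intro exI[of _ "inverse s"]) auto
  qed
  define S where "S y = {t. 0 < t \<and> inverse t *\<^sub>R y \<in> W0}" for y
  define p where "p y = Inf (S y)" for y
  have Sne: "S y \<noteq> {}" for y using abs[of y] by (auto simp: S_def)
  have Sbdd: "bdd_below (S y)" for y by (auto simp: S_def intro!: bdd_belowI[of _ 0])
  have le: "p y \<le> t" if "0 < t" "inverse t *\<^sub>R y \<in> W0" for y t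
    unfolding p_def using that Sbdd by (intro cInf_lower) (auto simp: S_def)
  have ge: "m \<le> p y" if "\<And>t. 0 < t \<Longrightarrow> inverse t *\<^sub>R y \<in> W0 \<Longrightarrow> m \<le> t" for y m
    unfolding p_def using that Sne by (intro cInf_greatest) (auto simp: S_def)
  have sub: "sublinear p"
  proof (rule sublinearI)
    fix v w
    have "p (v + w) - t \<le> p w" if t: "0 < t" "inverse t *\<^sub>R v \<in> W0" for t
    proof (rule ge)
      fix u :: real assume u: "0 < u" "inverse u *\<^sub>R w \<in> W0"
      have "(t / (t + u)) *\<^sub>R (inverse t *\<^sub>R v) + (u / (t + u)) *\<^sub>R (inverse u *\<^sub>R w) \<in> W0"
        using t u by (intro convexD[OF W0(2)]) (auto simp flip: add_divide_distrib)
      also have "(t / (t + u)) *\<^sub>R (inverse t *\<^sub>R v) + (u / (t + u)) *\<^sub>R (inverse u *\<^sub>R w)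
          = inverse (t + u) *\<^sub>R (v + w)"
      proof -
        have "t / (t + u) * inverse t = inverse (t + u)" "u / (t + u) * inverse u = inverse (t + u)"
          using t u by (simp_all add: field_simps)
        then show ?thesis by (simp only: scaleR_scaleR scaleR_right_distrib)
      qed
      finally have "p (v + w) \<le> t + u" using t u by (intro le) auto
      then show "p (v + w) - t \<le> u" by simp
    qed
    then have "p (v + w) - p w \<le> p v"
      by (intro ge) (simp add: algebra_simps)
    then show "p (v + w) \<le> p v + p w" by simp
  next
    fix v and s :: real assume s: "0 < s"
    have "p (s *\<^sub>R v) / s \<le> p v"
    proof (rule ge)
      fix t :: real assume t: "0 < t" "inverse t *\<^sub>R v \<in> W0"
      have "p (s *\<^sub>R v) \<le> s * t" using s t by (intro le) (auto simp: field_simps)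
      then show "p (s *\<^sub>R v) / s \<le> t" using s by (simp add: field_simps)
    qed
    then show "p (s *\<^sub>R v) \<le> s * p v" using s by (simp add: field_simps)
  qed
  obtain f where f: "linear f" "\<And>v. f v \<le> p v" "f x = p x" using hahn_banach[OF sub, of x] by blast
  have "1 \<le> p x"
  proof (rule ge)
    fix t :: real assume t: "0 < t" "inverse t *\<^sub>R x \<in> W0"
    show "1 \<le> t"
    proof (rule ccontr)
      assume "\<not> 1 \<le> t"
      then have "t *\<^sub>R (inverse t *\<^sub>R x) + (1 - t) *\<^sub>R 0 \<in> W0"
        using t W0 by (intro convexD[OF W0(2)]) auto
      then show False using t W0 UV by auto
    qed
  qed
  moreover have "continuous_on UNIV f"
  proof (rule linear_bounded_above_continuous[OF f(1)])
    show "open (W0 \<inter> {x. (-1) *\<^sub>R x \<in> W0})" by (intro open_Int open_scaleR_tvs W0) auto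
    fix y assume "y \<in> W0 \<inter> {x. (-1) *\<^sub>R x \<in> W0}"
    then have "p y \<le> 1" "p (- y) \<le> 1" by (auto intro!: le)
    then show "\<bar>f y\<bar> \<le> 1" using f(2)[of y] f(2)[of "- y"] by (simp add: linear_neg[OF f(1)])
  qed (use W0 in auto)
  ultimately show ?thesis using f by (intro bexI[of _ f]) (auto simp: top_dual_def)
qed

section \<open>Lusin separation and the Borel sets of a Souslin space\<close>

definition borel_separated :: "'a::topological_space set \<Rightarrow> 'a set \<Rightarrow> bool" where
  "borel_separated A B \<longleftrightarrow> (\<exists>S\<in>sets borel. A \<subseteq> S \<and> B \<inter> S = {})"

text \<open>For fixed \<open>i\<close> the separating sets are intersected over \<open>j\<close>,
  and the results are united over \<open>i\<close>. Read contrapositively, two inseparable countable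
  unions contain an inseparable pair of pieces; this drives the recursion in Lusin's
  theorem.\<close>

lemma borel_separated_UN:
  assumes "countable I" "countable J" "\<And>i j. i \<in> I \<Longrightarrow> j \<in> J \<Longrightarrow> borel_separated (A i) (B j)"
  shows "borel_separated (\<Union>i\<in>I. A i) (\<Union>j\<in>J. B j)"
proof (cases "J = {}")
  case True
  then show ?thesis by (auto simp: borel_separated_def intro!: bexI[of _ UNIV])
next
  case False
  have "\<forall>i\<in>I. \<forall>j\<in>J. \<exists>S\<in>sets borel. A i \<subseteq> S \<and> B j \<inter> S = {}"
    using assms(3) by (auto simp: borel_separated_def)
  then obtain S where S: "\<And>i j. i \<in> I \<Longrightarrow> j \<in> J \<Longrightarrow> S i j \<in> sets borel"
      "\<And>i j. i \<in> I \<Longrightarrow> j \<in> J \<Longrightarrow> A i \<subseteq> S i j" "\<And>i j. i \<in> I \<Longrightarrow> j \<in> J \<Longrightarrow> B j \<inter> S i j = {}"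
    by metis
  have "(\<Union>i\<in>I. \<Inter>j\<in>J. S i j) \<in> sets borel"
    using assms(1,2) False S(1)
    by (intro sets.countable_UN'[OF assms(1)] sets.countable_INT''[OF _ assms(2)] image_subsetI) auto
  moreover have "(\<Union>i\<in>I. A i) \<subseteq> (\<Union>i\<in>I. \<Inter>j\<in>J. S i j)" using S(2) by blast
  moreover have "(\<Union>j\<in>J. B j) \<inter> (\<Union>i\<in>I. \<Inter>j\<in>J. S i j) = {}" using S(3) by blast
  ultimately show ?thesis unfolding borel_separated_def by blast
qed

context Metric_space
begin

text \<open>Cantor's intersection argument. Diameters of at most \<open>2 / (n + 1)\<close> bring
  not only a point but a whole set \<open>A n\<close> into any given neighbourhood of the limit, and
  this is what the separation argument needs.\<close>

lemma closed_contains_small_limit: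
  assumes comp: mcomplete and A: "\<And>n. closedin mtopology (A n)" "\<And>n. A (Suc n) \<subseteq> A n" "\<And>n. A n \<noteq> {}"
    and p: "\<And>n. A (Suc n) \<subseteq> mcball (p n) (inverse (Suc n))"
  shows "\<exists>a. (\<forall>n. a \<in> A n) \<and> (\<forall>U. openin mtopology U \<longrightarrow> a \<in> U \<longrightarrow> (\<exists>n. A n \<subseteq> U))"
proof -
  obtain x where x: "\<And>n. x n \<in> A n" using A(3) choice[of "\<lambda>n y. y \<in> A n"] by auto
  have AM: "A n \<subseteq> M" for n using A(1)[of n] closedin_subset by fastforce
  have mono: "A m \<subseteq> A n" if "n \<le> m" for m n by (rule lift_Suc_antimono_le[of A, OF _ that]) (rule A(2))
  have close: "d y z \<le> 2 * inverse (Suc n)" if "y \<in> A (Suc n)" "z \<in> A (Suc n)" for y z n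
  proof -
    have "y \<in> mcball (p n) (inverse (Suc n))" "z \<in> mcball (p n) (inverse (Suc n))"
      using p[of n] that by auto
    then show ?thesis using triangle[of y "p n" z] commute[of y "p n"] by (simp; linarith)
  qed
  have small: "\<exists>n. \<forall>y\<in>A (Suc n). \<forall>z\<in>A (Suc n). d y z < e" if e: "0 < e" for e
  proof -
    obtain n where "inverse (real (Suc n)) < e / 2" using reals_Archimedean[of "e / 2"] e by auto
    then show ?thesis using close by (intro exI[of _ n]) fastforce
  qed
  have "MCauchy x"
    unfolding MCauchy_def
  proof (intro conjI allI impI)
    show "range x \<subseteq> M" using x AM by blast
    fix e :: real assume "0 < e"
    then obtain n where "\<forall>y\<in>A (Suc n). \<forall>z\<in>A (Suc n). d y z < e" using small by blast
    then show "\<exists>N. \<forall>n n'. N \<le> n \<longrightarrow> N \<le> n' \<longrightarrow> d (x n) (x n') < e"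
      using x mono by (intro exI[of _ "Suc n"]) blast
  qed
  then obtain a where a: "limitin mtopology x a sequentially" using comp by (auto simp: mcomplete_def)
  have aA: "a \<in> A n" for n
  proof (rule limitin_closedin[OF a A(1)])
    show "\<forall>\<^sub>F k in sequentially. x k \<in> A n"
      using x mono by (intro eventually_sequentiallyI[of n]) blast
  qed simp
  moreover have "\<exists>n. A n \<subseteq> U" if U: "openin mtopology U" "a \<in> U" for U
  proof -
    obtain r where r: "r > 0" "mball a r \<subseteq> U" using U openin_mtopology by blast
    obtain n where n: "\<forall>y\<in>A (Suc n). \<forall>z\<in>A (Suc n). d y z < r" using small[OF r(1)] by blast
    then have "A (Suc n) \<subseteq> mball a r" using aA AM by (auto simp: subset_iff)
    then show ?thesis using r by blast
  qed
  ultimately show ?thesis by blast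
qed

text \<open>If the images were inseparable, cutting both sets by countably many balls of radius
  \<open>1 / (n + 1)\<close> would leave an inseparable pair of pieces at every stage. The pieces
  shrink to points \<open>a\<close> and \<open>b\<close> with \<open>f a \<noteq> g b\<close>. By
  continuity, disjoint open neighbourhoods of these two values separate the images of a late pair, a
  contradiction.\<close>

theorem lusin_separation:
  fixes f g :: "'a \<Rightarrow> 'b::t2_space"
  assumes comp: mcomplete and D: "countable D" "D \<subseteq> M" "\<And>x r. x \<in> M \<Longrightarrow> 0 < r \<Longrightarrow> \<exists>p\<in>D. d p x < r"
    and A0: "closedin mtopology A0" and B0: "closedin mtopology B0"
    and f: "continuous_map mtopology euclidean f" and g: "continuous_map mtopology euclidean g"
    and disj: "f ` A0 \<inter> g ` B0 = {}"
  shows "borel_separated (f ` A0) (g ` B0)"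
proof (rule ccontr)
  assume nsep: "\<not> borel_separated (f ` A0) (g ` B0)"
  define P where "P AB \<longleftrightarrow> closedin mtopology (fst AB) \<and> closedin mtopology (snd AB) \<and>
    \<not> borel_separated (f ` fst AB) (g ` snd AB)" for AB
  have step: "\<exists>AB'. P AB' \<and> (\<exists>p q. fst AB' = fst AB \<inter> mcball p (inverse (Suc n)) \<and>
      snd AB' = snd AB \<inter> mcball q (inverse (Suc n)))" if "P AB" for AB and n :: nat
  proof -
    define r where "r = inverse (real (Suc n))"
    have r: "0 < r" by (simp add: r_def)
    have cov: "C = (\<Union>p\<in>D. C \<inter> mcball p r)" if "closedin mtopology C" for C
      using closedin_subset[OF that] D(2) D(3)[OF _ r] by (fastforce simp: less_imp_le)
    obtain A B where AB: "AB = (A, B)" by (cases AB)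
    have cl: "closedin mtopology A" "closedin mtopology B" using that AB by (auto simp: P_def)
    have eq: "f ` A = (\<Union>p\<in>D. f ` (A \<inter> mcball p r))" "g ` B = (\<Union>q\<in>D. g ` (B \<inter> mcball q r))"
      using cov[OF cl(1)] cov[OF cl(2)] by blast+
    have "\<exists>p\<in>D. \<exists>q\<in>D. \<not> borel_separated (f ` (A \<inter> mcball p r)) (g ` (B \<inter> mcball q r))"
    proof (rule ccontr)
      assume "\<not> ?thesis"
      then have "borel_separated (\<Union>p\<in>D. f ` (A \<inter> mcball p r)) (\<Union>q\<in>D. g ` (B \<inter> mcball q r))"
        using D(1) by (intro borel_separated_UN) auto
      then show False using that eq by (simp add: P_def AB)
    qed
    then obtain p q where "\<not> borel_separated (f ` (A \<inter> mcball p r)) (g ` (B \<inter> mcball q r))" by blast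
    then show ?thesis
      using cl by (intro exI[of _ "(A \<inter> mcball p r, B \<inter> mcball q r)"]) (auto simp: P_def AB r_def)
  qed
  have "\<exists>C. \<forall>n. (P (C n) \<and> (n = 0 \<longrightarrow> C n = (A0, B0))) \<and>
      (\<exists>p q. fst (C (Suc n)) = fst (C n) \<inter> mcball p (inverse (Suc n)) \<and>
      snd (C (Suc n)) = snd (C n) \<inter> mcball q (inverse (Suc n)))"
  proof (rule dependent_nat_choice)
    show "\<exists>C. P C \<and> (0 = 0 \<longrightarrow> C = (A0, B0))"
      using A0 B0 nsep by (auto simp: P_def)
    fix C and n :: nat assume "P C \<and> (n = 0 \<longrightarrow> C = (A0, B0))"
    then obtain C' where "P C'" "\<exists>p q. fst C' = fst C \<inter> mcball p (inverse (Suc n)) \<and>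
        snd C' = snd C \<inter> mcball q (inverse (Suc n))"
      using step[of C n] by blast
    then show "\<exists>C'. (P C' \<and> (Suc n = 0 \<longrightarrow> C' = (A0, B0))) \<and>
      (\<exists>p q. fst C' = fst C \<inter> mcball p (inverse (Suc n)) \<and>
        snd C' = snd C \<inter> mcball q (inverse (Suc n)))" by blast
  qed
  then obtain C where C: "\<And>n. P (C n)" "C 0 = (A0, B0)"
      "\<And>n. \<exists>p q. fst (C (Suc n)) = fst (C n) \<inter> mcball p (inverse (Suc n)) \<and>
      snd (C (Suc n)) = snd (C n) \<inter> mcball q (inverse (Suc n))"
    by metis
  obtain p q where pq: "\<And>n. fst (C (Suc n)) = fst (C n) \<inter> mcball (p n) (inverse (Suc n))"
      "\<And>n. snd (C (Suc n)) = snd (C n) \<inter> mcball (q n) (inverse (Suc n))"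
    using C(3) by metis
  have ne: "fst (C n) \<noteq> {}" "snd (C n) \<noteq> {}" for n
    using C(1)[of n] by (auto simp: P_def borel_separated_def)
  obtain a where a: "\<And>n. a \<in> fst (C n)"
      "\<And>U. openin mtopology U \<Longrightarrow> a \<in> U \<Longrightarrow> \<exists>n. fst (C n) \<subseteq> U"
    using closed_contains_small_limit[OF comp, of "\<lambda>n. fst (C n)" p] C(1) pq ne by (auto simp: P_def)
  obtain b where b: "\<And>n. b \<in> snd (C n)"
      "\<And>U. openin mtopology U \<Longrightarrow> b \<in> U \<Longrightarrow> \<exists>n. snd (C n) \<subseteq> U"
    using closed_contains_small_limit[OF comp, of "\<lambda>n. snd (C n)" q] C(1) pq ne by (auto simp: P_def)
  have "a \<in> A0" "b \<in> B0" using a(1)[of 0] b(1)[of 0] C(2) by auto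
  then have "f a \<noteq> g b" and abM: "a \<in> M" "b \<in> M"
    using disj closedin_subset[OF A0] closedin_subset[OF B0] by auto
  then obtain S T where ST: "open S" "open T" "f a \<in> S" "g b \<in> T" "S \<inter> T = {}"
    using hausdorff by metis
  have "openin mtopology {x \<in> M. f x \<in> S}" "openin mtopology {x \<in> M. g x \<in> T}"
    using f g ST by (auto simp: continuous_map)
  then obtain m n where mn: "fst (C m) \<subseteq> {x \<in> M. f x \<in> S}" "snd (C n) \<subseteq> {x \<in> M. g x \<in> T}"
    using a(2) b(2) ST abM by (metis (no_types, lifting) mem_Collect_eq)
  have "fst (C (max m n)) \<subseteq> fst (C m)" "snd (C (max m n)) \<subseteq> snd (C n)"
    using lift_Suc_antimono_le[of "\<lambda>n. fst (C n)" m "max m n"]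
      lift_Suc_antimono_le[of "\<lambda>n. snd (C n)" n "max m n"] pq by auto
  then have "borel_separated (f ` fst (C (max m n))) (g ` snd (C (max m n)))"
    unfolding borel_separated_def using ST mn by (intro bexI[of _ S]) auto
  then show False using C(1) by (simp add: P_def)
qed

end

lemma souslin_spaceE:
  assumes "souslin_space (euclidean :: 'a::topological_space topology)"
  obtains M :: "real set" and d D and f :: "real \<Rightarrow> 'a::topological_space"
  where "Metric_space M d" "Metric_space.mcomplete M d" "countable D" "D \<subseteq> M"
    "\<And>x r. x \<in> M \<Longrightarrow> 0 < r \<Longrightarrow> \<exists>p\<in>D. d p x < r"
    "continuous_map (Metric_space.mtopology M d) euclidean f" "f ` M = UNIV"
proof -
  obtain m :: "real metric" and f :: "real \<Rightarrow> 'a" where m: "mcomplete_of m"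
      "separable_space (mtopology_of m)" "continuous_map (mtopology_of m) euclidean f" "f ` mspace m = UNIV"
    using assms by (auto simp: souslin_space_def)
  interpret Metric_space "mspace m" "mdist m" by (rule Metric_space_mspace_mdist)
  obtain D where D: "countable D" "D \<subseteq> mspace m" "mtopology closure_of D = mspace m"
    using m(2) by (auto simp: separable_space_def mtopology_of_def)
  have "\<exists>p\<in>D. mdist m p x < r" if "x \<in> mspace m" "0 < r" for x r
  proof -
    have "x \<in> mtopology closure_of D" using D that by simp
    then have "\<exists>y\<in>D. y \<in> mball x r" using that by (auto simp: metric_closure_of)
    then show ?thesis by (auto simp: commute)
  qed
  then show thesis
    using m D by (intro that[of "mspace m" "mdist m" D f]) (auto simp: mcomplete_of_def mtopology_of_def)
qed

text \<open>Open and closed sets pull back to F-sigma sets of the parametrizing metric space. Both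
  images are thus countable unions of images of closed sets, and Lusin's theorem applies to each
  pair.\<close>

lemma souslin_borel_separated:
  fixes g :: "'a::topological_space \<Rightarrow> 'b::t2_space"
  assumes S: "souslin_space (euclidean :: 'a::topological_space topology)" and g: "continuous_on UNIV g"
    and A: "open A \<or> closed A" and B: "open B \<or> closed B" and disj: "g ` A \<inter> g ` B = {}"
  shows "borel_separated (g ` A) (g ` B)"
proof -
  obtain M :: "real set" and d D and f :: "real \<Rightarrow> 'a"
    where MS: "Metric_space M d" and comp: "Metric_space.mcomplete M d" and D: "countable D" "D \<subseteq> M"
      "\<And>x r. x \<in> M \<Longrightarrow> 0 < r \<Longrightarrow> \<exists>p\<in>D. d p x < r"
      and f: "continuous_map (Metric_space.mtopology M d) euclidean f" "f ` M = UNIV"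
    using S by (rule souslin_spaceE) blast
  interpret Metric_space M d by fact
  have fsigma: "\<exists>C. (\<forall>n::nat. closedin mtopology (C n)) \<and> \<Union> (range C) = {x \<in> M. f x \<in> A}"
    if "open A \<or> closed A" for A
  proof -
    have "openin mtopology {x \<in> M. f x \<in> A} \<or> closedin mtopology {x \<in> M. f x \<in> A}"
      using that f(1) openin_continuous_map_preimage[OF f(1), of A]
        closedin_continuous_map_preimage[OF f(1), of A] by auto
    then have "fsigma_in mtopology {x \<in> M. f x \<in> A}"
      using open_imp_fsigma_in closed_imp_fsigma_in metrizable_space_mtopology by blast
    then show ?thesis unfolding fsigma_in_ascending by blast
  qed
  obtain C where C: "\<And>n::nat. closedin mtopology (C n)" "\<Union> (range C) = {x \<in> M. f x \<in> A}"
    using fsigma[OF A] by blast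
  obtain E where E: "\<And>n::nat. closedin mtopology (E n)" "\<Union> (range E) = {x \<in> M. f x \<in> B}"
    using fsigma[OF B] by blast
  have img: "g ` A = (\<Union>n. (g \<circ> f) ` C n)" if "\<Union> (range C) = {x \<in> M. f x \<in> A}" for A and C :: "nat \<Rightarrow> _"
  proof -
    have "(\<Union>n. (g \<circ> f) ` C n) = (g \<circ> f) ` \<Union> (range C)" by blast
    also have "\<dots> = g ` (f ` {x \<in> M. f x \<in> A})" by (simp add: that image_comp)
    also have "f ` {x \<in> M. f x \<in> A} = A" using f(2) by (auto simp: image_iff set_eq_iff) metis
    finally show ?thesis by simp
  qed
  have gf: "continuous_map mtopology euclidean (g \<circ> f)"
    using f(1) g by (intro continuous_map_compose) auto
  have "borel_separated (\<Union>n. (g \<circ> f) ` C n) (\<Union>n. (g \<circ> f) ` E n)"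
  proof (rule borel_separated_UN)
    fix m n
    have "C m \<subseteq> {x \<in> M. f x \<in> A}" "E n \<subseteq> {x \<in> M. f x \<in> B}" using C(2) E(2) by blast+
    then show "borel_separated ((g \<circ> f) ` C m) ((g \<circ> f) ` E n)"
      using disj by (intro lusin_separation[OF comp D C(1) E(1) gf gf]) auto
  qed auto
  then show ?thesis using img[OF C(2)] img[OF E(2)] by simp
qed

text \<open>A Lindelof argument: for every pair of base balls of the parametrizing space on whose
  images some element of \<open>V\<close> is strictly ordered, one such element is kept. Continuity
  and a threshold between \<open>\<phi> x\<close> and \<open>\<phi> y\<close> provide such a pair of
  balls around preimages of \<open>x\<close> and \<open>y\<close>, so the element kept for it
  separates them as well.\<close>

lemma souslin_countable_separating:
  fixes V :: "('a::topological_space \<Rightarrow> real) set"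
  assumes S: "souslin_space (euclidean :: 'a::topological_space topology)"
    and V: "\<And>\<phi>. \<phi> \<in> V \<Longrightarrow> continuous_on UNIV \<phi>" "\<And>x y. x \<noteq> y \<Longrightarrow> \<exists>\<phi>\<in>V. \<phi> x < \<phi> y"
    and ne: "V \<noteq> {}"
  shows "\<exists>\<phi>::nat \<Rightarrow> _. range \<phi> \<subseteq> V \<and> (\<forall>x y. x \<noteq> y \<longrightarrow> (\<exists>n. \<phi> n x \<noteq> \<phi> n y))"
proof -
  obtain M :: "real set" and d D and f :: "real \<Rightarrow> 'a"
    where MS: "Metric_space M d" and D: "countable D" "D \<subseteq> M"
      "\<And>x r. x \<in> M \<Longrightarrow> 0 < r \<Longrightarrow> \<exists>p\<in>D. d p x < r"
      and f: "continuous_map (Metric_space.mtopology M d) euclidean f" "f ` M = UNIV"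
    using S by (rule souslin_spaceE) blast
  interpret Metric_space M d by fact
  define B where "B = (\<lambda>(p, n::nat). mball p (inverse (Suc n))) ` (D \<times> UNIV)"
  have B: "countable B" using D(1) by (auto simp: B_def)
  have Bbase: "\<exists>b\<in>B. x \<in> b \<and> b \<subseteq> U" if U: "openin mtopology U" "x \<in> U" for x U
  proof -
    obtain r where r: "r > 0" "mball x r \<subseteq> U" "x \<in> M" using U openin_mtopology by blast
    obtain n where n: "inverse (Suc n) < r / 2" using reals_Archimedean[of "r / 2"] r by auto
    obtain p where p: "p \<in> D" "d p x < inverse (Suc n)" using D(3)[of x "inverse (Suc n)"] r by auto
    have "x \<in> mball p (inverse (Suc n))" using p D(2) r by auto
    moreover have "mball p (inverse (Suc n)) \<subseteq> mball x r"
    proof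
      fix y assume "y \<in> mball p (inverse (Suc n))"
      then show "y \<in> mball x r"
        using triangle[of x p y] p(2) n r(3) commute[of x p] by simp
    qed
    ultimately show ?thesis using p r by (intro bexI[of _ "mball p (inverse (Suc n))"]) (auto simp: B_def)
  qed
  define ok where "ok b b' \<phi> \<longleftrightarrow> \<phi> \<in> V \<and> (\<forall>x\<in>b. \<forall>y\<in>b'. \<phi> (f x) < \<phi> (f y))" for b b' \<phi>
  \<comment> \<open>The second branch is a default that makes \<open>F\<close> total and keeps the
    countable family inside \<open>V\<close>.\<close>
  define F where "F b b' = (if Ex (ok b b') then SOME \<phi>. ok b b' \<phi> else SOME \<phi>. \<phi> \<in> V)" for b b'
  have FV: "F b b' \<in> V" for b b'
  proof (cases "Ex (ok b b')")
    case True
    then show ?thesis using someI_ex[of "ok b b'"] by (simp add: F_def) (simp add: ok_def)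
  qed (use some_in_eq[of V] ne in \<open>auto simp: F_def\<close>)
  define W where "W = (\<lambda>(b, b'). F b b') ` (B \<times> B)"
  have W: "countable W" "W \<subseteq> V" using B FV by (auto simp: W_def)
  have sep: "\<exists>\<phi>\<in>W. \<phi> x \<noteq> \<phi> y" if xy: "x \<noteq> y" for x y
  proof -
    obtain \<phi> where phi: "\<phi> \<in> V" "\<phi> x < \<phi> y" using V(2)[OF xy] by blast
    define r where "r = (\<phi> x + \<phi> y) / 2"
    have r: "\<phi> x < r" "r < \<phi> y" using phi by (auto simp: r_def)
    obtain s t where st: "s \<in> M" "t \<in> M" "f s = x" "f t = y" using f(2) by (metis UNIV_I imageE)
    have "continuous_map mtopology euclidean (\<phi> \<circ> f)"
      using f(1) V(1)[OF phi(1)] by (intro continuous_map_compose) auto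
    then have op: "openin mtopology {x \<in> M. (\<phi> \<circ> f) x \<in> T}" if "open T" for T
      using that by (auto simp: continuous_map)
    obtain b where b: "b \<in> B" "s \<in> b" "b \<subseteq> {x \<in> M. (\<phi> \<circ> f) x \<in> {..<r}}"
      using Bbase[OF op[of "{..<r}"], of s] st r by auto
    obtain b' where b': "b' \<in> B" "t \<in> b'" "b' \<subseteq> {x \<in> M. (\<phi> \<circ> f) x \<in> {r<..}}"
      using Bbase[OF op[of "{r<..}"], of t] st r by auto
    have "ok b b' \<phi>" using b b' phi by (fastforce simp: ok_def)
    then have "ok b b' (F b b')" using someI_ex[of "ok b b'"] by (auto simp: F_def)
    then have "F b b' x \<noteq> F b b' y" using b b' st by (fastforce simp: ok_def)
    then show ?thesis using b b' by (auto simp: W_def)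
  qed
  show ?thesis
  proof (cases "W = {}")
    case True
    then show ?thesis using sep ne by (intro exI[of _ "\<lambda>_. SOME \<phi>. \<phi> \<in> V"]) (auto simp: some_in_eq)
  next
    case False
    then show ?thesis
      using range_from_nat_into[OF False W(1)] W(2) sep
      by (intro exI[of _ "from_nat_into W"]) (metis imageE)
  qed
qed

text \<open>Together the functionals form a continuous injection \<open>T\<close> into the space of
  real sequences. It sends an open set and its complement to disjoint sets, and the preimage of a
  Borel set separating these is exactly the open set.\<close>

lemma souslin_borel_generated:
  fixes \<phi> :: "nat \<Rightarrow> 'a::topological_space \<Rightarrow> real"
  assumes S: "souslin_space (euclidean :: 'a::topological_space topology)"
    and c: "\<And>n. continuous_on UNIV (\<phi> n)" and sep: "\<And>x y. x \<noteq> y \<Longrightarrow> \<exists>n. \<phi> n x \<noteq> \<phi> n y"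
  shows "sets (borel :: 'a measure) = sigma_sets UNIV {\<phi> n -` S | n S. S \<in> sets borel}" (is "_ = ?R")
proof
  define T where "T x = (\<lambda>n. \<phi> n x)" for x
  have T: "continuous_on UNIV T" unfolding T_def by (intro continuous_on_coordinatewise_then_product c)
  interpret R: sigma_algebra UNIV ?R by (rule sigma_algebra_sigma_sets) auto
  have Tm: "T \<in> measurable (sigma UNIV ?R) borel"
  proof -
    have "T \<in> measurable (sigma UNIV ?R) (PiM UNIV (\<lambda>_. borel))"
    proof (rule measurable_PiM_single')
      fix i
      show "(\<lambda>x. T x i) \<in> borel_measurable (sigma UNIV ?R)"
        unfolding T_def by (rule measurableI) (auto simp: space_measure_of_conv)
    qed (auto simp: space_measure_of_conv)
    then show ?thesis using measurable_cong_sets[OF refl sets_PiM_equal_borel, of "sigma UNIV ?R"] by blast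
  qed
  show "sets borel \<subseteq> ?R"
  proof -
    have "U \<in> ?R" if U: "open U" for U :: "'a set"
    proof -
      have "inj T" using sep unfolding inj_def T_def fun_eq_iff by blast
      then have "T ` U \<inter> T ` (- U) = {}" by (auto simp: inj_def)
      then have "borel_separated (T ` U) (T ` (- U))"
        using U by (intro souslin_borel_separated[OF S T]) (auto simp: closed_def)
      then obtain E where E: "E \<in> sets borel" "T ` U \<subseteq> E" "T ` (- U) \<inter> E = {}"
        by (auto simp: borel_separated_def)
      then have "U = T -` E" by blast
      also have "\<dots> \<in> sets (sigma UNIV ?R)"
        using measurable_sets[OF Tm E(1)] by (simp add: space_measure_of_conv)
      finally show ?thesis by (simp add: R.sets_measure_of_eq)
    qed
    then have "sigma_sets UNIV {U :: 'a set. open U} \<subseteq> ?R"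
      by (intro R.sigma_sets_subset) auto
    moreover have "sets borel = sigma_sets UNIV {U :: 'a set. open U}" by (simp add: borel_def)
    ultimately show ?thesis by simp
  qed
  have "\<phi> n -` S \<in> sets borel" if "S \<in> sets borel" for n S
    using measurable_sets[OF borel_measurable_continuous_onI[OF c] that] by simp
  then show "?R \<subseteq> sets borel"
    using sets.sigma_sets_subset[of "{\<phi> n -` S | n S. S \<in> sets borel}" borel] by auto
qed

section \<open>Characteristic functionals\<close>

text \<open>Levy's uniqueness theorem concerns probability measures. The common mass is read off at
  \<open>t = 0\<close> and divided out; mass zero is treated apart.\<close>

lemma finite_measure_eqI_cos_sin:
  fixes M N :: "real measure"
  assumes M: "finite_measure M" "sets M = sets borel" and N: "finite_measure N" "sets N = sets borel"
    and c: "\<And>t. (\<integral>x. cos (t * x) \<partial>M) = (\<integral>x. cos (t * x) \<partial>N)"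
    and s: "\<And>t. (\<integral>x. sin (t * x) \<partial>M) = (\<integral>x. sin (t * x) \<partial>N)"
  shows "M = N"
proof -
  interpret M: finite_measure M by fact
  interpret N: finite_measure N by fact
  have sp: "space M = UNIV" "space N = UNIV" using sets_eq_imp_space_eq[OF M(2)] sets_eq_imp_space_eq[OF N(2)] by simp_all
  define m where "m = measure M UNIV"
  have mN: "m = measure N UNIV" using c[of 0] by (simp add: m_def sp)
  show ?thesis
  proof (cases "m = 0")
    case True
    have "emeasure M A = emeasure N A" if "A \<in> sets M" for A
    proof -
      have "measure M A \<le> m" "measure N A \<le> m"
        using M.bounded_measure[of A] N.bounded_measure[of A] mN sp by (auto simp: m_def)
      then have "measure M A = 0" "measure N A = 0"
        using True measure_nonneg[of M A] measure_nonneg[of N A] by linarith+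
      then show ?thesis by (simp add: M.emeasure_eq_measure N.emeasure_eq_measure)
    qed
    then show ?thesis using M N by (intro measure_eqI) auto
  next
    case False
    then have m: "0 < m" using measure_nonneg[of M UNIV] by (simp add: m_def less_le)
    define D where "D K = density K (\<lambda>_. ennreal (1 / m))" for K :: "real measure"
    have D: "real_distribution (D K)" if "finite_measure K" "sets K = sets borel" "measure K UNIV = m" for K
    proof -
      interpret finite_measure K by fact
      have sp: "space K = UNIV" using sets_eq_imp_space_eq[OF that(2)] by simp
      have "emeasure (D K) (space (D K)) = ennreal (1 / m) * emeasure K UNIV"
        using sets.top[of K] unfolding D_def sp by (subst emeasure_density_const) (auto simp: sp)
      also have "\<dots> = 1" using m that(3) by (simp add: emeasure_eq_measure flip: ennreal_mult)
      finally have "prob_space (D K)" by (rule prob_spaceI)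
      then show ?thesis
        using that(2) sp by (simp add: real_distribution_def real_distribution_axioms_def D_def)
    qed
    have ch: "char (D K) t = complex_of_real ((\<integral>x. cos (t * x) \<partial>K) / m) + \<i> * complex_of_real ((\<integral>x. sin (t * x) \<partial>K) / m)"
      if K: "finite_measure K" "sets K = sets borel" for K t
    proof -
      interpret finite_measure K by fact
      have mb: "f \<in> borel_measurable K" if "f \<in> borel_measurable borel" for f :: "real \<Rightarrow> real"
        using that K(2) by (simp cong: measurable_cong_sets)
      have ic: "integrable K (\<lambda>x. cos (t * x))" and is_: "integrable K (\<lambda>x. sin (t * x))"
        by (auto intro!: integrable_const_bound[where B=1] mb)
      have "(CLINT x|D K. iexp (t * x)) = (CLINT x|K. (1 / m) *\<^sub>R iexp (t * x))"
      proof -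
        have "(\<lambda>x. iexp (t * x)) \<in> borel_measurable borel" by measurable
        then have "(\<lambda>x. iexp (t * x)) \<in> borel_measurable K"
          unfolding measurable_cong_sets[OF K(2) refl] .
        then show ?thesis unfolding D_def using m by (subst integral_density) simp_all
      qed
      also have "\<dots> = (1 / m) *\<^sub>R (CLINT x|K. iexp (t * x))" by simp
      also have "(CLINT x|K. iexp (t * x)) = (CLINT x|K. complex_of_real (cos (t * x)) + \<i> * complex_of_real (sin (t * x)))"
        by (intro Bochner_Integration.integral_cong refl) (simp only: exp_Euler flip: cos_of_real sin_of_real)
      also have "\<dots> = complex_of_real (\<integral>x. cos (t * x) \<partial>K) + \<i> * complex_of_real (\<integral>x. sin (t * x) \<partial>K)"
        using ic is_ by (subst Bochner_Integration.integral_add) auto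
      finally show ?thesis using m by (simp add: char_def scaleR_conv_of_real field_simps)
    qed
    have "D M = D N"
      using M N mN by (intro Levy_uniqueness D ext) (auto simp: ch c s m_def)
    then have eq: "ennreal (1 / m) * emeasure M A = ennreal (1 / m) * emeasure N A" if "A \<in> sets borel" for A
      using that M(2) N(2) emeasure_density_const[of A M "ennreal (1 / m)"]
        emeasure_density_const[of A N "ennreal (1 / m)"] by (simp add: D_def)
    show ?thesis
    proof (rule measure_eqI)
      fix A assume "A \<in> sets M"
      then have "ennreal m * (ennreal (1 / m) * emeasure M A) = ennreal m * (ennreal (1 / m) * emeasure N A)"
        using eq[of A] M(2) by simp
      moreover have "ennreal m * (ennreal (1 / m) * a) = a" for a
        using m by (simp flip: mult.assoc ennreal_mult)
      ultimately show "emeasure M A = emeasure N A" by simp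
    qed (use M N in simp)
  qed
qed

text \<open>The sets \<open>A\<close> on which the characteristic functionals (in terms of \<open>cos\<close> and \<open>sin\<close>) of the
  restricted measures agree are stable under intersection with
  \<open>{g \<in> S}\<close>: weight the one-dimensional law of \<open>g\<close> with the nonnegative functions \<open>1 + cos f\<close> and
  \<open>1 + sin f\<close> and use Levy's uniqueness theorem on the real line.\<close>

locale char_functional_eq =
  fixes P Q :: "'a measure" and V :: "('a \<Rightarrow> real) set"
  assumes P: "finite_measure P" and Q: "finite_measure Q" and sets_eq: "sets P = sets Q"
    and V_meas: "\<And>f. f \<in> V \<Longrightarrow> f \<in> borel_measurable P"
    and V_lin: "\<And>f g a b. f \<in> V \<Longrightarrow> g \<in> V \<Longrightarrow> (\<lambda>x. a * f x + b * g x) \<in> V"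
    and V_ne: "V \<noteq> {}"
    and V_gen: "sets P \<subseteq> sigma_sets (space P) {f -` S \<inter> space P | f S. f \<in> V \<and> S \<in> sets borel}"
    and cos_eq: "\<And>f. f \<in> V \<Longrightarrow> (\<integral>x. cos (f x) \<partial>P) = (\<integral>x. cos (f x) \<partial>Q)"
    and sin_eq: "\<And>f. f \<in> V \<Longrightarrow> (\<integral>x. sin (f x) \<partial>P) = (\<integral>x. sin (f x) \<partial>Q)"
begin

definition good :: "'a set \<Rightarrow> bool" where
  "good A \<longleftrightarrow> A \<in> sets P \<and> (\<forall>f\<in>V. (\<integral>x. indicator A x * cos (f x) \<partial>P) = (\<integral>x. indicator A x * cos (f x) \<partial>Q)
     \<and> (\<integral>x. indicator A x * sin (f x) \<partial>P) = (\<integral>x. indicator A x * sin (f x) \<partial>Q))"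

lemma meas_PQ: "f \<in> borel_measurable P \<longleftrightarrow> f \<in> borel_measurable Q"
  by (simp only: measurable_cong_sets[OF sets_eq refl])

lemma integrable_PQ:
  fixes w :: "'a \<Rightarrow> real"
  assumes "w \<in> borel_measurable P" "\<And>x. \<bar>w x\<bar> \<le> B"
  shows "integrable P w" "integrable Q w"
proof -
  have "w \<in> borel_measurable Q" using assms(1) meas_PQ by blast
  then show "integrable P w" "integrable Q w"
    using assms by (auto intro!: finite_measure.integrable_const_bound[OF P, of w B]
        finite_measure.integrable_const_bound[OF Q, of w B])
qed

text \<open>The image under \<open>g\<close> of the measure with density \<open>w\<close> is a
  finite measure on the line, and the last two hypotheses compare its characteristic functions.
  Nonnegativity makes \<open>w\<close> a density; the bound 2 is that of the weights
  \<open>1 + cos (f x)\<close> and \<open>1 + sin (f x)\<close>.\<close>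

lemma weighted_law_eq:
  assumes w: "w \<in> borel_measurable P" "\<And>x. 0 \<le> w x" "\<And>x. w x \<le> (2::real)" and g: "g \<in> borel_measurable P"
    and S: "S \<in> sets borel"
    and c: "\<And>t. (\<integral>x. w x * cos (t * g x) \<partial>P) = (\<integral>x. w x * cos (t * g x) \<partial>Q)"
    and s: "\<And>t. (\<integral>x. w x * sin (t * g x) \<partial>P) = (\<integral>x. w x * sin (t * g x) \<partial>Q)"
  shows "(\<integral>x. w x * indicator S (g x) \<partial>P) = (\<integral>x. w x * indicator S (g x) \<partial>Q)"
proof -
  define D where "D K = distr (density K (\<lambda>x. ennreal (w x))) borel g" for K
  have K: "finite_measure (D K)" "sets (D K) = sets borel"
    "(\<integral>x. h x \<partial>D K) = (\<integral>x. w x * h (g x) \<partial>K)"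
    if "finite_measure K" "w \<in> borel_measurable K" "g \<in> borel_measurable K" "h \<in> borel_measurable borel"
    for K and h :: "real \<Rightarrow> real"
  proof -
    interpret finite_measure K by fact
    note [measurable] = that
    have "integrable K w"
      using w(2,3) by (intro integrable_const_bound[where B=2]) auto
    then have "finite_measure (density K (\<lambda>x. ennreal (w x)))"
      using w(2) by (intro finite_measureI) (simp add: emeasure_density nn_integral_eq_integral)
    then show "finite_measure (D K)" unfolding D_def
      by (rule finite_measure.finite_measure_distr) simp
    show "(\<integral>x. h x \<partial>D K) = (\<integral>x. w x * h (g x) \<partial>K)"
      unfolding D_def using w(2) by (simp add: integral_distr integral_density)
  qed (simp add: D_def)
  have wg: "w \<in> borel_measurable P" "g \<in> borel_measurable P" "w \<in> borel_measurable Q" "g \<in> borel_measurable Q"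
    using w g meas_PQ by blast+
  note KP = K[OF P wg(1,2)] and KQ = K[OF Q wg(3,4)]
  have "D P = D Q"
  proof (rule finite_measure_eqI_cos_sin)
    fix t
    show "(\<integral>x. cos (t * x) \<partial>D P) = (\<integral>x. cos (t * x) \<partial>D Q)"
      "(\<integral>x. sin (t * x) \<partial>D P) = (\<integral>x. sin (t * x) \<partial>D Q)"
      using c s by (simp_all add: KP(3) KQ(3))
  qed (use KP(1,2)[of "\<lambda>_. 0"] KQ(1,2)[of "\<lambda>_. 0"] in simp_all)
  then have "(\<integral>x. indicator S x \<partial>D P) = (\<integral>x. (indicator S x :: real) \<partial>D Q)" by simp
  then show ?thesis using S KP(3)[of "indicator S"] KQ(3)[of "indicator S"] by (simp del: Bochner_Integration.integral_indicator)
qed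

lemma zero_V: "(\<lambda>_. 0) \<in> V"
proof -
  obtain f where "f \<in> V" using V_ne by auto
  then show ?thesis using V_lin[of f f 0 0] by simp
qed

lemma good_Int:
  assumes A: "good A" and g: "g \<in> V" and S: "S \<in> sets borel"
  shows "good (A \<inter> (g -` S \<inter> space P))"
proof -
  have [measurable]: "A \<in> sets P" "g \<in> borel_measurable P" using A g V_meas by (auto simp: good_def)
  note [measurable] = S
  let ?I = "indicator A :: 'a \<Rightarrow> real"
  have ind: "indicator (A \<inter> (g -` S \<inter> space P)) x = ?I x * indicator S (g x)" if "x \<in> space P" for x
    using that by (auto simp: indicator_def)
  have sp: "space Q = space P" using sets_eq_imp_space_eq[OF sets_eq] by simp
  have c: "(\<integral>x. ?I x * cos (f x) \<partial>P) = (\<integral>x. ?I x * cos (f x) \<partial>Q)"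
    and s: "(\<integral>x. ?I x * sin (f x) \<partial>P) = (\<integral>x. ?I x * sin (f x) \<partial>Q)" if "f \<in> V" for f
    using A that by (auto simp: good_def)
  \<comment> \<open>The case of weight 1, which is subtracted at the end to get from
    \<open>1 + cos (f x)\<close> and \<open>1 + sin (f x)\<close> to \<open>cos (f x)\<close> and
    \<open>sin (f x)\<close>.\<close>
  have one: "(\<integral>x. ?I x * indicator S (g x) \<partial>P) = (\<integral>x. ?I x * indicator S (g x) \<partial>Q)"
  proof (rule weighted_law_eq)
    fix t
    have V: "(\<lambda>x. t * g x) \<in> V" using V_lin[OF g g, of t 0] by simp
    show "(\<integral>x. ?I x * cos (t * g x) \<partial>P) = (\<integral>x. ?I x * cos (t * g x) \<partial>Q)"
      "(\<integral>x. ?I x * sin (t * g x) \<partial>P) = (\<integral>x. ?I x * sin (t * g x) \<partial>Q)"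
      using c[OF V] s[OF V] by auto
  qed (auto simp: indicator_def)
  have int: "integrable P w" "integrable Q w" if "w \<in> borel_measurable P" "\<And>x. \<bar>w x\<bar> \<le> 1" for w :: "'a \<Rightarrow> real"
    using integrable_PQ[of w 1] that by auto
  have bd: "\<bar>?I x * u\<bar> \<le> 1" if "\<bar>u\<bar> \<le> 1" for x u using that by (auto simp: indicator_def)
  have w1: "(\<integral>x. (?I x * (1 + cos (f x))) * indicator S (g x) \<partial>P) = (\<integral>x. (?I x * (1 + cos (f x))) * indicator S (g x) \<partial>Q)"
    and w2: "(\<integral>x. (?I x * (1 + sin (f x))) * indicator S (g x) \<partial>P) = (\<integral>x. (?I x * (1 + sin (f x))) * indicator S (g x) \<partial>Q)"
    if f: "f \<in> V" for f
  proof -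
    have [measurable]: "f \<in> borel_measurable P" using V_meas f by auto
    have V: "(\<lambda>x. t * g x) \<in> V" "(\<lambda>x. t * g x + f x) \<in> V" "(\<lambda>x. t * g x - f x) \<in> V" for t
      using V_lin[OF g f, of t 0] V_lin[OF g f, of t 1] V_lin[OF g f, of t "-1"] by auto
    \<comment> \<open>Product-to-sum formulas: the arguments \<open>t * g x + f x\<close> and
      \<open>t * g x - f x\<close> belong to \<open>V\<close> again, so that \<open>good A\<close>
      covers every term.\<close>
    have exp: "?I x * (1 + cos (f x)) * cos (t * g x) =
        ?I x * cos (t * g x) + (?I x * cos (t * g x + f x) + ?I x * cos (t * g x - f x)) / 2"
      "?I x * (1 + cos (f x)) * sin (t * g x) =
        ?I x * sin (t * g x) + (?I x * sin (t * g x + f x) + ?I x * sin (t * g x - f x)) / 2"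
      "?I x * (1 + sin (f x)) * cos (t * g x) =
        ?I x * cos (t * g x) + (?I x * sin (t * g x + f x) - ?I x * sin (t * g x - f x)) / 2"
      "?I x * (1 + sin (f x)) * sin (t * g x) =
        ?I x * sin (t * g x) + (?I x * cos (t * g x - f x) - ?I x * cos (t * g x + f x)) / 2" for x t
      by (simp_all add: cos_add cos_diff sin_add sin_diff field_simps)
    show "(\<integral>x. (?I x * (1 + cos (f x))) * indicator S (g x) \<partial>P) = (\<integral>x. (?I x * (1 + cos (f x))) * indicator S (g x) \<partial>Q)"
    proof (rule weighted_law_eq)
      show "0 \<le> ?I x * (1 + cos (f x))" for x 
        using cos_ge_minus_one[of "f x"] by (intro mult_nonneg_nonneg indicator_pos_le) linarith
      show "?I x * (1 + cos (f x)) \<le> 2" for x using cos_le_one[of "f x"] by (simp add: indicator_def)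
      fix t
      show "(\<integral>x. ?I x * (1 + cos (f x)) * cos (t * g x) \<partial>P) = (\<integral>x. ?I x * (1 + cos (f x)) * cos (t * g x) \<partial>Q)"
        unfolding exp using c[OF V(1)[of t]] c[OF V(2)[of t]] c[OF V(3)[of t]]
        by (simp add: int bd)
      show "(\<integral>x. ?I x * (1 + cos (f x)) * sin (t * g x) \<partial>P) = (\<integral>x. ?I x * (1 + cos (f x)) * sin (t * g x) \<partial>Q)"
        unfolding exp using s[OF V(1)[of t]] s[OF V(2)[of t]] s[OF V(3)[of t]]
        by (simp add: int bd)
    qed simp_all
    show "(\<integral>x. (?I x * (1 + sin (f x))) * indicator S (g x) \<partial>P) = (\<integral>x. (?I x * (1 + sin (f x))) * indicator S (g x) \<partial>Q)"
    proof (rule weighted_law_eq)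
      show "0 \<le> ?I x * (1 + sin (f x))" for x 
        using sin_ge_minus_one[of "f x"] by (intro mult_nonneg_nonneg indicator_pos_le) linarith
      show "?I x * (1 + sin (f x)) \<le> 2" for x using sin_le_one[of "f x"] by (simp add: indicator_def)
      fix t
      show "(\<integral>x. ?I x * (1 + sin (f x)) * cos (t * g x) \<partial>P) = (\<integral>x. ?I x * (1 + sin (f x)) * cos (t * g x) \<partial>Q)"
        unfolding exp using c[OF V(1)[of t]] s[OF V(2)[of t]] s[OF V(3)[of t]]
        by (simp add: int bd)
      show "(\<integral>x. ?I x * (1 + sin (f x)) * sin (t * g x) \<partial>P) = (\<integral>x. ?I x * (1 + sin (f x)) * sin (t * g x) \<partial>Q)"
        unfolding exp using s[OF V(1)[of t]] c[OF V(2)[of t]] c[OF V(3)[of t]]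
        by (simp add: int bd)
    qed simp_all
  qed
  have "(\<integral>x. ?I x * indicator S (g x) * u x \<partial>P) = (\<integral>x. ?I x * indicator S (g x) * u x \<partial>Q)"
    if u: "u \<in> borel_measurable P" "\<And>x. \<bar>u x\<bar> \<le> 1"
      "(\<integral>x. (?I x * (1 + u x)) * indicator S (g x) \<partial>P) = (\<integral>x. (?I x * (1 + u x)) * indicator S (g x) \<partial>Q)" for u
  proof -
    note [measurable] = u(1)
    have "(?I x * (1 + u x)) * indicator S (g x) = ?I x * indicator S (g x) + ?I x * indicator S (g x) * u x" for x
      by (simp add: algebra_simps)
    moreover have "integrable K (\<lambda>x. ?I x * indicator S (g x))" "integrable K (\<lambda>x. ?I x * indicator S (g x) * u x)"
      if "K = P \<or> K = Q" for K
      using u(2) int[of "\<lambda>x. ?I x * indicator S (g x)"] int[of "\<lambda>x. ?I x * indicator S (g x) * u x"] that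
      by (auto simp: indicator_def)
    ultimately show ?thesis using u(3) one by simp
  qed
  note this[OF _ _ w1] this[OF _ _ w2]
  moreover have "(\<integral>x. indicator (A \<inter> (g -` S \<inter> space P)) x * u x \<partial>K) = (\<integral>x. ?I x * indicator S (g x) * u x \<partial>K)"
    if "K = P \<or> K = Q" for K and u :: "'a \<Rightarrow> real"
    using that sp by (intro Bochner_Integration.integral_cong refl) (auto simp: indicator_def)
  ultimately show ?thesis
    unfolding good_def using V_meas by simp
qed

theorem measures_eq: "P = Q"
proof -
  interpret P: finite_measure P by (rule P)
  interpret Q: finite_measure Q by (rule Q)
  have sp: "space Q = space P" using sets_eq_imp_space_eq[OF sets_eq] by simp
  \<comment> \<open>Lists encode finite intersections: \<open>[]\<close> gives the whole space and
    \<open>@\<close> the intersection, so the sets \<open>I l\<close> are an intersection-stable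
    generator.\<close>
  define I where "I l = (\<Inter>(f, S)\<in>set l. f -` S) \<inter> space P" for l :: "(('a \<Rightarrow> real) \<times> real set) list"
  define E where "E = I ` {l. set l \<subseteq> V \<times> sets borel}"
  have good: "good (I l)" if "set l \<subseteq> V \<times> sets borel" for l
    using that
  proof (induction l)
    case Nil
    have "(\<integral>x. indicator (space P) x * u x \<partial>K) = (\<integral>x. u x \<partial>K)" if "K = P \<or> K = Q" for K and u :: "'a \<Rightarrow> real"
      using that sp by (intro Bochner_Integration.integral_cong) auto
    then show ?case using cos_eq sin_eq by (simp add: good_def I_def)
  next
    case (Cons a l)
    obtain f S where a: "a = (f, S)" by (cases a)
    have "I (a # l) = I l \<inter> (f -` S \<inter> space P)" by (auto simp: I_def a)
    then show ?case using Cons good_Int[of "I l" f S] by (simp add: a)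
  qed
  have eq: "emeasure P A = emeasure Q A" if "good A" for A
  proof -
    have A: "A \<in> sets P" "A \<in> sets Q" using that sets_eq by (auto simp: good_def)
    have "(\<integral>x. indicator A x * cos ((\<lambda>_. 0::real) x) \<partial>P) = (\<integral>x. indicator A x * cos ((\<lambda>_. 0) x) \<partial>Q)"
      using that zero_V unfolding good_def by fast
    then have "integral\<^sup>L P (indicator A :: _ \<Rightarrow> real) = integral\<^sup>L Q (indicator A)" by simp
    then have "measure P A = measure Q A" using A by simp
    then show ?thesis by (simp add: P.emeasure_eq_measure Q.emeasure_eq_measure)
  qed
  have gen: "sets P = sigma_sets (space P) E"
  proof
    have "{f -` S \<inter> space P | f S. f \<in> V \<and> S \<in> sets borel} \<subseteq> E"
    proof clarify
      fix f S assume "f \<in> V" "(S :: real set) \<in> sets borel"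
      then show "f -` S \<inter> space P \<in> E"
        unfolding E_def by (intro image_eqI[of _ _ "[(f, S)]"]) (auto simp: I_def)
    qed
    from sigma_sets_mono'[OF this] show "sets P \<subseteq> sigma_sets (space P) E"
      using V_gen by (rule order_trans[rotated])
    show "sigma_sets (space P) E \<subseteq> sets P"
      using good by (intro sets.sigma_sets_subset) (auto simp: E_def good_def)
  qed
  show ?thesis
  proof (rule measure_eqI_generator_eq[of E "space P" P Q "\<lambda>_. space P"])
    show "Int_stable E"
    proof (rule Int_stableI)
      fix A B assume "A \<in> E" "B \<in> E"
      then obtain l m where lm: "A = I l" "B = I m" "set l \<subseteq> V \<times> sets borel" "set m \<subseteq> V \<times> sets borel"
        by (auto simp: E_def)
      then have "A \<inter> B = I (l @ m)" by (auto simp: I_def)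
      then show "A \<inter> B \<in> E" using lm by (auto simp: E_def)
    qed
    show "E \<subseteq> Pow (space P)" by (auto simp: E_def I_def)
    show "range (\<lambda>_::nat. space P) \<subseteq> E"
      by (auto simp: E_def I_def intro!: image_eqI[of _ _ "[]"])
    show "sets Q = sigma_sets (space P) E" using gen sets_eq by simp
    show "emeasure P A = emeasure Q A" if "A \<in> E" for A
      using that good eq by (auto simp: E_def)
    show "sets P = sigma_sets (space P) E" by (rule gen)
  qed simp_all
qed

end

section \<open>Gaussian measures\<close>

text \<open>An image measure instead of a density, so that variance 0 (the Dirac measure at 0) is
  included and the sign of \<open>\<sigma>\<close> is free.\<close>

definition normal_law :: "real \<Rightarrow> real measure" where
  "normal_law \<sigma> = distr std_normal_distribution borel (\<lambda>x. \<sigma> * x)"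

lemma sets_normal_law [simp, measurable_cong]: "sets (normal_law \<sigma>) = sets borel"
  and space_normal_law [simp]: "space (normal_law \<sigma>) = UNIV"
  by (simp_all add: normal_law_def)

lemma prob_space_normal_law: "prob_space (normal_law \<sigma>)"
  unfolding normal_law_def
  using real_dist_normal_dist by (intro prob_space.prob_space_distr) (auto simp: real_distribution_def)

lemma std_normal_cos_sin:
  "(\<integral>x. cos (t * x) \<partial>std_normal_distribution) = exp (- t\<^sup>2 / 2)"
  "(\<integral>x. sin (t * x) \<partial>std_normal_distribution) = 0"
proof -
  interpret real_distribution std_normal_distribution by (rule real_dist_normal_dist)
  have int: "complex_integrable std_normal_distribution (\<lambda>x. iexp (t * x))"
    by (intro integrable_const_bound[where B=1]) auto
  have ch: "(CLINT x|std_normal_distribution. iexp (t * x)) = complex_of_real (exp (- t\<^sup>2 / 2))"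
    using fun_cong[OF char_std_normal_distribution, of t] by (simp add: char_def)
  have "(\<integral>x. Re (iexp (t * x)) \<partial>std_normal_distribution) = Re (complex_of_real (exp (- t\<^sup>2 / 2)))"
    unfolding integral_Re[OF int] ch ..
  then show "(\<integral>x. cos (t * x) \<partial>std_normal_distribution) = exp (- t\<^sup>2 / 2)"
    by (simp add: Re_exp)
  have "(\<integral>x. Im (iexp (t * x)) \<partial>std_normal_distribution) = Im (complex_of_real (exp (- t\<^sup>2 / 2)))"
    unfolding integral_Im[OF int] ch ..
  then show "(\<integral>x. sin (t * x) \<partial>std_normal_distribution) = 0"
    by (simp add: Im_exp)
qed

lemma normal_law_cos_sin:
  "(\<integral>x. cos (t * x) \<partial>normal_law \<sigma>) = exp (- (t\<^sup>2 * \<sigma>\<^sup>2) / 2)"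
  "(\<integral>x. sin (t * x) \<partial>normal_law \<sigma>) = 0"
  using std_normal_cos_sin[of "t * \<sigma>"]
  by (simp_all add: normal_law_def integral_distr mult.assoc power_mult_distrib)

lemma normal_law_moments:
  "integrable (normal_law \<sigma>) (\<lambda>x. x ^ k)"
  "(\<integral>x. x \<partial>normal_law \<sigma>) = 0" "(\<integral>x. x\<^sup>2 \<partial>normal_law \<sigma>) = \<sigma>\<^sup>2" "(\<integral>x. x ^ 4 \<partial>normal_law \<sigma>) = 3 * \<sigma> ^ 4"
proof -
  have i: "integrable std_normal_distribution (\<lambda>x. (\<sigma> * x) ^ k)" for k
    using integrable_std_normal_distribution_moment[of k] by (simp add: power_mult_distrib)
  show "integrable (normal_law \<sigma>) (\<lambda>x. x ^ k)"
    unfolding normal_law_def using i by (subst integrable_distr_eq) auto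
  have m: "(\<integral>x. x ^ k \<partial>normal_law \<sigma>) = \<sigma> ^ k * (\<integral>x. x ^ k \<partial>std_normal_distribution)" for k
    unfolding normal_law_def by (subst integral_distr) (auto simp: power_mult_distrib)
  show "(\<integral>x. x \<partial>normal_law \<sigma>) = 0"
    using m[of 1] integral_std_normal_distribution_moment_odd[of 1] by simp
  show "(\<integral>x. x\<^sup>2 \<partial>normal_law \<sigma>) = \<sigma>\<^sup>2"
    using m[of 2] std_normal_distribution_even_moments(1)[of 1] by simp
  show "(\<integral>x. x ^ 4 \<partial>normal_law \<sigma>) = 3 * \<sigma> ^ 4"
    using m[of 4] std_normal_distribution_even_moments(1)[of 2] by (simp add: fact_numeral)
qed

text \<open>The Cameron-Martin formula on the line: moving the standard variable \<open>x\<close> by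
  \<open>\<sigma>\<close> multiplies its density by
  \<open>exp (\<sigma> * x - \<sigma>\<^sup>2 / 2)\<close> and moves \<open>u = \<sigma> * x\<close>
  by \<open>\<sigma>\<^sup>2\<close>.\<close>

lemma normal_law_shift:
  assumes [measurable]: "g \<in> borel_measurable borel"
  shows "(\<integral>\<^sup>+u. g (u + \<sigma>\<^sup>2) \<partial>normal_law \<sigma>) = (\<integral>\<^sup>+u. g u * ennreal (exp (u - \<sigma>\<^sup>2 / 2)) \<partial>normal_law \<sigma>)"
proof -
  have dens: "std_normal_density (x - \<sigma>) = std_normal_density x * exp (\<sigma> * x - \<sigma>\<^sup>2 / 2)" for x
    by (simp add: std_normal_density_def flip: exp_add) (simp add: power2_eq_square field_simps)
  have "(\<integral>\<^sup>+u. g (u + \<sigma>\<^sup>2) \<partial>normal_law \<sigma>) = (\<integral>\<^sup>+x. ennreal (std_normal_density x) * g (\<sigma> * (\<sigma> + 1 * x)) \<partial>lborel)"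
    by (simp add: normal_law_def nn_integral_distr nn_integral_density algebra_simps power2_eq_square)
  also have "\<dots> = (\<integral>\<^sup>+x. ennreal (std_normal_density ((\<sigma> + 1 * x) - \<sigma>)) * g (\<sigma> * (\<sigma> + 1 * x)) \<partial>lborel)"
    by simp
  also have "\<dots> = (\<integral>\<^sup>+x. ennreal (std_normal_density (x - \<sigma>)) * g (\<sigma> * x) \<partial>lborel)"
    by (subst nn_integral_real_affine[of "\<lambda>x. ennreal (std_normal_density (x - \<sigma>)) * g (\<sigma> * x)" 1 \<sigma>]) simp_all
  also have "\<dots> = (\<integral>\<^sup>+x. ennreal (std_normal_density x * exp (\<sigma> * x - \<sigma>\<^sup>2 / 2)) * g (\<sigma> * x) \<partial>lborel)"
    unfolding dens ..
  also have "\<dots> = (\<integral>\<^sup>+u. g u * ennreal (exp (u - \<sigma>\<^sup>2 / 2)) \<partial>normal_law \<sigma>)"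
    by (simp add: normal_law_def nn_integral_distr nn_integral_density ennreal_mult algebra_simps)
  finally show ?thesis .
qed

lemma centered_gaussian_real_normal_law:
  assumes "centered_gaussian_real \<nu>"
  shows "\<exists>\<sigma>. \<nu> = normal_law \<sigma>"
  using assms unfolding centered_gaussian_real_def
proof (elim disjE exE conjE)
  fix \<sigma> :: real assume s: "0 < \<sigma>" "\<nu> = density lborel (\<lambda>t. ennreal (normal_density 0 \<sigma> t))"
  interpret real_distribution std_normal_distribution by (rule real_dist_normal_dist)
  have "distributed std_normal_distribution lborel (\<lambda>x. x) (normal_density 0 1)"
    by (simp add: distributed_def distr_id2)
  from normal_density_affine[OF this, of \<sigma> 0] s(1)
  have "distributed std_normal_distribution lborel (\<lambda>x. \<sigma> * x) (normal_density 0 \<sigma>)" by simp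
  then have "distr std_normal_distribution lborel (\<lambda>x. \<sigma> * x) = \<nu>"
    by (simp add: distributed_def s(2))
  moreover have "distr std_normal_distribution lborel (\<lambda>x. \<sigma> * x) = normal_law \<sigma>"
    unfolding normal_law_def by (intro distr_cong) auto
  ultimately show ?thesis by auto
next
  assume "\<nu> = return borel 0"
  moreover have "normal_law 0 = return borel 0"
  proof -
    interpret real_distribution std_normal_distribution by (rule real_dist_normal_dist)
    show ?thesis by (simp add: normal_law_def)
  qed
  ultimately show ?thesis by metis
qed

text \<open>An independence criterion: the joint characteristic functional of \<open>R\<close> and
  \<open>f\<close> factors, and the second factor is that of a normal law. The class
  \<open>V\<close> is abstract because \<open>N\<close> is the space of real sequences in one
  application and the space itself in the other.\<close>

lemma gaussian_split:
  fixes f :: "'a \<Rightarrow> real" and V :: "('b \<Rightarrow> real) set"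
  assumes M: "prob_space M" and R[measurable]: "R \<in> measurable M N" and f[measurable]: "f \<in> borel_measurable M"
    and V_meas: "\<And>\<psi>. \<psi> \<in> V \<Longrightarrow> \<psi> \<in> borel_measurable N"
    and V_lin: "\<And>\<psi> \<theta> a b. \<psi> \<in> V \<Longrightarrow> \<theta> \<in> V \<Longrightarrow> (\<lambda>x. a * \<psi> x + b * \<theta> x) \<in> V"
    and V_ne: "V \<noteq> {}"
    and V_gen: "sets N \<subseteq> sigma_sets (space N) {\<psi> -` S \<inter> space N | \<psi> S. \<psi> \<in> V \<and> S \<in> sets borel}"
    and c: "\<And>\<psi> b. \<psi> \<in> V \<Longrightarrow> (\<integral>z. cos (\<psi> (R z) + b * f z) \<partial>M) = (\<integral>z. cos (\<psi> (R z)) \<partial>M) * exp (- (b\<^sup>2 * \<sigma>\<^sup>2) / 2)"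
    and s: "\<And>\<psi> b. \<psi> \<in> V \<Longrightarrow> (\<integral>z. sin (\<psi> (R z) + b * f z) \<partial>M) = (\<integral>z. sin (\<psi> (R z)) \<partial>M) * exp (- (b\<^sup>2 * \<sigma>\<^sup>2) / 2)"
  shows "distr M (N \<Otimes>\<^sub>M borel) (\<lambda>z. (R z, f z)) = distr M N R \<Otimes>\<^sub>M normal_law \<sigma>"
proof -
  interpret M: prob_space M by fact
  interpret R: prob_space "distr M N R" by (rule M.prob_space_distr) simp
  interpret nl: prob_space "normal_law \<sigma>" by (rule prob_space_normal_law)
  interpret RN: pair_prob_space "distr M N R" "normal_law \<sigma>" ..
  define W where "W = {\<lambda>(r, u). \<psi> r + b * u | \<psi> (b::real). \<psi> \<in> V}"
  have W_I: "(\<lambda>(r, u). \<psi> r + b * u) \<in> W" if "\<psi> \<in> V" for \<psi> b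
    unfolding W_def by (intro CollectI exI[of _ \<psi>] exI[of _ b] conjI refl that)
  have W_E: "\<exists>\<psi> b. w = (\<lambda>(r, u). \<psi> r + b * u) \<and> \<psi> \<in> V" if "w \<in> W" for w
    using that unfolding W_def by (simp only: mem_Collect_eq)
  let ?P = "distr M (N \<Otimes>\<^sub>M borel) (\<lambda>z. (R z, f z))" and ?Q = "distr M N R \<Otimes>\<^sub>M normal_law \<sigma>"
  have setsQ: "sets ?Q = sets (N \<Otimes>\<^sub>M borel)" by (intro sets_pair_measure_cong) auto
  have zero: "(\<lambda>_. 0) \<in> V"
  proof -
    obtain \<psi> where "\<psi> \<in> V" using V_ne by auto
    then show ?thesis using V_lin[of \<psi> \<psi> 0 0] by simp
  qed
  have Wm: "w \<in> borel_measurable (N \<Otimes>\<^sub>M borel)" if "w \<in> W" for w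
    using that V_meas by (auto simp: W_def intro!: borel_measurable_add borel_measurable_times measurable_compose[OF measurable_fst] measurable_compose[OF measurable_snd] simp: split_beta)
  have intQ: "(\<integral>x. cos (\<psi> (fst x) + b * snd x) \<partial>?Q) = (\<integral>z. cos (\<psi> (R z)) \<partial>M) * exp (- (b\<^sup>2 * \<sigma>\<^sup>2) / 2)"
    "(\<integral>x. sin (\<psi> (fst x) + b * snd x) \<partial>?Q) = (\<integral>z. sin (\<psi> (R z)) \<partial>M) * exp (- (b\<^sup>2 * \<sigma>\<^sup>2) / 2)"
    if psi: "\<psi> \<in> V" for \<psi> b
  proof -
    have [measurable]: "\<psi> \<in> borel_measurable N" using V_meas psi by auto
    have int: "integrable (normal_law \<sigma>) (\<lambda>u. cos (b * u))" "integrable (normal_law \<sigma>) (\<lambda>u. sin (b * u))"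
      by (auto intro!: nl.integrable_const_bound[where B=1])
    have inner: "(\<integral>u. cos (a + b * u) \<partial>normal_law \<sigma>) = cos a * exp (- (b\<^sup>2 * \<sigma>\<^sup>2) / 2)"
      "(\<integral>u. sin (a + b * u) \<partial>normal_law \<sigma>) = sin a * exp (- (b\<^sup>2 * \<sigma>\<^sup>2) / 2)" for a
      using int normal_law_cos_sin[of \<sigma> b] by (simp_all add: cos_add sin_add)
    have iQ: "integrable ?Q (\<lambda>x. cos (\<psi> (fst x) + b * snd x))" "integrable ?Q (\<lambda>x. sin (\<psi> (fst x) + b * snd x))"
      by (auto intro!: RN.P.integrable_const_bound[where B=1])
    have "(\<integral>x. cos (\<psi> (fst x) + b * snd x) \<partial>?Q) = (\<integral>r. (\<integral>u. cos (\<psi> r + b * u) \<partial>normal_law \<sigma>) \<partial>distr M N R)"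
      using RN.integral_fst'[OF iQ(1)] by simp
    then show "(\<integral>x. cos (\<psi> (fst x) + b * snd x) \<partial>?Q) = (\<integral>z. cos (\<psi> (R z)) \<partial>M) * exp (- (b\<^sup>2 * \<sigma>\<^sup>2) / 2)"
      by (simp add: inner integral_distr)
    have "(\<integral>x. sin (\<psi> (fst x) + b * snd x) \<partial>?Q) = (\<integral>r. (\<integral>u. sin (\<psi> r + b * u) \<partial>normal_law \<sigma>) \<partial>distr M N R)"
      using RN.integral_fst'[OF iQ(2)] by simp
    then show "(\<integral>x. sin (\<psi> (fst x) + b * snd x) \<partial>?Q) = (\<integral>z. sin (\<psi> (R z)) \<partial>M) * exp (- (b\<^sup>2 * \<sigma>\<^sup>2) / 2)"
      by (simp add: inner integral_distr)
  qed
  \<comment> \<open>The choice \<open>b = 0\<close> produces the cylinders over sets of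
    \<open>N\<close>, and the zero functional with \<open>b = 1\<close> those over real Borel sets;
    rectangles are their intersections.\<close>
  have gen: "sets (N \<Otimes>\<^sub>M borel) \<subseteq> sigma_sets (space N \<times> UNIV) {w -` S \<inter> (space N \<times> UNIV) | w S. w \<in> W \<and> S \<in> sets (borel :: real measure)}"
    (is "_ \<subseteq> sigma_sets ?O ?G")
  proof -
    interpret G: sigma_algebra ?O "sigma_sets ?O ?G" by (rule sigma_algebra_sigma_sets) auto
    have sub: "A \<times> UNIV \<in> sigma_sets ?O ?G" if "A \<in> sets N" for A
    proof -
      have "A \<in> sigma_sets (space N) {\<psi> -` S \<inter> space N | \<psi> S. \<psi> \<in> V \<and> S \<in> sets borel}" using that V_gen by blast
      then show ?thesis
      proof induction
        case (Basic a)
        then obtain \<psi> S where a: "a = \<psi> -` S \<inter> space N" "\<psi> \<in> V" "S \<in> sets borel" by blast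
        have "a \<times> UNIV = (\<lambda>(r, u). \<psi> r + 0 * u) -` S \<inter> ?O" unfolding a(1) by (simp add: set_eq_iff mem_Times_iff split_beta)
        moreover have "(\<lambda>(r, u). \<psi> r + 0 * u) \<in> W" unfolding W_def using a(2) by blast
        ultimately have "a \<times> UNIV \<in> ?G" using a(3) by blast
        then show ?case by (rule sigma_sets.Basic)
      next
        case (Compl a)
        have "(space N - a) \<times> UNIV = ?O - a \<times> UNIV" by auto
        then show ?case using G.compl_sets[OF Compl.IH] by (simp only:)
      next
        case (Union a)
        have "(\<Union>i. a i) \<times> (UNIV :: real set) = (\<Union>i. a i \<times> UNIV)" by blast
        then show ?case using sigma_sets.Union[of "\<lambda>i. a i \<times> UNIV", OF Union.IH] by (simp only:)
      qed (simp only: Sigma_empty1 sigma_sets.Empty)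
    qed
    have "A \<times> B \<in> sigma_sets ?O ?G" if "A \<in> sets N" "B \<in> sets borel" for A B
    proof -
      have "space N \<times> B \<in> ?G"
      proof -
        have "(\<lambda>(r, u). (\<lambda>_. 0) r + 1 * u) \<in> W" unfolding W_def
          by (intro CollectI exI[of _ "\<lambda>_. 0"] exI[of _ 1] conjI zero refl)
        moreover have "space N \<times> B = (\<lambda>(r, u). (\<lambda>_. 0) r + 1 * u) -` B \<inter> ?O"
          by (simp add: set_eq_iff mem_Times_iff split_beta conj_commute)
        ultimately show ?thesis using that(2) by blast
      qed
      then have "(A \<times> UNIV) \<inter> (space N \<times> B) \<in> sigma_sets ?O ?G"
        by (intro G.Int[OF sub[OF that(1)]] sigma_sets.Basic)
      also have "(A \<times> UNIV) \<inter> (space N \<times> B) = A \<times> B" using sets.sets_into_space[OF that(1)] by auto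
      finally show ?thesis .
    qed
    then show ?thesis
      unfolding sets_pair_measure space_borel
      by (intro G.sigma_sets_subset subsetI) (elim CollectE exE conjE, simp only:)
  qed
  interpret char_functional_eq ?P ?Q W
  proof (rule char_functional_eq.intro)
    show "finite_measure ?P" by (rule prob_space.finite_measure) (rule M.prob_space_distr, simp)
    show "finite_measure ?Q" by (rule RN.P.finite_measure_axioms)
    show "W \<noteq> {}" using zero by (auto simp: W_def)
    show "sets ?P = sets ?Q" using setsQ by simp
    show "w \<in> borel_measurable ?P" if "w \<in> W" for w using Wm[OF that] by simp
    show "sets ?P \<subseteq> sigma_sets (space ?P) {w -` S \<inter> space ?P | w S. w \<in> W \<and> S \<in> sets borel}"
      using gen by (simp add: space_pair_measure)
    show "(\<lambda>x. a * v x + b * w x) \<in> W" if "v \<in> W" "w \<in> W" for v w a b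
    proof -
      obtain \<psi> c \<theta> d where vw: "v = (\<lambda>(r, u). \<psi> r + c * u)" "w = (\<lambda>(r, u). \<theta> r + d * u)" "\<psi> \<in> V" "\<theta> \<in> V"
        using W_E[OF \<open>v \<in> W\<close>] W_E[OF \<open>w \<in> W\<close>] by blast
      have "(\<lambda>x. a * v x + b * w x) = (\<lambda>(r, u). (a * \<psi> r + b * \<theta> r) + (a * c + b * d) * u)"
        by (auto simp: vw algebra_simps)
      then show ?thesis using W_I[OF V_lin[OF vw(3,4), of a b]] by simp
    qed
    show "(\<integral>x. cos (w x) \<partial>?P) = (\<integral>x. cos (w x) \<partial>?Q)" if wW: "w \<in> W" for w
    proof -
      obtain \<psi> b where w: "w = (\<lambda>(r, u). \<psi> r + b * u)" "\<psi> \<in> V" using W_E[OF wW] by blast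
      show ?thesis using c[OF w(2), of b] intQ(1)[OF w(2), of b] Wm[OF wW]
        by (subst integral_distr) (auto simp: w(1) split_beta)
    qed
    show "(\<integral>x. sin (w x) \<partial>?P) = (\<integral>x. sin (w x) \<partial>?Q)" if wW: "w \<in> W" for w
    proof -
      obtain \<psi> b where w: "w = (\<lambda>(r, u). \<psi> r + b * u)" "\<psi> \<in> V" using W_E[OF wW] by blast
      show ?thesis using s[OF w(2), of b] intQ(2)[OF w(2), of b] Wm[OF wW]
        by (subst integral_distr) (auto simp: w(1) split_beta)
    qed
  qed
  show ?thesis by (rule measures_eq)
qed

section \<open>The topological dual and measurability in a Souslin locally convex space\<close>

lemma top_dual_lin:
  assumes "\<phi> \<in> top_dual" "\<psi> \<in> top_dual"
  shows "(\<lambda>x. a * \<phi> x + b * \<psi> x) \<in> top_dual"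
  using assms unfolding top_dual_def
  by (auto intro!: linearI continuous_on_add continuous_on_mult continuous_on_const simp: linear_add linear_scale algebra_simps)

lemma top_dual_zero: "(\<lambda>_. 0) \<in> top_dual"
  by (auto simp: top_dual_def intro!: linearI)

lemma top_dual_sum:
  assumes "\<And>i. i \<in> I \<Longrightarrow> \<phi> i \<in> top_dual"
  shows "(\<lambda>x. \<Sum>i\<in>I. a i * \<phi> i x) \<in> top_dual"
  using assms
proof (induction I rule: infinite_finite_induct)
  case (insert i I)
  then show ?case using top_dual_lin[of "\<phi> i" "\<lambda>x. \<Sum>i\<in>I. a i * \<phi> i x" "a i" 1] by simp
qed (simp_all add: top_dual_zero)

lemma top_dual_linear: "\<phi> \<in> top_dual \<Longrightarrow> linear \<phi>"
  and top_dual_continuous: "\<phi> \<in> top_dual \<Longrightarrow> continuous_on UNIV \<phi>"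
  by (auto simp: top_dual_def)

lemma top_dual_measurable: "\<phi> \<in> top_dual \<Longrightarrow> \<phi> \<in> borel_measurable borel"
  by (intro borel_measurable_continuous_onI top_dual_continuous)

lemma top_dual_simps:
  assumes "\<phi> \<in> top_dual"
  shows "\<phi> (x + y) = \<phi> x + \<phi> y" "\<phi> (x - y) = \<phi> x - \<phi> y" "\<phi> (c *\<^sub>R x) = c * \<phi> x" "\<phi> 0 = 0" "\<phi> (- x) = - \<phi> x"
    "\<phi> (\<Sum>i\<in>I. f i) = (\<Sum>i\<in>I. \<phi> (f i))"
  using top_dual_linear[OF assms]
  by (simp_all add: linear_add linear_diff linear_scale linear_0 linear_neg linear_sum)

locale souslin_lcs =
  fixes TYP :: "'g::locally_convex_tvs itself"
  assumes souslin: "souslin_space (euclidean :: 'g topology)"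
begin

lemma top_dual_eqI:
  fixes x y :: 'g
  assumes "\<And>\<phi>. \<phi> \<in> top_dual \<Longrightarrow> \<phi> x = \<phi> y" shows "x = y"
proof (rule ccontr)
  assume "x \<noteq> y"
  then obtain \<phi> where "\<phi> \<in> top_dual" "\<phi> (x - y) \<noteq> 0"
    using top_dual_separates[of "x - y"] souslin by (auto simp: souslin_space_def)
  then show False using assms[of \<phi>] by (simp add: top_dual_simps)
qed

lemma separating_sequence:
  "\<exists>\<phi>::nat \<Rightarrow> 'g \<Rightarrow> real. range \<phi> \<subseteq> top_dual \<and> (\<forall>x y. x \<noteq> y \<longrightarrow> (\<exists>n. \<phi> n x \<noteq> \<phi> n y))"
proof (rule souslin_countable_separating[OF souslin])
  fix x y :: 'g assume "x \<noteq> y"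
  then obtain \<phi> where phi: "\<phi> \<in> top_dual" "\<phi> x \<noteq> \<phi> y" using top_dual_eqI by blast
  show "\<exists>\<phi>\<in>top_dual. \<phi> x < \<phi> y"
  proof (cases "\<phi> x < \<phi> y")
    case False
    then show ?thesis using phi top_dual_lin[OF phi(1,1), of "-1" 0]
      by (intro bexI[of _ "\<lambda>x. - \<phi> x"]) auto
  qed (use phi in auto)
qed (use top_dual_zero top_dual_continuous in auto)

definition sep :: "nat \<Rightarrow> 'g \<Rightarrow> real" where
  "sep = (SOME \<phi>. range \<phi> \<subseteq> top_dual \<and> (\<forall>x y. x \<noteq> y \<longrightarrow> (\<exists>n. \<phi> n x \<noteq> \<phi> n y)))"

lemma sep_dual: "sep n \<in> top_dual" and sep_separates: "x \<noteq> y \<Longrightarrow> \<exists>n. sep n x \<noteq> sep n y"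
  using someI_ex[OF separating_sequence] unfolding sep_def by auto

lemma borel_generated: "sets (borel :: 'g measure) = sigma_sets UNIV {sep n -` S | n S. S \<in> sets borel}"
  using sep_separates top_dual_continuous[OF sep_dual] by (intro souslin_borel_generated[OF souslin]) auto

text \<open>Continuity of addition refers to the product topology, not to the product sigma-algebra.
  Testing measurability against functionals avoids a comparison of the two and reduces vector
  operations to real ones.\<close>

lemma measurable_borelI:
  fixes g :: "'a \<Rightarrow> 'g"
  assumes "\<And>\<phi>. \<phi> \<in> top_dual \<Longrightarrow> (\<lambda>x. \<phi> (g x)) \<in> borel_measurable N"
  shows "g \<in> measurable N borel"
proof -
  have "g \<in> measurable N (sigma UNIV {sep n -` S | n S. S \<in> sets borel})"
  proof (rule measurable_measure_of)
    fix A :: "'g set" assume "A \<in> {sep n -` S | n S. S \<in> sets borel}"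
    then obtain n S where "A = sep n -` S" "S \<in> sets borel" by blast
    then show "g -` A \<inter> space N \<in> sets N"
      using measurable_sets[OF assms[OF sep_dual[of n]], of S] by (simp add: vimage_def)
  qed auto
  also have "measurable N (sigma UNIV {sep n -` S | n S. S \<in> sets borel}) = measurable N borel"
    by (intro measurable_cong_sets refl) (simp add: borel_generated)
  finally show ?thesis .
qed

lemma top_dual_generates:
  "sets (borel :: 'g measure) \<subseteq> sigma_sets UNIV {\<psi> -` S \<inter> UNIV | \<psi> S. \<psi> \<in> top_dual \<and> S \<in> sets borel}"
  unfolding borel_generated using sep_dual by (intro sigma_sets_mono') blast

lemma measurable_add [measurable]:
  fixes f g :: "'a \<Rightarrow> 'g"
  assumes [measurable]: "f \<in> measurable N borel" "g \<in> measurable N borel"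
  shows "(\<lambda>x. f x + g x) \<in> measurable N borel"
proof (rule measurable_borelI)
  fix \<phi> :: "'g \<Rightarrow> real" assume phi: "\<phi> \<in> top_dual"
  note [measurable] = top_dual_measurable[OF phi]
  show "(\<lambda>x. \<phi> (f x + g x)) \<in> borel_measurable N" by (simp add: top_dual_simps[OF phi])
qed

lemma measurable_scaleR [measurable]:
  fixes g :: "'a \<Rightarrow> 'g"
  assumes [measurable]: "f \<in> borel_measurable N" "g \<in> measurable N borel"
  shows "(\<lambda>x. f x *\<^sub>R g x) \<in> measurable N borel"
proof (rule measurable_borelI)
  fix \<phi> :: "'g \<Rightarrow> real" assume phi: "\<phi> \<in> top_dual"
  note [measurable] = top_dual_measurable[OF phi]
  show "(\<lambda>x. \<phi> (f x *\<^sub>R g x)) \<in> borel_measurable N" by (simp add: top_dual_simps[OF phi])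
qed

end

section \<open>The covariance form on the dual\<close>

locale souslin_gaussian = souslin_lcs TYP for TYP :: "'g::locally_convex_tvs itself" +
  fixes \<mu> :: "'g measure"
  assumes gaussian: "centered_gaussian \<mu>"
begin

sublocale prob_space \<mu>
  using gaussian by (simp add: centered_gaussian_def)

lemma sets_mu [simp, measurable_cong]: "sets \<mu> = sets borel"
  using gaussian by (simp add: centered_gaussian_def)

lemma space_mu [simp]: "space \<mu> = UNIV"
  using sets_eq_imp_space_eq[OF sets_mu] by simp

definition ip :: "('g \<Rightarrow> real) \<Rightarrow> ('g \<Rightarrow> real) \<Rightarrow> real" where
  "ip \<phi> \<psi> = (\<integral>y. \<phi> y * \<psi> y \<partial>\<mu>)"

lemma ip_commute: "ip \<phi> \<psi> = ip \<psi> \<phi>"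
  by (simp add: ip_def mult.commute)

lemma dual_meas: "\<phi> \<in> top_dual \<Longrightarrow> \<phi> \<in> borel_measurable \<mu>"
  using top_dual_measurable measurable_cong_sets[OF sets_mu refl] by blast

context
  fixes \<phi> :: "'g \<Rightarrow> real"
  assumes phi: "\<phi> \<in> top_dual"
begin

text \<open>The Gaussian hypothesis supplies some parameter. Its square is the second moment, and
  its sign does not show in the law, by symmetry.\<close>

lemma dual_normal_law: "distr \<mu> borel \<phi> = normal_law (sqrt (ip \<phi> \<phi>))"
proof -
  obtain \<sigma> where s: "distr \<mu> borel \<phi> = normal_law \<sigma>"
    using gaussian phi centered_gaussian_real_normal_law by (auto simp: centered_gaussian_def)
  have "(\<integral>x. x\<^sup>2 \<partial>distr \<mu> borel \<phi>) = ip \<phi> \<phi>"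
    by (subst integral_distr) (auto simp: dual_meas[OF phi] ip_def power2_eq_square)
  then have "ip \<phi> \<phi> = \<sigma>\<^sup>2" by (simp add: s normal_law_moments)
  then have "sqrt (ip \<phi> \<phi>) = \<bar>\<sigma>\<bar>" by simp
  moreover have "normal_law \<bar>\<sigma>\<bar> = normal_law \<sigma>"
    by (intro finite_measure_eqI_cos_sin) (auto simp: prob_space_normal_law prob_space.finite_measure normal_law_cos_sin)
  ultimately show ?thesis using s by simp
qed

lemma dual_integrable_power: "integrable \<mu> (\<lambda>y. \<phi> y ^ k)"
proof -
  have "integrable (distr \<mu> borel \<phi>) (\<lambda>x. x ^ k)"
    unfolding dual_normal_law by (rule normal_law_moments)
  then show ?thesis using dual_meas[OF phi] by (subst (asm) integrable_distr_eq) auto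
qed

lemma ip_nonneg: "0 \<le> ip \<phi> \<phi>"
  by (simp add: ip_def)

lemma dual_expectation: "(\<integral>y. \<phi> y \<partial>\<mu>) = 0"
  and dual_fourth_moment: "(\<integral>y. \<phi> y ^ 4 \<partial>\<mu>) = 3 * (ip \<phi> \<phi>)\<^sup>2"
  and dual_cos: "(\<integral>y. cos (\<phi> y) \<partial>\<mu>) = exp (- ip \<phi> \<phi> / 2)"
  and dual_sin: "(\<integral>y. sin (\<phi> y) \<partial>\<mu>) = 0"
proof -
  have t: "(\<integral>y. h (\<phi> y) \<partial>\<mu>) = (\<integral>x. h x \<partial>normal_law (sqrt (ip \<phi> \<phi>)))"
    if "h \<in> borel_measurable borel" for h :: "real \<Rightarrow> real"
    using that dual_meas[OF phi] by (simp add: integral_distr flip: dual_normal_law)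
  show "(\<integral>y. \<phi> y \<partial>\<mu>) = 0" using t[of "\<lambda>x. x"] by (simp add: normal_law_moments)
  have "sqrt a ^ 4 = a\<^sup>2" if "0 \<le> a" for a
    using power_mult[of "sqrt a" 2 2] real_sqrt_pow2[OF that] by simp
  then show "(\<integral>y. \<phi> y ^ 4 \<partial>\<mu>) = 3 * (ip \<phi> \<phi>)\<^sup>2"
    using t[of "\<lambda>x. x ^ 4"] ip_nonneg by (simp add: normal_law_moments)
  show "(\<integral>y. cos (\<phi> y) \<partial>\<mu>) = exp (- ip \<phi> \<phi> / 2)"
    using t[of cos] normal_law_cos_sin(1)[of "sqrt (ip \<phi> \<phi>)" 1] ip_nonneg by simp
  show "(\<integral>y. sin (\<phi> y) \<partial>\<mu>) = 0"
    using t[of sin] normal_law_cos_sin(2)[of "sqrt (ip \<phi> \<phi>)" 1] by simp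
qed

lemma ip_eq_0_AE:
  assumes "ip \<phi> \<phi> = 0" shows "AE y in \<mu>. \<phi> y = 0"
  using integral_nonneg_eq_0_iff_AE[of \<mu> "\<lambda>y. \<phi> y * \<phi> y"] dual_integrable_power[of 2] assms
  by (simp add: ip_def power2_eq_square)

end

lemma integrable_dual_prod:
  assumes "\<phi> \<in> top_dual" "\<psi> \<in> top_dual"
  shows "integrable \<mu> (\<lambda>y. \<phi> y * \<psi> y)"
proof (rule Bochner_Integration.integrable_bound)
  show "integrable \<mu> (\<lambda>y. (\<phi> y)\<^sup>2 + (\<psi> y)\<^sup>2)"
    using assms dual_integrable_power by auto
  have "\<bar>a * b\<bar> \<le> \<bar>a\<^sup>2 + b\<^sup>2\<bar>" for a b :: real
  proof -
    have "0 \<le> \<bar>a\<bar> * \<bar>b\<bar>" by simp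
    moreover have "2 * (\<bar>a\<bar> * \<bar>b\<bar>) \<le> a\<^sup>2 + b\<^sup>2" using sum_squares_bound[of "\<bar>a\<bar>" "\<bar>b\<bar>"] by simp
    ultimately show ?thesis unfolding abs_mult by linarith
  qed
  then show "AE y in \<mu>. norm (\<phi> y * \<psi> y) \<le> norm ((\<phi> y)\<^sup>2 + (\<psi> y)\<^sup>2)" by simp
qed (use dual_meas assms in auto)

lemma ip_lin_left:
  assumes "\<phi> \<in> top_dual" "\<psi> \<in> top_dual" "\<theta> \<in> top_dual"
  shows "ip (\<lambda>x. a * \<phi> x + b * \<psi> x) \<theta> = a * ip \<phi> \<theta> + b * ip \<psi> \<theta>"
proof -
  have "ip (\<lambda>x. a * \<phi> x + b * \<psi> x) \<theta> = (\<integral>y. a * (\<phi> y * \<theta> y) + b * (\<psi> y * \<theta> y) \<partial>\<mu>)"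
    by (simp add: ip_def algebra_simps)
  also have "\<dots> = a * ip \<phi> \<theta> + b * ip \<psi> \<theta>"
    using assms integrable_dual_prod by (simp add: ip_def)
  finally show ?thesis .
qed

lemma ip_lin_right:
  assumes "\<phi> \<in> top_dual" "\<psi> \<in> top_dual" "\<theta> \<in> top_dual"
  shows "ip \<theta> (\<lambda>x. a * \<phi> x + b * \<psi> x) = a * ip \<theta> \<phi> + b * ip \<theta> \<psi>"
  using ip_lin_left[OF assms, of a b] by (simp add: ip_commute)

lemma ip_lin_self:
  assumes "\<phi> \<in> top_dual" "\<psi> \<in> top_dual"
  shows "ip (\<lambda>x. a * \<phi> x + b * \<psi> x) (\<lambda>x. a * \<phi> x + b * \<psi> x) = a\<^sup>2 * ip \<phi> \<phi> + 2 * a * b * ip \<phi> \<psi> + b\<^sup>2 * ip \<psi> \<psi>"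
  using assms top_dual_lin[OF assms, of a b]
  by (simp add: ip_lin_left ip_lin_right) (simp add: ip_commute[of \<psi> \<phi>] algebra_simps power2_eq_square)

lemma ip_zero_left: "ip (\<lambda>_. 0) \<theta> = 0"
  by (simp add: ip_def)

lemma ip_sum_left:
  assumes "\<And>i. i \<in> I \<Longrightarrow> \<phi> i \<in> top_dual" "\<theta> \<in> top_dual"
  shows "ip (\<lambda>x. \<Sum>i\<in>I. a i * \<phi> i x) \<theta> = (\<Sum>i\<in>I. a i * ip (\<phi> i) \<theta>)"
  using assms
proof (induction I rule: infinite_finite_induct)
  case (insert i I)
  then show ?case
    using ip_lin_left[of "\<phi> i" "\<lambda>x. \<Sum>i\<in>I. a i * \<phi> i x" \<theta> "a i" 1] top_dual_sum[of I \<phi> a] by simp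
qed (simp_all add: ip_zero_left)

lemma ip_Cauchy_Schwarz:
  assumes "\<phi> \<in> top_dual" "\<psi> \<in> top_dual"
  shows "\<bar>ip \<phi> \<psi>\<bar> \<le> sqrt (ip \<phi> \<phi>) * sqrt (ip \<psi> \<psi>)"
proof (cases "ip \<phi> \<phi> = 0")
  case True
  have "AE y in \<mu>. \<phi> y * \<psi> y = 0" using ip_eq_0_AE[OF assms(1) True] by auto
  then have "ip \<phi> \<psi> = (\<integral>y. 0 \<partial>\<mu>)"
    unfolding ip_def using dual_meas assms by (intro integral_cong_AE) auto
  then show ?thesis using ip_nonneg assms by simp
next
  case False
  then have pos: "0 < ip \<phi> \<phi>" using ip_nonneg[OF assms(1)] by simp
  define t where "t = - ip \<phi> \<psi> / ip \<phi> \<phi>"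
  have "0 \<le> ip (\<lambda>x. t * \<phi> x + 1 * \<psi> x) (\<lambda>x. t * \<phi> x + 1 * \<psi> x)"
    by (intro ip_nonneg top_dual_lin assms)
  also have "\<dots> = ip \<psi> \<psi> - (ip \<phi> \<psi>)\<^sup>2 / ip \<phi> \<phi>"
    unfolding ip_lin_self[OF assms] using pos by (simp add: t_def power2_eq_square field_simps)
  finally have "(ip \<phi> \<psi>)\<^sup>2 \<le> ip \<phi> \<phi> * ip \<psi> \<psi>" using pos by (simp add: field_simps)
  then have "sqrt ((ip \<phi> \<psi>)\<^sup>2) \<le> sqrt (ip \<phi> \<phi> * ip \<psi> \<psi>)" by (rule real_sqrt_le_mono)
  then show ?thesis by (simp add: real_sqrt_mult)
qed

end

section \<open>Covariance elements and the Cameron-Martin formula\<close>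

context souslin_gaussian
begin

text \<open>If \<open>\<phi>\<close> were a function of \<open>z - \<phi>(z) \<xi>\<close> (seen through the functionals \<open>\<theta> n\<close>, where
  \<open>\<xi> n = \<langle>\<theta> n, \<phi>\<rangle> / \<parallel>\<phi>\<parallel>\<^sup>2\<close>), from which it is independent, then the half-space \<open>{\<phi> \<le> 0}\<close> would be
  independent of itself; by Lusin's theorem this covers non-measurable functions as well. So two points
  differ by a multiple of the covariance element.\<close>

lemma cov_element_sequence:
  fixes \<theta> :: "nat \<Rightarrow> 'g \<Rightarrow> real"
  assumes phi: "\<phi> \<in> top_dual" and th: "\<And>n. \<theta> n \<in> top_dual" and pos: "0 < ip \<phi> \<phi>"
  shows "\<exists>h. \<forall>n. \<theta> n h = ip (\<theta> n) \<phi>"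
proof -
  define s where "s = ip \<phi> \<phi>"
  define \<xi> where "\<xi> n = ip (\<theta> n) \<phi> / s" for n
  define R where "R z = (\<lambda>n. \<theta> n z - \<phi> z * \<xi> n)" for z
  have Rc: "continuous_on UNIV R"
    unfolding R_def using phi th
    by (intro continuous_on_coordinatewise_then_product continuous_on_diff continuous_on_mult continuous_on_const
        top_dual_continuous)
  have Rm: "R \<in> measurable \<mu> borel"
    using borel_measurable_continuous_onI[OF Rc] measurable_cong_sets[OF sets_mu refl] by blast
  \<comment> \<open>Functions of the residual that, read as functions of \<open>z\<close>, are
    functionals uncorrelated with \<open>\<phi>\<close>. The value of \<open>\<xi>\<close> puts the
    coordinates into \<open>V\<close>, so \<open>V\<close> generates the Borel sets of the sequence
    space.\<close>
  define V where "V = {f :: (nat \<Rightarrow> real) \<Rightarrow> real. f \<in> borel_measurable borel \<and>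
    (\<exists>\<psi>\<in>top_dual. ip \<psi> \<phi> = 0 \<and> (\<forall>z. f (R z) = \<psi> z))}"
  have coord: "(\<lambda>r. r n) \<in> V" for n
  proof -
    have d: "(\<lambda>z. 1 * \<theta> n z + (- \<xi> n) * \<phi> z) \<in> top_dual" by (intro top_dual_lin th phi)
    have "ip (\<lambda>z. 1 * \<theta> n z + (- \<xi> n) * \<phi> z) \<phi> = 0"
      unfolding ip_lin_left[OF th phi phi] using pos by (simp add: \<xi>_def s_def)
    with d show ?thesis by (auto simp: V_def R_def intro!: bexI[OF _ d])
  qed
  have split: "distr \<mu> (borel \<Otimes>\<^sub>M borel) (\<lambda>z. (R z, \<phi> z)) = distr \<mu> borel R \<Otimes>\<^sub>M normal_law (sqrt s)"
  proof (rule gaussian_split[where V=V])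
    show "prob_space \<mu>" by (rule prob_space_axioms)
    show "R \<in> measurable \<mu> borel" by (rule Rm)
    show "\<phi> \<in> borel_measurable \<mu>" by (rule dual_meas[OF phi])
    show "\<psi> \<in> borel_measurable borel" if "\<psi> \<in> V" for \<psi> using that by (simp add: V_def)
    show "V \<noteq> {}" using coord by blast
    show "(\<lambda>x. a * f x + b * g x) \<in> V" if "f \<in> V" "g \<in> V" for f g a b
    proof -
      obtain \<psi> \<psi>' where psi: "\<psi> \<in> top_dual" "ip \<psi> \<phi> = 0" "\<And>z. f (R z) = \<psi> z"
          "\<psi>' \<in> top_dual" "ip \<psi>' \<phi> = 0" "\<And>z. g (R z) = \<psi>' z"
        using \<open>f \<in> V\<close> \<open>g \<in> V\<close> unfolding V_def by blast
      have [measurable]: "f \<in> borel_measurable borel" "g \<in> borel_measurable borel"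
        using that by (auto simp: V_def)
      have "ip (\<lambda>z. a * \<psi> z + b * \<psi>' z) \<phi> = 0" using psi phi by (simp add: ip_lin_left)
      then show ?thesis
        unfolding V_def using psi top_dual_lin[OF psi(1,4), of a b] by auto
    qed
    have "sets (borel :: (nat \<Rightarrow> real) measure) = sigma_sets UNIV {{r. r i \<in> A} | i A. A \<in> sets borel}"
      unfolding sets_PiM_equal_borel[symmetric] sets_PiM_single by (simp add: PiE_UNIV_domain)
    also have "\<dots> \<subseteq> sigma_sets UNIV {\<psi> -` S \<inter> UNIV | \<psi> S. \<psi> \<in> V \<and> S \<in> sets borel}"
    proof (rule sigma_sets_mono', clarify)
      fix i and A :: "real set" assume "A \<in> sets borel"
      then show "\<exists>\<psi> S. {r. r i \<in> A} = \<psi> -` S \<inter> UNIV \<and> \<psi> \<in> V \<and> S \<in> sets borel"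
        using coord[of i] by (intro exI[of _ "\<lambda>r. r i"] exI[of _ A]) auto
    qed
    finally show "sets (borel :: (nat \<Rightarrow> real) measure)
      \<subseteq> sigma_sets (space borel) {\<psi> -` S \<inter> space borel | \<psi> S. \<psi> \<in> V \<and> S \<in> sets borel}" by simp
    show "(\<integral>z. cos (f (R z) + b * \<phi> z) \<partial>\<mu>) = (\<integral>z. cos (f (R z)) \<partial>\<mu>) * exp (- (b\<^sup>2 * (sqrt s)\<^sup>2) / 2)"
      "(\<integral>z. sin (f (R z) + b * \<phi> z) \<partial>\<mu>) = (\<integral>z. sin (f (R z)) \<partial>\<mu>) * exp (- (b\<^sup>2 * (sqrt s)\<^sup>2) / 2)"
      if fV: "f \<in> V" for f b
    proof -
      obtain \<psi> where psi: "\<psi> \<in> top_dual" "ip \<psi> \<phi> = 0" "\<And>z. f (R z) = \<psi> z"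
        using fV unfolding V_def by blast
      have d: "(\<lambda>z. 1 * \<psi> z + b * \<phi> z) \<in> top_dual" by (intro top_dual_lin psi phi)
      have "ip (\<lambda>z. 1 * \<psi> z + b * \<phi> z) (\<lambda>z. 1 * \<psi> z + b * \<phi> z) = ip \<psi> \<psi> + b\<^sup>2 * s"
        unfolding ip_lin_self[OF psi(1) phi] by (simp add: psi s_def)
      then show "(\<integral>z. cos (f (R z) + b * \<phi> z) \<partial>\<mu>) = (\<integral>z. cos (f (R z)) \<partial>\<mu>) * exp (- (b\<^sup>2 * (sqrt s)\<^sup>2) / 2)"
        using dual_cos[OF d] dual_cos[OF psi(1)] pos by (simp add: psi s_def add_divide_distrib flip: exp_add)
      show "(\<integral>z. sin (f (R z) + b * \<phi> z) \<partial>\<mu>) = (\<integral>z. sin (f (R z)) \<partial>\<mu>) * exp (- (b\<^sup>2 * (sqrt s)\<^sup>2) / 2)"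
        using dual_sin[OF d] dual_sin[OF psi(1)] by (simp add: psi)
    qed
  qed
  define H where "H = {z. \<phi> z \<le> 0}"
  have Hm: "H \<in> sets \<mu>" using dual_meas[OF phi] by (simp add: H_def) measurable
  have "\<exists>z z'. R z = R z' \<and> \<phi> z \<le> 0 \<and> 0 < \<phi> z'"
  proof (rule ccontr)
    assume contra: "\<not> ?thesis"
    have "closed H"
      using closed_vimage[of "{..0::real}" \<phi>] top_dual_continuous[OF phi] by (simp add: H_def vimage_def)
    then have "closed H" "open (- H)" by (auto simp: closed_def)
    then have "borel_separated (R ` H) (R ` (- H))"
    proof (intro souslin_borel_separated[OF souslin Rc])
      have "R z \<noteq> R z'" if "z \<in> H" "z' \<notin> H" for z z' using contra that by (simp add: H_def) (metis not_le)
      then show "R ` H \<inter> R ` (- H) = {}" by blast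
    qed auto
    then obtain B where B: "B \<in> sets borel" "R ` H \<subseteq> B" "R ` (- H) \<inter> B = {}"
      by (auto simp: borel_separated_def)
    have HB: "R z \<in> B \<longleftrightarrow> z \<in> H" for z using B by blast
    define p where "p = measure \<mu> H"
    interpret RN: pair_prob_space "distr \<mu> borel R" "normal_law (sqrt s)"
      by (intro pair_prob_space.intro pair_sigma_finite.intro prob_space_imp_sigma_finite prob_space_distr Rm prob_space_normal_law)
    have "emeasure (distr \<mu> (borel \<Otimes>\<^sub>M borel) (\<lambda>z. (R z, \<phi> z))) (B \<times> {..0}) = emeasure \<mu> H"
      using B(1) Rm dual_meas[OF phi] HB
      by (subst emeasure_distr) (auto simp: H_def intro!: arg_cong[where f="emeasure \<mu>"])
    moreover have "emeasure (distr \<mu> borel R \<Otimes>\<^sub>M normal_law (sqrt s)) (B \<times> {..0}) =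
        emeasure (distr \<mu> borel R) B * emeasure (normal_law (sqrt s)) {..0}"
      using B(1) by (intro RN.M2.emeasure_pair_measure_Times) auto
    moreover have "emeasure (distr \<mu> borel R) B = emeasure \<mu> H"
      using B(1) Rm HB by (subst emeasure_distr) (auto intro!: arg_cong[where f="emeasure \<mu>"])
    moreover have "emeasure (normal_law (sqrt s)) {..0} = emeasure \<mu> H"
      using dual_meas[OF phi] unfolding s_def dual_normal_law[OF phi, symmetric]
      by (subst emeasure_distr) (auto simp: H_def intro!: arg_cong[where f="emeasure \<mu>"])
    ultimately have "emeasure \<mu> H = emeasure \<mu> H * emeasure \<mu> H" using split by simp
    then have "p = p * p" by (simp add: emeasure_eq_measure p_def flip: ennreal_mult)
    then have "p = 0 \<or> p = 1" by simp
    \<comment> \<open>A half-space of probability 0 or 1 gives \<open>\<phi>\<close> an almost sure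
      sign. As its mean is zero, it vanishes almost everywhere, contrary to its positive
      variance.\<close>
    then have "(AE z in \<mu>. 0 \<le> \<phi> z) \<or> (AE z in \<mu>. 0 \<le> - \<phi> z)"
    proof
      assume "p = 0"
      then have "AE z in \<mu>. z \<notin> H"
        using Hm by (intro AE_not_in) (auto simp: null_sets_def emeasure_eq_measure p_def)
      then show ?thesis by (auto simp: H_def elim: eventually_mono)
    next
      assume "p = 1"
      then have "AE z in \<mu>. z \<in> H" using Hm by (simp add: prob_eq_1 p_def)
      then show ?thesis by (auto simp: H_def elim: eventually_mono)
    qed
    then have "AE z in \<mu>. \<phi> z = 0"
    proof
      have int: "integrable \<mu> \<phi>" "integrable \<mu> (\<lambda>z. - \<phi> z)"
        using dual_integrable_power[OF phi, of 1] by simp_all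
      show ?thesis if "AE z in \<mu>. 0 \<le> \<phi> z"
        using integral_nonneg_eq_0_iff_AE[OF int(1) that] dual_expectation[OF phi] by simp
      show ?thesis if "AE z in \<mu>. 0 \<le> - \<phi> z"
        using integral_nonneg_eq_0_iff_AE[OF int(2) that] dual_expectation[OF phi] by simp
    qed
    then have "ip \<phi> \<phi> = (\<integral>z. 0 \<partial>\<mu>)"
      unfolding ip_def using dual_meas[OF phi] by (intro integral_cong_AE) auto
    then show False using pos by simp
  qed
  then obtain z z' where z: "R z = R z'" "\<phi> z \<le> 0" "0 < \<phi> z'" by blast
  define t where "t = \<phi> z' - \<phi> z"
  have t: "0 < t" using z by (simp add: t_def)
  \<comment> \<open>Since the residuals agree, \<open>\<theta> n\<close> takes the value
    \<open>t * \<xi> n\<close> at \<open>z' - z\<close>; the factor \<open>s / t\<close> turns this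
    into the covariance.\<close>
  have "\<theta> n ((s / t) *\<^sub>R (z' - z)) = ip (\<theta> n) \<phi>" for n
  proof -
    have "\<theta> n z - \<phi> z * \<xi> n = \<theta> n z' - \<phi> z' * \<xi> n" using fun_cong[OF z(1), of n] by (simp add: R_def)
    then have "\<theta> n z' - \<theta> n z = t * \<xi> n" by (simp add: t_def algebra_simps)
    then show ?thesis using t pos by (simp add: top_dual_simps[OF th] \<xi>_def s_def)
  qed
  then show ?thesis by blast
qed

text \<open>The sequence \<open>sep\<close> already determines \<open>h\<close>. To test another
  functional \<open>\<psi>\<close>, it is put in front of the sequence: the element found for the
  longer sequence agrees with \<open>h\<close> on every \<open>sep n\<close>, hence equals
  \<open>h\<close>.\<close>

theorem cov_element:
  assumes phi: "\<phi> \<in> top_dual"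
  shows "\<exists>h. \<forall>\<psi>\<in>top_dual. \<psi> h = ip \<psi> \<phi>"
proof (cases "ip \<phi> \<phi> = 0")
  case True
  have "ip \<psi> \<phi> = 0" if "\<psi> \<in> top_dual" for \<psi>
    using ip_Cauchy_Schwarz[OF that phi] True by simp
  then show ?thesis by (intro exI[of _ 0]) (simp add: top_dual_simps)
next
  case False
  then have pos: "0 < ip \<phi> \<phi>" using ip_nonneg[OF phi] by simp
  obtain h where h: "\<And>n. sep n h = ip (sep n) \<phi>"
    using cov_element_sequence[of \<phi> sep, OF phi sep_dual pos] by blast
  have "\<psi> h = ip \<psi> \<phi>" if psi: "\<psi> \<in> top_dual" for \<psi>
  proof -
    have "case_nat \<psi> sep n \<in> top_dual" for n using psi sep_dual by (cases n) auto
    then obtain h' where h': "\<And>n. case_nat \<psi> sep n h' = ip (case_nat \<psi> sep n) \<phi>"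
      using cov_element_sequence[OF phi _ pos] by blast
    have "sep n h' = sep n h" for n using h'[of "Suc n"] h[of n] by simp
    then have "h' = h" using sep_separates by blast
    then show ?thesis using h'[of 0] by simp
  qed
  then show ?thesis by blast
qed

text \<open>The hypothesis says that \<open>f\<close> behaves like a Gaussian variable of variance \<open>s\<close> whose
  covariance with every \<open>\<psi> \<in> G'\<close> is \<open>\<psi> h\<close>. The proof splits \<open>z\<close> into \<open>z - (f z / s) h\<close> and the
  independent component \<open>f z\<close>, and shifts only the latter.\<close>

theorem cameron_martin:
  assumes f: "f \<in> borel_measurable borel" and s: "0 \<le> s"
    and c: "\<And>\<psi> b. \<psi> \<in> top_dual \<Longrightarrow> (\<integral>z. cos (\<psi> z + b * f z) \<partial>\<mu>) = exp (- (ip \<psi> \<psi> + 2 * b * \<psi> h + b\<^sup>2 * s) / 2)"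
    and sn: "\<And>\<psi> b. \<psi> \<in> top_dual \<Longrightarrow> (\<integral>z. sin (\<psi> z + b * f z) \<partial>\<mu>) = 0"
    and g: "g \<in> borel_measurable borel"
  shows "(\<integral>\<^sup>+z. g (z + h) \<partial>\<mu>) = (\<integral>\<^sup>+z. g z * ennreal (exp (f z - s / 2)) \<partial>\<mu>)"
proof -
  have fm: "f \<in> borel_measurable \<mu>" using f measurable_cong_sets[OF sets_mu refl] by blast
  note [measurable] = f fm
  have gm [measurable]: "g \<in> borel_measurable \<mu>" using g measurable_cong_sets[OF sets_mu refl] by blast
  show ?thesis
  proof (cases "s = 0")
    \<comment> \<open>At variance 0 the variable \<open>f\<close> vanishes almost everywhere;
      comparing the two values of the characteristic function gives \<open>\<psi> h = 0\<close> for
      every functional, so \<open>h = 0\<close>.\<close>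
    case True
    have "distr \<mu> borel f = distr \<mu> borel (\<lambda>_. 0)"
    proof (rule finite_measure_eqI_cos_sin)
      show "finite_measure (distr \<mu> borel f)" by (intro finite_measure_distr) measurable
      show "finite_measure (distr \<mu> borel (\<lambda>_. 0))" by (intro finite_measure_distr) measurable
      fix t
      show "(\<integral>x. cos (t * x) \<partial>distr \<mu> borel f) = (\<integral>x. cos (t * x) \<partial>distr \<mu> borel (\<lambda>_. 0))"
        "(\<integral>x. sin (t * x) \<partial>distr \<mu> borel f) = (\<integral>x. sin (t * x) \<partial>distr \<mu> borel (\<lambda>_. 0))"
        using c[OF top_dual_zero, of t] sn[OF top_dual_zero, of t] True
        by (simp_all add: integral_distr ip_zero_left prob_space[unfolded space_mu] del: distr_const)
    qed simp_all
    then have "(AE x in distr \<mu> borel f. x = 0) = (AE x in distr \<mu> borel (\<lambda>_. 0::real). x = 0)" by (simp only:)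
    then have f0: "AE z in \<mu>. f z = 0" by (simp add: AE_distr_iff)
    have "h = 0"
    proof (rule top_dual_eqI)
      fix \<psi> :: "'g \<Rightarrow> real" assume psi: "\<psi> \<in> top_dual"
      have "exp (- (ip \<psi> \<psi> + 2 * 1 * \<psi> h + 1\<^sup>2 * s) / 2) = (\<integral>z. cos (\<psi> z + 1 * f z) \<partial>\<mu>)" by (rule c[OF psi, symmetric])
      also have "\<dots> = (\<integral>z. cos (\<psi> z) \<partial>\<mu>)"
        using f0 dual_meas[OF psi] by (intro integral_cong_AE) auto
      also have "\<dots> = exp (- ip \<psi> \<psi> / 2)" by (rule dual_cos[OF psi])
      finally show "\<psi> h = \<psi> 0" using True by (simp add: top_dual_simps[OF psi])
    qed
    then show ?thesis using f0 True by (intro nn_integral_cong_AE) auto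
  next
    case False
    then have pos: "0 < s" using s by simp
    \<comment> \<open>The coefficient \<open>1 / s\<close> removes the correlation: the covariance
      of \<open>\<psi> (R z)\<close> with \<open>f z\<close> is
      \<open>\<psi> h - (\<psi> h / s) * s = 0\<close>.\<close>
    define R where "R z = z + (- f z / s) *\<^sub>R h" for z
    have Rm [measurable]: "R \<in> measurable \<mu> borel"
      unfolding R_def by (intro measurable_add measurable_scaleR) (auto simp: measurable_cong_sets[OF sets_mu refl])
    have R: "\<psi> (R z) = \<psi> z - \<psi> h / s * f z" if "\<psi> \<in> top_dual" for \<psi> z
      by (simp add: R_def top_dual_simps[OF that])
    have split: "distr \<mu> (borel \<Otimes>\<^sub>M borel) (\<lambda>z. (R z, f z)) = distr \<mu> borel R \<Otimes>\<^sub>M normal_law (sqrt s)"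
    proof (rule gaussian_split[where V=top_dual])
      have e: "- (ip \<psi> \<psi> + 2 * (b - \<psi> h / s) * \<psi> h + (b - \<psi> h / s)\<^sup>2 * s) / 2 =
          - (ip \<psi> \<psi> + 2 * (- (\<psi> h / s)) * \<psi> h + (- (\<psi> h / s))\<^sup>2 * s) / 2 + - (b\<^sup>2 * (sqrt s)\<^sup>2) / 2" for \<psi> b
        using pos by (simp add: power2_eq_square field_simps)
      have eq: "\<psi> (R z) + b * f z = \<psi> z + (b - \<psi> h / s) * f z" "\<psi> (R z) = \<psi> z + (- (\<psi> h / s)) * f z"
        if "\<psi> \<in> top_dual" for \<psi> b z
        using R[OF that] by (simp_all add: algebra_simps)
      show "(\<integral>z. cos (\<psi> (R z) + b * f z) \<partial>\<mu>) = (\<integral>z. cos (\<psi> (R z)) \<partial>\<mu>) * exp (- (b\<^sup>2 * (sqrt s)\<^sup>2) / 2)"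
        if psi: "\<psi> \<in> top_dual" for \<psi> b
        unfolding eq(1)[OF psi] unfolding eq(2)[OF psi] c[OF psi] e exp_add ..
      show "(\<integral>z. sin (\<psi> (R z) + b * f z) \<partial>\<mu>) = (\<integral>z. sin (\<psi> (R z)) \<partial>\<mu>) * exp (- (b\<^sup>2 * (sqrt s)\<^sup>2) / 2)"
        if psi: "\<psi> \<in> top_dual" for \<psi> b
        unfolding eq(1)[OF psi] unfolding eq(2)[OF psi] sn[OF psi] by simp
      show "prob_space \<mu>" by (rule prob_space_axioms)
      show "top_dual \<noteq> ({} :: ('g \<Rightarrow> real) set)" using top_dual_zero by blast
      show "(\<lambda>x. a * \<psi> x + b * \<theta> x) \<in> top_dual" if "\<psi> \<in> top_dual" "\<theta> \<in> top_dual" for a b and \<psi> \<theta> :: "'g \<Rightarrow> real"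
        using that by (rule top_dual_lin)
    qed (use Rm fm top_dual_measurable top_dual_generates in auto)
    interpret RN: pair_prob_space "distr \<mu> borel R" "normal_law (sqrt s)"
      by (intro pair_prob_space.intro pair_sigma_finite.intro prob_space_imp_sigma_finite prob_space_distr Rm prob_space_normal_law)
    have key: "(\<integral>\<^sup>+z. k (R z, f z) \<partial>\<mu>) = (\<integral>\<^sup>+r. (\<integral>\<^sup>+u. k (r, u) \<partial>normal_law (sqrt s)) \<partial>distr \<mu> borel R)"
      if k: "k \<in> borel_measurable (borel \<Otimes>\<^sub>M borel)" for k
    proof -
      have km: "k \<in> borel_measurable (distr \<mu> borel R \<Otimes>\<^sub>M normal_law (sqrt s))"
        using k by (simp cong: measurable_cong_sets sets_pair_measure_cong)
      have "(\<integral>\<^sup>+z. k (R z, f z) \<partial>\<mu>) = (\<integral>\<^sup>+x. k x \<partial>distr \<mu> (borel \<Otimes>\<^sub>M borel) (\<lambda>z. (R z, f z)))"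
        using k Rm fm by (simp add: nn_integral_distr)
      also have "\<dots> = (\<integral>\<^sup>+r. (\<integral>\<^sup>+u. k (r, u) \<partial>normal_law (sqrt s)) \<partial>distr \<mu> borel R)"
        unfolding split using RN.M2.nn_integral_fst[OF km] by simp
      finally show ?thesis .
    qed
    have gG: "(\<lambda>(r, u). g (r + ((u + c) / s) *\<^sub>R h)) \<in> borel_measurable (borel \<Otimes>\<^sub>M borel)" for c
      unfolding split_beta by (rule measurable_compose[OF _ g]) (intro measurable_add measurable_scaleR, auto)
    \<comment> \<open>Since \<open>z\<close> equals \<open>R z + (f z / s) *\<^sub>R h\<close>,
      adding \<open>h\<close> means adding \<open>s\<close> to \<open>f z\<close>, and
      \<open>s\<close> is the square of the parameter \<open>sqrt s\<close>, as
      \<open>normal_law_shift\<close> requires.\<close>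
    have "(\<integral>\<^sup>+z. g (z + h) \<partial>\<mu>) = (\<integral>\<^sup>+z. (\<lambda>(r, u). g (r + ((u + s) / s) *\<^sub>R h)) (R z, f z) \<partial>\<mu>)"
      using pos by (simp add: R_def add_divide_distrib scaleR_left_distrib)
    also have "\<dots> = (\<integral>\<^sup>+r. (\<integral>\<^sup>+u. g (r + ((u + (sqrt s)\<^sup>2) / s) *\<^sub>R h) \<partial>normal_law (sqrt s)) \<partial>distr \<mu> borel R)"
      by (subst key[OF gG]) (use pos in simp)
    also have "\<dots> = (\<integral>\<^sup>+r. (\<integral>\<^sup>+u. g (r + (u / s) *\<^sub>R h) * ennreal (exp (u - (sqrt s)\<^sup>2 / 2)) \<partial>normal_law (sqrt s)) \<partial>distr \<mu> borel R)"
    proof (rule nn_integral_cong)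
      fix r
      have "(\<lambda>u. g (r + (u / s) *\<^sub>R h)) \<in> borel_measurable borel"
        by (rule measurable_compose[OF _ g]) (intro measurable_add measurable_scaleR, auto)
      from normal_law_shift[OF this, of "sqrt s"]
      show "(\<integral>\<^sup>+u. g (r + ((u + (sqrt s)\<^sup>2) / s) *\<^sub>R h) \<partial>normal_law (sqrt s)) =
        (\<integral>\<^sup>+u. g (r + (u / s) *\<^sub>R h) * ennreal (exp (u - (sqrt s)\<^sup>2 / 2)) \<partial>normal_law (sqrt s))" .
    qed
    also have "\<dots> = (\<integral>\<^sup>+z. (\<lambda>(r, u). g (r + (u / s) *\<^sub>R h) * ennreal (exp (u - s / 2))) (R z, f z) \<partial>\<mu>)"
    proof (subst key)
      show "(\<lambda>(r, u). g (r + (u / s) *\<^sub>R h) * ennreal (exp (u - s / 2))) \<in> borel_measurable (borel \<Otimes>\<^sub>M borel)"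
        using gG[of 0] by (simp add: split_beta)
    qed (use pos in simp)
    also have "\<dots> = (\<integral>\<^sup>+z. g z * ennreal (exp (f z - s / 2)) \<partial>\<mu>)"
      by (simp add: R_def)
    finally show ?thesis .
  qed
qed

end

section \<open>The Cameron-Martin space\<close>

lemma sqrt_le_cancel:
  assumes "0 \<le> a" "a \<le> sqrt a * B" "0 \<le> B" shows "sqrt a \<le> B"
proof (cases "a = 0")
  case False
  then have "sqrt a * sqrt a \<le> sqrt a * B" "0 < sqrt a" using assms by auto
  then show ?thesis by (simp only: mult_le_cancel_left_pos)
qed (use assms in simp)

context souslin_gaussian
begin

lemma cov_ball_iff: "\<phi> \<in> cov_ball \<mu> \<longleftrightarrow> \<phi> \<in> top_dual \<and> ip \<phi> \<phi> \<le> 1"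
  by (simp add: cov_ball_def ip_def power2_eq_square)

text \<open>Homogeneity extends the supremum over \<open>cov_ball \<mu>\<close> to all functionals.
  If \<open>\<phi>\<close> has variance 0, all its multiples lie in that ball, and finiteness of the
  supremum forces \<open>\<phi> h = 0\<close>.\<close>

lemma cm_bound:
  assumes h: "h \<in> cm_space \<mu>" and phi: "\<phi> \<in> top_dual"
  shows "\<bar>\<phi> h\<bar> \<le> sqrt (ip \<phi> \<phi>) * cm_norm \<mu> h"
proof -
  have bdd: "bdd_above ((\<lambda>\<phi>. \<phi> h) ` cov_ball \<mu>)" using h by (simp add: cm_space_def)
  have scaled: "(\<lambda>x. t * \<phi> x) \<in> top_dual" "ip (\<lambda>x. t * \<phi> x) (\<lambda>x. t * \<phi> x) = t\<^sup>2 * ip \<phi> \<phi>" for t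
    using top_dual_lin[OF phi phi, of t 0] ip_lin_self[OF phi phi, of t 0] by simp_all
  have upper: "t * \<phi> h \<le> cm_norm \<mu> h" if "t\<^sup>2 * ip \<phi> \<phi> \<le> 1" for t
    unfolding cm_norm_def
    using cSUP_upper[OF _ bdd, of "\<lambda>x. t * \<phi> x"] scaled[of t] that by (simp add: cov_ball_iff)
  show ?thesis
  proof (cases "ip \<phi> \<phi> = 0")
    case True
    have "\<phi> h = 0"
    proof (rule ccontr)
      assume "\<phi> h \<noteq> 0"
      then show False using upper[of "(cm_norm \<mu> h + 1) / \<phi> h"] True by simp
    qed
    then show ?thesis using True by simp
  next
    case False
    then have pos: "0 < ip \<phi> \<phi>" using ip_nonneg[OF phi] by simp
    have "t * \<phi> h \<le> cm_norm \<mu> h" if "\<bar>t\<bar> = 1 / sqrt (ip \<phi> \<phi>)" for t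
    proof (rule upper)
      have "t\<^sup>2 = \<bar>t\<bar>\<^sup>2" by simp
      then show "t\<^sup>2 * ip \<phi> \<phi> \<le> 1" unfolding that using pos by (simp add: power_divide)
    qed
    from this[of "1 / sqrt (ip \<phi> \<phi>)"] this[of "- (1 / sqrt (ip \<phi> \<phi>))"]
    have "\<phi> h \<le> sqrt (ip \<phi> \<phi>) * cm_norm \<mu> h" "- \<phi> h \<le> sqrt (ip \<phi> \<phi>) * cm_norm \<mu> h"
      using pos by (simp_all add: field_simps)
    then show ?thesis by linarith
  qed
qed

lemma cm_norm_leI:
  assumes "\<And>\<phi>. \<phi> \<in> top_dual \<Longrightarrow> \<bar>\<phi> h\<bar> \<le> sqrt (ip \<phi> \<phi>) * B" and B: "0 \<le> B"
  shows "h \<in> cm_space \<mu>" "cm_norm \<mu> h \<le> B"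
proof -
  have *: "\<phi> h \<le> B" if "\<phi> \<in> cov_ball \<mu>" for \<phi>
  proof -
    have "\<bar>\<phi> h\<bar> \<le> sqrt (ip \<phi> \<phi>) * B" using assms(1) that by (simp add: cov_ball_iff)
    also have "\<dots> \<le> 1 * B" using that B by (intro mult_right_mono) (auto simp: cov_ball_iff)
    finally show ?thesis by simp
  qed
  show "h \<in> cm_space \<mu>" unfolding cm_space_def using * by (auto intro!: bdd_aboveI2)
  have "(\<lambda>_. 0) \<in> cov_ball \<mu>" using top_dual_zero ip_zero_left by (simp add: cov_ball_iff)
  then have "cov_ball \<mu> \<noteq> {}" by blast
  then show "cm_norm \<mu> h \<le> B" unfolding cm_norm_def using * by (intro cSUP_least) auto
qed

lemma cm_norm_nonneg:
  assumes h: "h \<in> cm_space \<mu>" shows "0 \<le> cm_norm \<mu> h"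
proof -
  have "(\<lambda>_. 0) \<in> cov_ball \<mu>" using top_dual_zero ip_zero_left by (simp add: cov_ball_iff)
  then show ?thesis
    using cSUP_upper[of "\<lambda>_. 0" "cov_ball \<mu>" "\<lambda>\<phi>. \<phi> h"] h by (simp add: cm_norm_def cm_space_def)
qed

text \<open>The covariance operator is isometric for the L2 norm: Cauchy-Schwarz gives one
  inequality, and testing \<open>h\<close> against \<open>\<phi>\<close> itself gives the
  other.\<close>

lemma cm_cov_element:
  assumes phi: "\<phi> \<in> top_dual" and h: "\<And>\<psi>. \<psi> \<in> top_dual \<Longrightarrow> \<psi> h = ip \<psi> \<phi>"
  shows "h \<in> cm_space \<mu>" "cm_norm \<mu> h = sqrt (ip \<phi> \<phi>)"
proof -
  have "\<bar>\<psi> h\<bar> \<le> sqrt (ip \<psi> \<psi>) * sqrt (ip \<phi> \<phi>)" if "\<psi> \<in> top_dual" for \<psi>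
    using ip_Cauchy_Schwarz[OF that phi] h[OF that] by simp
  note * = cm_norm_leI[OF this]
  show hcm: "h \<in> cm_space \<mu>" using * ip_nonneg[OF phi] by simp
  have "ip \<phi> \<phi> \<le> sqrt (ip \<phi> \<phi>) * cm_norm \<mu> h"
    using cm_bound[OF hcm phi] h[OF phi] by simp
  then have "sqrt (ip \<phi> \<phi>) \<le> cm_norm \<mu> h"
    by (intro sqrt_le_cancel ip_nonneg[OF phi] cm_norm_nonneg[OF hcm])
  then show "cm_norm \<mu> h = sqrt (ip \<phi> \<phi>)" using * ip_nonneg[OF phi] by (intro antisym) auto
qed

lemma cm_add:
  assumes h: "h \<in> cm_space \<mu>" and k: "k \<in> cm_space \<mu>"
  shows "h + k \<in> cm_space \<mu>" "cm_norm \<mu> (h + k) \<le> cm_norm \<mu> h + cm_norm \<mu> k"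
proof -
  have "\<bar>\<phi> (h + k)\<bar> \<le> sqrt (ip \<phi> \<phi>) * (cm_norm \<mu> h + cm_norm \<mu> k)" if "\<phi> \<in> top_dual" for \<phi>
    using cm_bound[OF h that] cm_bound[OF k that] by (simp add: top_dual_simps[OF that] algebra_simps)
  note * = cm_norm_leI[OF this]
  then show "h + k \<in> cm_space \<mu>" "cm_norm \<mu> (h + k) \<le> cm_norm \<mu> h + cm_norm \<mu> k"
    using cm_norm_nonneg h k by auto
qed

lemma cm_scaleR:
  assumes h: "h \<in> cm_space \<mu>"
  shows "t *\<^sub>R h \<in> cm_space \<mu>" "cm_norm \<mu> (t *\<^sub>R h) \<le> \<bar>t\<bar> * cm_norm \<mu> h"
proof -
  have "\<bar>\<phi> (t *\<^sub>R h)\<bar> \<le> sqrt (ip \<phi> \<phi>) * (\<bar>t\<bar> * cm_norm \<mu> h)" if "\<phi> \<in> top_dual" for \<phi>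
    using mult_left_mono[OF cm_bound[OF h that], of "\<bar>t\<bar>"]
    by (simp add: top_dual_simps[OF that] abs_mult mult.left_commute)
  note * = cm_norm_leI[OF this]
  then show "t *\<^sub>R h \<in> cm_space \<mu>" "cm_norm \<mu> (t *\<^sub>R h) \<le> \<bar>t\<bar> * cm_norm \<mu> h"
    using cm_norm_nonneg[OF h] by auto
qed

lemma cm_diff:
  assumes h: "h \<in> cm_space \<mu>" and k: "k \<in> cm_space \<mu>"
  shows "h - k \<in> cm_space \<mu>" "cm_norm \<mu> (h - k) \<le> cm_norm \<mu> h + cm_norm \<mu> k"
  using cm_add[OF h cm_scaleR(1)[OF k, of "-1"]] cm_scaleR(2)[OF k, of "-1"] by auto

lemma subspace_cm_space: "subspace (cm_space \<mu>)"
proof (rule subspaceI)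
  show "0 \<in> cm_space \<mu>"
    using cm_norm_leI(1)[of 0 0] by (simp add: top_dual_simps)
qed (auto intro: cm_add cm_scaleR)

text \<open>The normalized covariance element of \<open>\<phi>\<close> is a unit vector at which
  \<open>\<phi>\<close> takes its L2 norm as value. Thus the norm in the dual of the Cameron-Martin
  space controls the L2 norm, and convergence in the sense of \<open>tendsto_cov_inv\<close> becomes
  L2 convergence.\<close>

lemma dual_norm_le:
  assumes phi: "\<phi> \<in> top_dual"
    and B: "\<And>k. k \<in> cm_space \<mu> \<Longrightarrow> cm_norm \<mu> k \<le> 1 \<Longrightarrow> \<bar>\<phi> k\<bar> \<le> B"
  shows "sqrt (ip \<phi> \<phi>) \<le> B"
proof (cases "ip \<phi> \<phi> = 0")
  case True
  have "0 \<in> cm_space \<mu>" using subspace_cm_space subspace_0 by blast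
  moreover have "cm_norm \<mu> 0 \<le> 1" using cm_norm_leI(2)[of 0 0] by (simp add: top_dual_simps)
  ultimately show ?thesis using B[of 0] True by simp
next
  case False
  then have pos: "0 < ip \<phi> \<phi>" using ip_nonneg[OF phi] by simp
  obtain h where h: "\<And>\<psi>. \<psi> \<in> top_dual \<Longrightarrow> \<psi> h = ip \<psi> \<phi>" using cov_element[OF phi] by blast
  note hc = cm_cov_element[OF phi h]
  define k where "k = (1 / sqrt (ip \<phi> \<phi>)) *\<^sub>R h"
  have "k \<in> cm_space \<mu>" "cm_norm \<mu> k \<le> 1"
    using cm_scaleR[OF hc(1), of "1 / sqrt (ip \<phi> \<phi>)"] hc(2) pos by (auto simp: k_def)
  then have "\<bar>\<phi> k\<bar> \<le> B" by (rule B)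
  moreover have "\<phi> k = sqrt (ip \<phi> \<phi>)"
    using pos by (simp add: k_def top_dual_simps[OF phi] h[OF phi] real_div_sqrt)
  ultimately show ?thesis by simp
qed

end

section \<open>Orthonormal expansions in the Cameron-Martin space\<close>

locale cm_basis = souslin_gaussian +
  fixes e :: "nat \<Rightarrow> 'a" and c :: "nat \<Rightarrow> 'a \<Rightarrow> real"
  assumes basis: "cm_orthonormal_basis \<mu> e" and cov: "\<And>i. cov_maps \<mu> (c i) (e i)"
begin

lemma c_dual: "c i \<in> top_dual" and dual_e: "\<psi> \<in> top_dual \<Longrightarrow> \<psi> (e i) = ip \<psi> (c i)"
  using cov[of i] by (auto simp: cov_maps_def ip_def mult.commute)

lemma e_cm: "e i \<in> cm_space \<mu>"
  using basis by (auto simp: cm_orthonormal_basis_def)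

text \<open>The vector \<open>e i + t *\<^sub>R e j\<close> is the covariance element of
  \<open>c i + t c j\<close>, so \<open>cm_cov_element\<close> gives its norm; polarization with
  \<open>t = 1\<close> and \<open>t = -1\<close> carries orthonormality over to the
  functionals.\<close>

lemma ip_c: "ip (c i) (c j) = (if i = j then 1 else 0)"
proof -
  have sq: "(cm_norm \<mu> (e i + t *\<^sub>R e j))\<^sup>2 = ip (c i) (c i) + 2 * t * ip (c i) (c j) + t\<^sup>2 * ip (c j) (c j)" for t
  proof -
    let ?\<phi> = "\<lambda>x. 1 * c i x + t * c j x"
    have d: "?\<phi> \<in> top_dual" by (intro top_dual_lin c_dual)
    have "cm_norm \<mu> (e i + t *\<^sub>R e j) = sqrt (ip ?\<phi> ?\<phi>)"
    proof (rule cm_cov_element(2)[OF d])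
      fix \<psi> :: "'a \<Rightarrow> real" assume psi: "\<psi> \<in> top_dual"
      show "\<psi> (e i + t *\<^sub>R e j) = ip \<psi> ?\<phi>"
        unfolding ip_lin_right[OF c_dual c_dual psi] by (simp add: top_dual_simps[OF psi] dual_e[OF psi])
    qed
    then show ?thesis using ip_nonneg[OF d] ip_lin_self[OF c_dual c_dual, of 1 i t j] by simp
  qed
  have "cm_inner \<mu> (e i) (e j) = ip (c i) (c j)"
    using sq[of 1] sq[of "-1"] by (simp add: cm_inner_def)
  then show ?thesis using basis by (simp add: cm_orthonormal_basis_def)
qed

text \<open>The functional whose covariance element is the truncated expansion
  \<open>proj n h\<close>, see \<open>ip_S\<close>; it approximates the inverse covariance of
  \<open>h\<close>.\<close>

definition S :: "nat \<Rightarrow> 'a \<Rightarrow> 'a \<Rightarrow> real" where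
  "S n h y = (\<Sum>i<n. c i h * c i y)"

definition proj :: "nat \<Rightarrow> 'a \<Rightarrow> 'a" where
  "proj n h = (\<Sum>i<n. c i h *\<^sub>R e i)"

lemma S_dual: "S n h \<in> top_dual"
  unfolding S_def by (intro top_dual_sum c_dual)

lemma ip_S: "\<psi> \<in> top_dual \<Longrightarrow> ip \<psi> (S n h) = \<psi> (proj n h)"
  unfolding S_def proj_def
  by (subst ip_commute, subst ip_sum_left) (auto simp: c_dual top_dual_simps dual_e ip_commute)

lemma ip_S_S: "ip (S m h) (S n k) = (\<Sum>i<min m n. c i h * c i k)"
proof -
  have inner: "ip (c i) (S n k) = (if i < n then c i k else 0)" for i
  proof -
    have "ip (c i) (S n k) = (\<Sum>j<n. c j k * (if i = j then 1 else 0))"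
      by (simp add: ip_S[OF c_dual] proj_def top_dual_simps[OF c_dual] dual_e[OF c_dual] ip_c)
    also have "\<dots> = (\<Sum>j<n. if i = j then c j k else 0)" by (intro sum.cong) auto
    finally show ?thesis by simp
  qed
  have "ip (S m h) (S n k) = (\<Sum>i<m. c i h * ip (c i) (S n k))"
    unfolding S_def[of m h] by (intro ip_sum_left c_dual S_dual)
  also have "\<dots> = (\<Sum>i<min m n. c i h * c i k)"
    unfolding inner by (intro sum.mono_neutral_cong_right) auto
  finally show ?thesis .
qed

lemma proj_cm: "proj n h \<in> cm_space \<mu>"
  and cm_norm_proj: "cm_norm \<mu> (proj n h) = sqrt (\<Sum>i<n. (c i h)\<^sup>2)"
  using cm_cov_element[OF S_dual, of "proj n h" n h] ip_S by (auto simp: ip_S_S power2_eq_square)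

text \<open>Testing \<open>h\<close> against the functional \<open>S n h\<close>, whose value there
  and whose variance are both the sum of squares.\<close>

lemma bessel:
  assumes h: "h \<in> cm_space \<mu>"
  shows "sqrt (\<Sum>i<n. (c i h)\<^sup>2) \<le> cm_norm \<mu> h"
proof -
  let ?s = "\<Sum>i<n. (c i h)\<^sup>2"
  have "\<bar>S n h h\<bar> \<le> sqrt ?s * cm_norm \<mu> h"
    using cm_bound[OF h S_dual, of n h] by (simp add: ip_S_S power2_eq_square)
  moreover have "S n h h = ?s" by (simp add: S_def power2_eq_square)
  ultimately show ?thesis
    by (intro sqrt_le_cancel cm_norm_nonneg[OF h] sum_nonneg) auto
qed

text \<open>An element of the span is fixed by \<open>proj n\<close> for all large \<open>n\<close>,
  and by Bessel's inequality \<open>proj n\<close> does not enlarge the distance to it.\<close>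

lemma proj_tendsto:
  assumes h: "h \<in> cm_space \<mu>"
  shows "(\<lambda>n. cm_norm \<mu> (h - proj n h)) \<longlonglongrightarrow> 0"
proof (rule LIMSEQ_I)
  fix r :: real assume r: "0 < r"
  obtain s where s: "s \<in> span (range e)" "cm_norm \<mu> (h - s) < r / 2"
    using basis h half_gt_zero[OF r] unfolding cm_orthonormal_basis_def by blast
  have "\<exists>N. \<forall>n\<ge>N. proj n s = s"
    using s(1)
  proof (induction rule: span_induct_alt)
    case base
    then show ?case by (simp add: proj_def top_dual_simps[OF c_dual])
  next
    case (step t x y)
    then obtain i N where x: "x = e i" and N: "\<And>n. n \<ge> N \<Longrightarrow> proj n y = y" by blast
    have "proj n (t *\<^sub>R x + y) = t *\<^sub>R x + y" if n: "n \<ge> max N (Suc i)" for n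
    proof -
      have "proj n (t *\<^sub>R x + y) = t *\<^sub>R proj n x + proj n y"
        by (simp add: proj_def top_dual_simps[OF c_dual] algebra_simps sum.distrib scaleR_sum_right)
      also have "proj n x = (\<Sum>j<n. if j = i then e i else 0)"
        unfolding proj_def x by (intro sum.cong) (auto simp: dual_e[OF c_dual] ip_c)
      also have "\<dots> = x" using n by (simp add: x)
      finally show ?thesis using N n by simp
    qed
    then show ?case by blast
  qed
  then obtain N where N: "\<And>n. n \<ge> N \<Longrightarrow> proj n s = s" by blast
  have scm: "s \<in> cm_space \<mu>"
    using s(1) span_minimal[OF _ subspace_cm_space, of "range e"] e_cm by blast
  have "cm_norm \<mu> (h - proj n h) < r" if n: "n \<ge> N" for n
  proof -
    have "proj n (h - s) = proj n h - proj n s"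
      by (simp add: proj_def top_dual_simps[OF c_dual] algebra_simps sum_subtractf)
    then have eq: "h - proj n h = (h - s) - proj n (h - s)" using N[OF n] by simp
    have hs: "h - s \<in> cm_space \<mu>" by (intro cm_diff h scm)
    have "cm_norm \<mu> (h - proj n h) \<le> cm_norm \<mu> (h - s) + cm_norm \<mu> (proj n (h - s))"
      unfolding eq by (intro cm_diff hs proj_cm)
    also have "cm_norm \<mu> (proj n (h - s)) \<le> cm_norm \<mu> (h - s)"
      unfolding cm_norm_proj by (rule bessel[OF hs])
    finally show ?thesis using s(2) by simp
  qed
  then show "\<exists>N. \<forall>n\<ge>N. norm (cm_norm \<mu> (h - proj n h) - 0) < r"
    using cm_norm_nonneg[OF cm_diff(1)[OF h proj_cm]] by (intro exI[of _ N]) auto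
qed

text \<open>Parseval's identity. It gives the series for the inner product by polarization, and it
  later shows that the norm of \<open>L x\<close> is measurable in \<open>x\<close>, the norm being
  expressed by countably many functionals.\<close>

lemma cm_norm_sums:
  assumes h: "h \<in> cm_space \<mu>"
  shows "(\<lambda>i. (c i h)\<^sup>2) sums (cm_norm \<mu> h)\<^sup>2"
proof -
  have "(\<lambda>n. cm_norm \<mu> h - cm_norm \<mu> (proj n h)) \<longlonglongrightarrow> 0"
  proof (rule Lim_null_comparison[OF always_eventually proj_tendsto[OF h]], intro allI)
    fix n
    have "cm_norm \<mu> h \<le> cm_norm \<mu> (h - proj n h) + cm_norm \<mu> (proj n h)"
      using cm_add(2)[OF cm_diff(1)[OF h proj_cm] proj_cm, of n h n h] by simp
    moreover have "cm_norm \<mu> (proj n h) \<le> cm_norm \<mu> h" unfolding cm_norm_proj by (rule bessel[OF h])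
    ultimately show "norm (cm_norm \<mu> h - cm_norm \<mu> (proj n h)) \<le> cm_norm \<mu> (h - proj n h)" by simp
  qed
  from tendsto_diff[OF tendsto_const[of "cm_norm \<mu> h"] this]
  have "(\<lambda>n. (cm_norm \<mu> (proj n h))\<^sup>2) \<longlonglongrightarrow> (cm_norm \<mu> h)\<^sup>2" by (intro tendsto_power) simp
  then show ?thesis by (simp add: sums_def cm_norm_proj sum_nonneg)
qed

lemma dual_proj_tendsto:
  assumes h: "h \<in> cm_space \<mu>" and psi: "\<psi> \<in> top_dual"
  shows "(\<lambda>n. \<psi> (proj n h)) \<longlonglongrightarrow> \<psi> h"
proof -
  have "(\<lambda>n. \<psi> h - \<psi> (proj n h)) \<longlonglongrightarrow> 0"
  proof (rule Lim_null_comparison[OF always_eventually], intro allI)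
    show "norm (\<psi> h - \<psi> (proj n h)) \<le> sqrt (ip \<psi> \<psi>) * cm_norm \<mu> (h - proj n h)" for n
      using cm_bound[OF cm_diff(1)[OF h proj_cm] psi, of n h] by (simp add: top_dual_simps[OF psi])
    show "(\<lambda>n. sqrt (ip \<psi> \<psi>) * cm_norm \<mu> (h - proj n h)) \<longlonglongrightarrow> 0"
      using tendsto_mult_right_zero[OF proj_tendsto[OF h]] by simp
  qed
  from tendsto_diff[OF tendsto_const[of "\<psi> h"] this] show ?thesis by simp
qed

lemma cm_inner_sums:
  assumes h: "h \<in> cm_space \<mu>" and k: "k \<in> cm_space \<mu>"
  shows "(\<lambda>i. c i h * c i k) sums cm_inner \<mu> h k"
proof -
  have "(\<lambda>i. ((c i (h + k))\<^sup>2 - (c i (h - k))\<^sup>2) / 4) sums cm_inner \<mu> h k"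
    unfolding cm_inner_def
    by (intro sums_divide sums_diff cm_norm_sums cm_add cm_diff h k)
  then show ?thesis
    by (simp add: top_dual_simps[OF c_dual] power2_eq_square algebra_simps)
qed

definition tail :: "nat \<Rightarrow> 'a \<Rightarrow> real" where
  "tail n h = (cm_norm \<mu> h)\<^sup>2 - (\<Sum>i<n. (c i h)\<^sup>2)"

lemma tail_tendsto: "h \<in> cm_space \<mu> \<Longrightarrow> (\<lambda>n. tail n h) \<longlonglongrightarrow> 0"
  using tendsto_diff[OF tendsto_const cm_norm_sums[unfolded sums_def], of h "(cm_norm \<mu> h)\<^sup>2"]
  by (simp add: tail_def)

lemma partial_le_tail:
  assumes h: "h \<in> cm_space \<mu>" and mn: "n \<le> m"
  shows "(\<Sum>i=n..<m. (c i h)\<^sup>2) \<le> tail n h"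
proof -
  have "(\<Sum>i<n. (c i h)\<^sup>2) + (\<Sum>i=n..<m. (c i h)\<^sup>2) = (\<Sum>i<m. (c i h)\<^sup>2)"
    using sum.atLeastLessThan_concat[of 0 n m "\<lambda>i. (c i h)\<^sup>2"] mn by (simp add: atLeast0LessThan)
  also have "\<dots> \<le> (cm_norm \<mu> h)\<^sup>2"
    using sum_le_suminf[of "\<lambda>i. (c i h)\<^sup>2" "{..<m}"] cm_norm_sums[OF h] by (auto simp: sums_iff)
  finally show ?thesis by (simp add: tail_def)
qed

lemma tail_nonneg: "h \<in> cm_space \<mu> \<Longrightarrow> 0 \<le> tail n h"
  using partial_le_tail[of h n n] by simp

lemma ip_S_diff:
  assumes "n \<le> m"
  shows "ip (\<lambda>y. S m h y - S n h y) (\<lambda>y. S m h y - S n h y) = (\<Sum>i=n..<m. (c i h)\<^sup>2)"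
proof -
  have "ip (\<lambda>y. 1 * S m h y + (-1) * S n h y) (\<lambda>y. 1 * S m h y + (-1) * S n h y)
      = (\<Sum>i<m. c i h * c i h) - 2 * (\<Sum>i<n. c i h * c i h) + (\<Sum>i<n. c i h * c i h)"
    unfolding ip_lin_self[OF S_dual S_dual] using assms by (simp add: ip_S_S min_def)
  also have "\<dots> = (\<Sum>i=n..<m. (c i h)\<^sup>2)"
    using sum.atLeastLessThan_concat[of 0 n m "\<lambda>i. c i h * c i h"] assms
    by (simp add: atLeast0LessThan power2_eq_square)
  finally show ?thesis by simp
qed

lemma S_diff_dual: "(\<lambda>y. S m h y - S n h y) \<in> top_dual"
  using top_dual_lin[OF S_dual S_dual, of 1 m h "-1" n h] by simp

lemma S_inner_bound:
  assumes h: "h \<in> cm_space \<mu>" and k: "k \<in> cm_space \<mu>"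
  shows "\<bar>S n h k - cm_inner \<mu> h k\<bar> \<le> sqrt (tail n h) * cm_norm \<mu> k"
proof -
  have lim: "(\<lambda>m. \<bar>S n h k - S m h k\<bar>) \<longlonglongrightarrow> \<bar>S n h k - cm_inner \<mu> h k\<bar>"
    using cm_inner_sums[OF h k] unfolding sums_def S_def by (intro tendsto_intros)
  have "\<bar>S n h k - S m h k\<bar> \<le> sqrt (tail n h) * cm_norm \<mu> k" if mn: "m \<ge> n" for m
  proof -
    have "\<bar>S m h k - S n h k\<bar> \<le> sqrt (\<Sum>i=n..<m. (c i h)\<^sup>2) * cm_norm \<mu> k"
      using cm_bound[OF k S_diff_dual, of m h n] ip_S_diff[OF mn] by simp
    also have "\<dots> \<le> sqrt (tail n h) * cm_norm \<mu> k"
      using partial_le_tail[OF h mn] cm_norm_nonneg[OF k] by (intro mult_right_mono) auto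
    finally show ?thesis by (simp add: abs_minus_commute)
  qed
  then show ?thesis
    by (intro tendsto_upperbound[OF lim] eventually_sequentiallyI[of n]) auto
qed

lemma cm_inner_bound:
  assumes h: "h \<in> cm_space \<mu>" and k: "k \<in> cm_space \<mu>"
  shows "\<bar>cm_inner \<mu> h k\<bar> \<le> cm_norm \<mu> h * cm_norm \<mu> k"
  using S_inner_bound[OF h k, of 0] cm_norm_nonneg[OF h] by (simp add: S_def tail_def)

lemma S_tendsto_cov_inv:
  assumes h: "h \<in> cm_space \<mu>"
  shows "tendsto_cov_inv \<mu> (\<lambda>n. S n h) h"
  unfolding tendsto_cov_inv_def
proof (rule Lim_null_comparison[OF always_eventually], intro allI)
  have zero: "0 \<in> cm_space \<mu>" "cm_norm \<mu> 0 \<le> 1"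
    using subspace_cm_space subspace_0 cm_norm_leI(2)[of 0 0] by (auto simp: top_dual_simps)
  fix n
  let ?U = "{k \<in> cm_space \<mu>. cm_norm \<mu> k \<le> 1}"
  have le: "\<bar>S n h k - cm_inner \<mu> h k\<bar> \<le> sqrt (tail n h)" if "k \<in> ?U" for k
    using that S_inner_bound[OF h, of k n] tail_nonneg[OF h, of n] mult_left_mono[of "cm_norm \<mu> k" 1 "sqrt (tail n h)"]
    by auto
  have "(SUP k\<in>?U. \<bar>S n h k - cm_inner \<mu> h k\<bar>) \<le> sqrt (tail n h)"
    using zero le by (intro cSUP_least) auto
  moreover have "\<bar>S n h 0 - cm_inner \<mu> h 0\<bar> \<le> (SUP k\<in>?U. \<bar>S n h k - cm_inner \<mu> h k\<bar>)"
    using zero le by (intro cSUP_upper bdd_aboveI2[of _ _ "sqrt (tail n h)"]) auto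
  ultimately show "norm (SUP k\<in>?U. \<bar>S n h k - cm_inner \<mu> h k\<bar>) \<le> sqrt (tail n h)" by simp
next
  show "(\<lambda>n. sqrt (tail n h)) \<longlonglongrightarrow> 0" using tendsto_real_sqrt[OF tail_tendsto[OF h]] by simp
qed

text \<open>Every sequence that approximates the inverse covariance of \<open>h\<close> is
  asymptotically equal in L2 to the particular sequence \<open>S n h\<close>, on which variances can
  be computed.\<close>

lemma tendsto_cov_inv_S:
  assumes h: "h \<in> cm_space \<mu>" and phi: "\<And>n. \<phi> n \<in> top_dual" and lim: "tendsto_cov_inv \<mu> \<phi> h"
  shows "(\<lambda>n. sqrt (ip (\<lambda>y. \<phi> n y - S n h y) (\<lambda>y. \<phi> n y - S n h y))) \<longlonglongrightarrow> 0"
proof (rule Lim_null_comparison[OF always_eventually], intro allI)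
  let ?U = "{k \<in> cm_space \<mu>. cm_norm \<mu> k \<le> 1}"
  let ?s = "\<lambda>n. SUP k\<in>?U. \<bar>\<phi> n k - cm_inner \<mu> h k\<bar>"
  fix n
  have d: "(\<lambda>y. \<phi> n y - S n h y) \<in> top_dual" using top_dual_lin[OF phi S_dual, of 1 n "-1" n h] by simp
  \<comment> \<open>A real supremum carries information only over a bounded set; here both terms are
    bounded on the unit ball.\<close>
  have bdd: "bdd_above ((\<lambda>k. \<bar>\<phi> n k - cm_inner \<mu> h k\<bar>) ` ?U)"
  proof (rule bdd_aboveI2)
    fix k assume k: "k \<in> ?U"
    have "\<bar>\<phi> n k\<bar> \<le> sqrt (ip (\<phi> n) (\<phi> n)) * 1"
      using cm_bound[of k, OF _ phi[of n]] k ip_nonneg[OF phi, of n]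
        mult_left_mono[of "cm_norm \<mu> k" 1 "sqrt (ip (\<phi> n) (\<phi> n))"] by auto
    moreover have "\<bar>cm_inner \<mu> h k\<bar> \<le> cm_norm \<mu> h * 1"
      using cm_inner_bound[OF h, of k] k cm_norm_nonneg[OF h]
        mult_left_mono[of "cm_norm \<mu> k" 1 "cm_norm \<mu> h"] by auto
    ultimately show "\<bar>\<phi> n k - cm_inner \<mu> h k\<bar> \<le> sqrt (ip (\<phi> n) (\<phi> n)) + cm_norm \<mu> h" by linarith
  qed
  have "sqrt (ip (\<lambda>y. \<phi> n y - S n h y) (\<lambda>y. \<phi> n y - S n h y)) \<le> ?s n + sqrt (tail n h)"
  proof (rule dual_norm_le[OF d])
    fix k assume k: "k \<in> cm_space \<mu>" "cm_norm \<mu> k \<le> 1"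
    have "\<bar>\<phi> n k - cm_inner \<mu> h k\<bar> \<le> ?s n" using k by (intro cSUP_upper[OF _ bdd]) auto
    moreover have "\<bar>S n h k - cm_inner \<mu> h k\<bar> \<le> sqrt (tail n h)"
      using k S_inner_bound[OF h k(1), of n] tail_nonneg[OF h, of n] mult_left_mono[of "cm_norm \<mu> k" 1 "sqrt (tail n h)"] by auto
    ultimately show "\<bar>\<phi> n k - S n h k\<bar> \<le> ?s n + sqrt (tail n h)" by linarith
  qed
  then show "norm (sqrt (ip (\<lambda>y. \<phi> n y - S n h y) (\<lambda>y. \<phi> n y - S n h y))) \<le> ?s n + sqrt (tail n h)"
    using ip_nonneg[OF d] by simp
next
  show "(\<lambda>n. (SUP k\<in>{k \<in> cm_space \<mu>. cm_norm \<mu> k \<le> 1}. \<bar>\<phi> n k - cm_inner \<mu> h k\<bar>) + sqrt (tail n h)) \<longlonglongrightarrow> 0"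
    using tendsto_add[OF lim[unfolded tendsto_cov_inv_def] tendsto_real_sqrt[OF tail_tendsto[OF h]]] by simp
qed

text \<open>These limits are the covariances and the variance that the characteristic function in
  \<open>cameron_martin\<close> has to display.\<close>

lemma tendsto_cov_inv_ip:
  assumes h: "h \<in> cm_space \<mu>" and phi: "\<And>n. \<phi> n \<in> top_dual" and lim: "tendsto_cov_inv \<mu> \<phi> h"
  shows "\<psi> \<in> top_dual \<Longrightarrow> (\<lambda>n. ip \<psi> (\<phi> n)) \<longlonglongrightarrow> \<psi> h"
    and "(\<lambda>n. ip (\<phi> n) (\<phi> n)) \<longlonglongrightarrow> (cm_norm \<mu> h)\<^sup>2"
proof -
  define \<delta> where "\<delta> n y = \<phi> n y - S n h y" for n y
  have d: "\<delta> n \<in> top_dual" for n unfolding \<delta>_def using top_dual_lin[OF phi S_dual, of 1 n "-1" n h] by simp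
  have phi_eq: "\<phi> n = (\<lambda>y. 1 * S n h y + 1 * \<delta> n y)" for n by (simp add: \<delta>_def)
  have d0: "(\<lambda>n. sqrt (ip (\<delta> n) (\<delta> n))) \<longlonglongrightarrow> 0"
    using tendsto_cov_inv_S[OF h phi lim] by (simp add: \<delta>_def[abs_def])
  show "(\<lambda>n. ip \<psi> (\<phi> n)) \<longlonglongrightarrow> \<psi> h" if psi: "\<psi> \<in> top_dual"
  proof -
    have "(\<lambda>n. ip \<psi> (\<delta> n)) \<longlonglongrightarrow> 0"
    proof (rule Lim_null_comparison[OF always_eventually], intro allI)
      show "norm (ip \<psi> (\<delta> n)) \<le> sqrt (ip \<psi> \<psi>) * sqrt (ip (\<delta> n) (\<delta> n))" for n
        using ip_Cauchy_Schwarz[OF psi d] by simp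
      show "(\<lambda>n. sqrt (ip \<psi> \<psi>) * sqrt (ip (\<delta> n) (\<delta> n))) \<longlonglongrightarrow> 0"
        by (rule tendsto_mult_right_zero[OF d0])
    qed
    moreover have "ip \<psi> (\<phi> n) = \<psi> (proj n h) + ip \<psi> (\<delta> n)" for n
      using ip_lin_right[OF S_dual[of n h] d[of n] psi, of 1 1] ip_S[OF psi] phi_eq[of n] by simp
    ultimately show ?thesis using tendsto_add[OF dual_proj_tendsto[OF h psi]] by force
  qed
  show "(\<lambda>n. ip (\<phi> n) (\<phi> n)) \<longlonglongrightarrow> (cm_norm \<mu> h)\<^sup>2"
  proof -
    have S2: "ip (S n h) (S n h) = (\<Sum>i<n. (c i h)\<^sup>2)" for n by (simp add: ip_S_S power2_eq_square)
    have "(\<lambda>n. ip (S n h) (\<delta> n)) \<longlonglongrightarrow> 0"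
    proof (rule Lim_null_comparison[OF always_eventually], intro allI)
      show "norm (ip (S n h) (\<delta> n)) \<le> cm_norm \<mu> h * sqrt (ip (\<delta> n) (\<delta> n))" for n
        using ip_Cauchy_Schwarz[OF S_dual d, of n h n] bessel[OF h, of n] mult_right_mono[of "sqrt (ip (S n h) (S n h))" "cm_norm \<mu> h" "sqrt (ip (\<delta> n) (\<delta> n))"] ip_nonneg[OF d, of n]
        by (simp add: S2)
      show "(\<lambda>n. cm_norm \<mu> h * sqrt (ip (\<delta> n) (\<delta> n))) \<longlonglongrightarrow> 0"
        by (rule tendsto_mult_right_zero[OF d0])
    qed
    moreover have "(\<lambda>n. ip (\<delta> n) (\<delta> n)) \<longlonglongrightarrow> 0"
      using tendsto_power[OF d0, of 2] ip_nonneg[OF d] by simp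
    moreover have "(\<lambda>n. ip (S n h) (S n h)) \<longlonglongrightarrow> (cm_norm \<mu> h)\<^sup>2"
      using cm_norm_sums[OF h] by (simp add: S2 sums_def)
    ultimately have "(\<lambda>n. ip (S n h) (S n h) + 2 * ip (S n h) (\<delta> n) + ip (\<delta> n) (\<delta> n)) \<longlonglongrightarrow> (cm_norm \<mu> h)\<^sup>2 + 2 * 0 + 0"
      by (intro tendsto_intros)
    moreover have "ip (\<phi> n) (\<phi> n) = ip (S n h) (S n h) + 2 * ip (S n h) (\<delta> n) + ip (\<delta> n) (\<delta> n)" for n
      using ip_lin_self[OF S_dual[of n h] d[of n], of 1 1] phi_eq[of n] by simp
    ultimately show ?thesis by simp
  qed
qed

end

section \<open>Recovery of the noise level\<close>

lemma AE_summable_of_nn_integral: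
  fixes f :: "nat \<Rightarrow> 'a \<Rightarrow> real"
  assumes f[measurable]: "\<And>n. f n \<in> borel_measurable M" and nn: "\<And>n z. 0 \<le> f n z"
    and b: "summable b" "\<And>n. 0 \<le> b n" "\<And>n. (\<integral>\<^sup>+z. ennreal (f n z) \<partial>M) \<le> ennreal (b n)"
  shows "AE z in M. summable (\<lambda>n. f n z)"
proof -
  have "(\<integral>\<^sup>+z. (\<Sum>n. ennreal (f n z)) \<partial>M) = (\<Sum>n. \<integral>\<^sup>+z. ennreal (f n z) \<partial>M)"
    by (intro nn_integral_suminf) auto
  also have "\<dots> \<le> (\<Sum>n. ennreal (b n))" by (intro suminf_le b summableI)
  also have "\<dots> < \<infinity>" using suminf_ennreal2[OF b(2) b(1)] by simp
  finally have "(\<integral>\<^sup>+z. (\<Sum>n. ennreal (f n z)) \<partial>M) \<noteq> \<infinity>" by simp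
  then have "AE z in M. (\<Sum>n. ennreal (f n z)) \<noteq> \<infinity>"
    by (intro nn_integral_PInf_AE) auto
  then show ?thesis by eventually_elim (auto intro: summable_suminf_not_top nn)
qed

lemma filterlim_floor_sqrt: "filterlim floor_sqrt at_top sequentially"
  unfolding filterlim_at_top
  by (intro allI) (auto intro: eventually_sequentiallyI[of "Z\<^sup>2" for Z] le_floor_sqrtI)

text \<open>For \<open>k\<close> the integer square root of \<open>n\<close>, monotonicity encloses
  \<open>a n / n\<close> between the averages at \<open>k\<^sup>2\<close> and
  \<open>(k + 1)\<^sup>2\<close>, up to factors formed from \<open>k / (k + 1)\<close> that tend to
  1.\<close>

lemma averages_along_squares:
  fixes a :: "nat \<Rightarrow> real"
  assumes mono: "mono a" and nn: "\<And>n. 0 \<le> a n" and lim: "(\<lambda>k. a (k\<^sup>2) / real (k\<^sup>2)) \<longlonglongrightarrow> 1"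
  shows "(\<lambda>n. a n / real n) \<longlonglongrightarrow> 1"
proof (rule tendsto_sandwich)
  let ?k = floor_sqrt
  have "(\<lambda>k. (a (k\<^sup>2) / real (k\<^sup>2)) * (real k / real (Suc k))\<^sup>2) \<longlonglongrightarrow> 1 * 1\<^sup>2"
    by (intro tendsto_intros lim LIMSEQ_n_over_Suc_n)
  then have low: "(\<lambda>k. (a (k\<^sup>2) / real (k\<^sup>2)) * (real k / real (Suc k))\<^sup>2) \<longlonglongrightarrow> 1" by simp
  have "(\<lambda>k. (a ((Suc k)\<^sup>2) / real ((Suc k)\<^sup>2)) * (real (Suc k) / real k)\<^sup>2) \<longlonglongrightarrow> 1 * 1\<^sup>2"
    by (intro tendsto_intros LIMSEQ_Suc[OF lim] LIMSEQ_Suc_n_over_n)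
  then have up: "(\<lambda>k. (a ((Suc k)\<^sup>2) / real ((Suc k)\<^sup>2)) * (real (Suc k) / real k)\<^sup>2) \<longlonglongrightarrow> 1" by simp
  show "(\<lambda>n. (a ((?k n)\<^sup>2) / real ((?k n)\<^sup>2)) * (real (?k n) / real (Suc (?k n)))\<^sup>2) \<longlonglongrightarrow> 1"
    by (rule filterlim_compose[OF low filterlim_floor_sqrt])
  show "(\<lambda>n. (a ((Suc (?k n))\<^sup>2) / real ((Suc (?k n))\<^sup>2)) * (real (Suc (?k n)) / real (?k n))\<^sup>2) \<longlonglongrightarrow> 1"
    by (rule filterlim_compose[OF up filterlim_floor_sqrt])
  have ev: "\<forall>\<^sub>F n in sequentially. 0 < n" by (rule eventually_gt_at_top)
  show "\<forall>\<^sub>F n in sequentially. (a ((?k n)\<^sup>2) / real ((?k n)\<^sup>2)) * (real (?k n) / real (Suc (?k n)))\<^sup>2 \<le> a n / real n"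
    using ev
  proof eventually_elim
    case (elim n)
    have k: "0 < ?k n" using elim by simp
    have "(a ((?k n)\<^sup>2) / real ((?k n)\<^sup>2)) * (real (?k n) / real (Suc (?k n)))\<^sup>2 = a ((?k n)\<^sup>2) / (real (Suc (?k n)))\<^sup>2"
      using k by (simp add: power_divide)
    also have "\<dots> \<le> a n / real n"
    proof (rule frac_le)
      show "a ((?k n)\<^sup>2) \<le> a n" by (intro monoD[OF mono]) simp
      have "n \<le> (Suc (?k n))\<^sup>2" using Suc_floor_sqrt_power2_gt[of n] by simp
      then show "real n \<le> (real (Suc (?k n)))\<^sup>2" by (metis of_nat_le_iff of_nat_power)
    qed (use elim nn in auto)
    finally show ?case .
  qed
  show "\<forall>\<^sub>F n in sequentially. a n / real n \<le> (a ((Suc (?k n))\<^sup>2) / real ((Suc (?k n))\<^sup>2)) * (real (Suc (?k n)) / real (?k n))\<^sup>2"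
    using ev
  proof eventually_elim
    case (elim n)
    have k: "0 < ?k n" using elim by simp
    have "a n / real n \<le> a ((Suc (?k n))\<^sup>2) / (real (?k n))\<^sup>2"
    proof (rule frac_le)
      show "a n \<le> a ((Suc (?k n))\<^sup>2)" using Suc_floor_sqrt_power2_gt[of n] by (intro monoD[OF mono]) simp
      have "(?k n)\<^sup>2 \<le> n" by simp
      then show "(real (?k n))\<^sup>2 \<le> real n" by (metis of_nat_le_iff of_nat_power)
    qed (use k nn in auto)
    also have "\<dots> = (a ((Suc (?k n))\<^sup>2) / real ((Suc (?k n))\<^sup>2)) * (real (Suc (?k n)) / real (?k n))\<^sup>2"
      by (simp add: power_divide del: of_nat_Suc)
    finally show ?case .
  qed
qed

section \<open>Fourth moments and L2 limits of characteristic functions\<close>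

context souslin_gaussian
begin

text \<open>A case of the Isserlis formula, obtained without a joint law: the fourth powers of
  \<open>\<phi> + \<psi>\<close> and \<open>\<phi> - \<psi>\<close> add up to
  \<open>2 \<phi>^4 + 12 \<phi>^2 \<psi>^2 + 2 \<psi>^4\<close>, and each fourth moment is three
  times a squared variance.\<close>

lemma dual_mixed_moment:
  assumes phi: "\<phi> \<in> top_dual" and psi: "\<psi> \<in> top_dual"
  shows "integrable \<mu> (\<lambda>z. (\<phi> z)\<^sup>2 * (\<psi> z)\<^sup>2)"
    and "(\<integral>z. (\<phi> z)\<^sup>2 * (\<psi> z)\<^sup>2 \<partial>\<mu>) = ip \<phi> \<phi> * ip \<psi> \<psi> + 2 * (ip \<phi> \<psi>)\<^sup>2"
proof -
  let ?p = "\<lambda>z. 1 * \<phi> z + 1 * \<psi> z" and ?m = "\<lambda>z. 1 * \<phi> z + (-1) * \<psi> z"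
  have d: "?p \<in> top_dual" "?m \<in> top_dual" by (intro top_dual_lin phi psi)+
  have eq: "(\<phi> z)\<^sup>2 * (\<psi> z)\<^sup>2 = (?p z ^ 4 + ?m z ^ 4 - 2 * \<phi> z ^ 4 - 2 * \<psi> z ^ 4) / 12" for z
    by (simp add: power4_eq_xxxx power2_eq_square algebra_simps)
  note int = dual_integrable_power[OF d(1), of 4] dual_integrable_power[OF d(2), of 4]
    dual_integrable_power[OF phi, of 4] dual_integrable_power[OF psi, of 4]
  show "integrable \<mu> (\<lambda>z. (\<phi> z)\<^sup>2 * (\<psi> z)\<^sup>2)"
    unfolding eq using int by (intro integrable_divide Bochner_Integration.integrable_diff Bochner_Integration.integrable_add integrable_mult_right) auto
  have "(\<integral>z. (\<phi> z)\<^sup>2 * (\<psi> z)\<^sup>2 \<partial>\<mu>) =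
    ((\<integral>z. ?p z ^ 4 \<partial>\<mu>) + (\<integral>z. ?m z ^ 4 \<partial>\<mu>) - 2 * (\<integral>z. \<phi> z ^ 4 \<partial>\<mu>) - 2 * (\<integral>z. \<psi> z ^ 4 \<partial>\<mu>)) / 12"
    unfolding eq using int by simp
  also have "\<dots> = ip \<phi> \<phi> * ip \<psi> \<psi> + 2 * (ip \<phi> \<psi>)\<^sup>2"
    unfolding dual_fourth_moment[OF d(1)] dual_fourth_moment[OF d(2)] dual_fourth_moment[OF phi]
      dual_fourth_moment[OF psi] ip_lin_self[OF phi psi]
    by (simp add: power2_eq_square algebra_simps)
  finally show "(\<integral>z. (\<phi> z)\<^sup>2 * (\<psi> z)\<^sup>2 \<partial>\<mu>) = ip \<phi> \<phi> * ip \<psi> \<psi> + 2 * (ip \<phi> \<psi>)\<^sup>2" .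
qed

text \<open>\<open>cos\<close> and \<open>sin\<close> are bounded and Lipschitz, so \<open>L\<^sup>2\<close> convergence suffices; here
  \<open>\<bar>x\<bar> \<le> r / 2 + x\<^sup>2 / (2 r)\<close>.\<close>

lemma lipschitz_integral_tendsto:
  fixes F :: "real \<Rightarrow> real"
  assumes F: "F \<in> borel_measurable borel" "\<And>x y. \<bar>F x - F y\<bar> \<le> \<bar>x - y\<bar>" "\<And>x. \<bar>F x\<bar> \<le> 1"
    and u: "\<And>n. u n \<in> borel_measurable \<mu>" "v \<in> borel_measurable \<mu>" "w \<in> borel_measurable \<mu>"
    and lim: "(\<lambda>n. \<integral>\<^sup>+z. ennreal ((u n z - v z)\<^sup>2) \<partial>\<mu>) \<longlonglongrightarrow> 0"
  shows "(\<lambda>n. \<integral>z. F (w z + b * u n z) \<partial>\<mu>) \<longlonglongrightarrow> (\<integral>z. F (w z + b * v z) \<partial>\<mu>)"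
proof (rule LIMSEQ_I)
  fix r :: real assume r: "0 < r"
  note [measurable] = F(1) u
  \<comment> \<open>Chosen so that \<open>b\<^sup>2 / (2 * r) * \<delta>\<close> is at most
    \<open>r / 2\<close>; the summand 1 keeps the denominator positive when
    \<open>b = 0\<close>.\<close>
  define \<delta> where "\<delta> = r\<^sup>2 / (b\<^sup>2 + 1)"
  have b1: "0 < b\<^sup>2 + 1" using zero_le_power2[of b] by linarith
  have \<delta>: "0 < \<delta>" using r b1 by (simp add: \<delta>_def)
  have "\<forall>\<^sub>F n in sequentially. (\<integral>\<^sup>+z. ennreal ((u n z - v z)\<^sup>2) \<partial>\<mu>) < ennreal \<delta>"
    using lim \<delta> by (intro order_tendstoD) auto
  then obtain N where N: "\<And>n. n \<ge> N \<Longrightarrow> (\<integral>\<^sup>+z. ennreal ((u n z - v z)\<^sup>2) \<partial>\<mu>) < ennreal \<delta>"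
    by (auto simp: eventually_sequentially)
  have int: "integrable \<mu> (\<lambda>z. F (w z + b * f z))" if "f \<in> borel_measurable \<mu>" for f
    using F(3) that by (intro integrable_const_bound[where B=1]) auto
  have "\<bar>(\<integral>z. F (w z + b * u n z) \<partial>\<mu>) - (\<integral>z. F (w z + b * v z) \<partial>\<mu>)\<bar> < r" if n: "n \<ge> N" for n
  proof -
    have sq: "integrable \<mu> (\<lambda>z. (u n z - v z)\<^sup>2)"
      using less_trans[OF N[OF n] ennreal_less_top] by (intro integrableI_nonneg) auto
    have sqv: "(\<integral>z. (u n z - v z)\<^sup>2 \<partial>\<mu>) < \<delta>"
      using N[OF n] nn_integral_eq_integral[OF sq] \<delta> by (simp add: ennreal_less_iff)
    have "\<bar>(\<integral>z. F (w z + b * u n z) \<partial>\<mu>) - (\<integral>z. F (w z + b * v z) \<partial>\<mu>)\<bar> =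
        \<bar>\<integral>z. F (w z + b * u n z) - F (w z + b * v z) \<partial>\<mu>\<bar>"
      using int[OF u(1)] int[OF u(2)] by simp
    also have "\<dots> \<le> (\<integral>z. \<bar>F (w z + b * u n z) - F (w z + b * v z)\<bar> \<partial>\<mu>)"
      by (rule integral_abs_bound)
    also have "\<dots> \<le> (\<integral>z. r / 2 + b\<^sup>2 / (2 * r) * (u n z - v z)\<^sup>2 \<partial>\<mu>)"
    proof (rule integral_mono)
      fix z
      let ?x = "b * (u n z - v z)"
      have "0 \<le> (r - \<bar>?x\<bar>)\<^sup>2" by simp
      then have "2 * r * \<bar>?x\<bar> \<le> r\<^sup>2 + ?x\<^sup>2" by (simp add: power2_diff mult.commute)
      then have "\<bar>?x\<bar> \<le> (r\<^sup>2 + ?x\<^sup>2) / (2 * r)" using r by (simp add: field_simps)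
      also have "\<dots> = r / 2 + b\<^sup>2 / (2 * r) * (u n z - v z)\<^sup>2"
        using r by (simp add: add_divide_distrib power2_eq_square)
      finally show "\<bar>F (w z + b * u n z) - F (w z + b * v z)\<bar> \<le> r / 2 + b\<^sup>2 / (2 * r) * (u n z - v z)\<^sup>2"
        using F(2)[of "w z + b * u n z" "w z + b * v z"] by (simp add: right_diff_distrib)
    qed (use int[OF u(1)] int[OF u(2)] sq in auto)
    also have "\<dots> = r / 2 + b\<^sup>2 / (2 * r) * (\<integral>z. (u n z - v z)\<^sup>2 \<partial>\<mu>)"
      using sq by (simp add: prob_space[unfolded space_mu])
    also have "\<dots> < r"
    proof (cases "b = 0")
      case False
      then have "b\<^sup>2 / (2 * r) * (\<integral>z. (u n z - v z)\<^sup>2 \<partial>\<mu>) < b\<^sup>2 / (2 * r) * \<delta>"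
        using sqv r by (intro mult_strict_left_mono) auto
      also have "\<dots> = r / 2 * (b\<^sup>2 / (b\<^sup>2 + 1))"
        using r by (simp add: \<delta>_def power2_eq_square)
      also have "\<dots> \<le> r / 2 * 1" using r b1 by (intro mult_left_mono) auto
      finally show ?thesis by simp
    qed (use r in simp)
    finally show ?thesis .
  qed
  then show "\<exists>N. \<forall>n\<ge>N. norm ((\<integral>z. F (w z + b * u n z) \<partial>\<mu>) - (\<integral>z. F (w z + b * v z) \<partial>\<mu>)) < r"
    by (intro exI[of _ N]) auto
qed

lemma cos_lipschitz: "\<bar>cos x - cos y\<bar> \<le> \<bar>x - y\<bar>" for x y :: real
proof -
  have "\<bar>cos x - cos y\<bar> = 2 * \<bar>sin ((x + y) / 2)\<bar> * \<bar>sin ((y - x) / 2)\<bar>"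
    by (simp add: cos_diff_cos abs_mult)
  also have "\<dots> \<le> 2 * 1 * \<bar>(y - x) / 2\<bar>"
    by (intro mult_mono abs_sin_x_le_abs_x) auto
  finally show ?thesis by simp
qed

lemma sin_lipschitz: "\<bar>sin x - sin y\<bar> \<le> \<bar>x - y\<bar>" for x y :: real
  using cos_lipschitz[of "pi / 2 - x" "pi / 2 - y"] by (simp add: cos_diff sin_diff abs_minus_commute)

lemma scaled_measurable: "(\<lambda>z. a *\<^sub>R z) \<in> measurable \<mu> borel"
  using measurable_scaleR[of "\<lambda>_. a" \<mu> "\<lambda>z. z"] measurable_cong_sets[OF sets_mu refl] by fastforce

lemma nn_integral_scaled:
  "f \<in> borel_measurable borel \<Longrightarrow> (\<integral>\<^sup>+y. f y \<partial>distr \<mu> borel (\<lambda>z. a *\<^sub>R z)) = (\<integral>\<^sup>+z. f (a *\<^sub>R z) \<partial>\<mu>)"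
  using scaled_measurable by (intro nn_integral_distr) simp_all

end

section \<open>Shifts of the scaled noise and the law of large numbers\<close>

context cm_basis
begin

text \<open>Writing \<open>h + a z\<close> as \<open>a (z + h / a)\<close> reduces the claim to
  \<open>cameron_martin\<close> with shift \<open>h / a\<close>, variable
  \<open>Dh (a z) / a^2\<close> and variance \<open>cm_norm \<mu> h ^ 2 / a^2\<close>. That variable
  is the L2 limit of \<open>\<phi> n z / a\<close>, and the characteristic functions of these
  Gaussian functionals converge.\<close>

theorem version_shift:
  assumes h: "h \<in> cm_space \<mu>" and D: "Dh \<in> borel_measurable borel" and phi: "\<And>n. \<phi> n \<in> top_dual"
    and cov_lim: "tendsto_cov_inv \<mu> \<phi> h" and a: "0 < a"
    and L2: "(\<lambda>n. \<integral>\<^sup>+y. ennreal ((\<phi> n y - Dh y)\<^sup>2) \<partial>distr \<mu> borel (\<lambda>z. a *\<^sub>R z)) \<longlonglongrightarrow> 0"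
    and g: "g \<in> borel_measurable borel"
  shows "(\<integral>\<^sup>+z. g (h + a *\<^sub>R z) \<partial>\<mu>) =
    (\<integral>\<^sup>+z. g (a *\<^sub>R z) * ennreal (exp (Dh (a *\<^sub>R z) / a\<^sup>2 - (cm_norm \<mu> h)\<^sup>2 / (2 * a\<^sup>2))) \<partial>\<mu>)"
proof -
  define f where "f z = Dh (a *\<^sub>R z) / a\<^sup>2" for z
  note [measurable] = D top_dual_measurable[OF phi]
  have sc: "(\<lambda>z :: 'a. a *\<^sub>R z) \<in> measurable borel borel"
    using scaled_measurable[of a] unfolding measurable_cong_sets[OF sets_mu refl] .
  have f: "f \<in> borel_measurable borel"
    unfolding f_def using measurable_compose[OF sc D] by simp
  have ga: "(\<lambda>z. g (a *\<^sub>R z)) \<in> borel_measurable borel" by (rule measurable_compose[OF sc g])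
  have "(\<lambda>n. \<integral>\<^sup>+z. ennreal ((a * \<phi> n z - Dh (a *\<^sub>R z))\<^sup>2) \<partial>\<mu>) \<longlonglongrightarrow> 0"
    using L2 D phi by (subst (asm) nn_integral_scaled) (auto simp: top_dual_simps top_dual_measurable)
  then have L2': "(\<lambda>n. \<integral>\<^sup>+z. ennreal ((a * \<phi> n z - a\<^sup>2 * f z)\<^sup>2) \<partial>\<mu>) \<longlonglongrightarrow> 0"
    using a by (simp add: f_def)
  have lims: "(\<lambda>n. \<integral>z. F (\<psi> z + b / a\<^sup>2 * (a * \<phi> n z)) \<partial>\<mu>) \<longlonglongrightarrow> (\<integral>z. F (\<psi> z + b / a\<^sup>2 * (a\<^sup>2 * f z)) \<partial>\<mu>)"
    if "F \<in> borel_measurable borel" "\<And>x y. \<bar>F x - F y\<bar> \<le> \<bar>x - y\<bar>" "\<And>x. \<bar>F x\<bar> \<le> 1" "\<psi> \<in> top_dual"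
    for F :: "real \<Rightarrow> real" and \<psi> b
    using f measurable_cong_sets[OF sets_mu refl, of borel] that phi
    by (intro lipschitz_integral_tendsto L2') (auto intro!: borel_measurable_times dual_meas)
  have exponent: "\<psi> z + b / a\<^sup>2 * (a * \<phi> n z) = 1 * \<psi> z + (b / a) * \<phi> n z" for \<psi> b n z
    using a by (simp add: power2_eq_square)
  have "(\<integral>\<^sup>+z. g (a *\<^sub>R (z + (1 / a) *\<^sub>R h)) \<partial>\<mu>) = (\<integral>\<^sup>+z. g (a *\<^sub>R z) * ennreal (exp (f z - (cm_norm \<mu> h)\<^sup>2 / a\<^sup>2 / 2)) \<partial>\<mu>)"
  proof (rule cameron_martin[OF f _ _ _ ga])
    fix \<psi> :: "'a \<Rightarrow> real" and b assume psi: "\<psi> \<in> top_dual"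
    have d: "(\<lambda>z. 1 * \<psi> z + (b / a) * \<phi> n z) \<in> top_dual" for n by (intro top_dual_lin psi phi)
    have "(\<lambda>n. \<integral>z. cos (1 * \<psi> z + (b / a) * \<phi> n z) \<partial>\<mu>) \<longlonglongrightarrow> (\<integral>z. cos (\<psi> z + b / a\<^sup>2 * (a\<^sup>2 * f z)) \<partial>\<mu>)"
      using lims[of cos \<psi> b, OF _ cos_lipschitz abs_cos_le_one psi] unfolding exponent by simp
    moreover have "(\<lambda>n. exp (- (1\<^sup>2 * ip \<psi> \<psi> + 2 * 1 * (b / a) * ip \<psi> (\<phi> n) + (b / a)\<^sup>2 * ip (\<phi> n) (\<phi> n)) / 2))
        \<longlonglongrightarrow> exp (- (1\<^sup>2 * ip \<psi> \<psi> + 2 * 1 * (b / a) * \<psi> h + (b / a)\<^sup>2 * (cm_norm \<mu> h)\<^sup>2) / 2)"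
      by (intro tendsto_intros tendsto_cov_inv_ip[OF h phi cov_lim] psi) simp
    ultimately have "(\<integral>z. cos (\<psi> z + b / a\<^sup>2 * (a\<^sup>2 * f z)) \<partial>\<mu>) =
        exp (- (1\<^sup>2 * ip \<psi> \<psi> + 2 * 1 * (b / a) * \<psi> h + (b / a)\<^sup>2 * (cm_norm \<mu> h)\<^sup>2) / 2)"
      unfolding dual_cos[OF d] ip_lin_self[OF psi phi] by (rule LIMSEQ_unique)
    then show "(\<integral>z. cos (\<psi> z + b * f z) \<partial>\<mu>) =
        exp (- (ip \<psi> \<psi> + 2 * b * \<psi> ((1 / a) *\<^sub>R h) + b\<^sup>2 * ((cm_norm \<mu> h)\<^sup>2 / a\<^sup>2)) / 2)"
      using a by (simp add: top_dual_simps[OF psi] power_divide)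
    have "(\<lambda>n. \<integral>z. sin (1 * \<psi> z + (b / a) * \<phi> n z) \<partial>\<mu>) \<longlonglongrightarrow> (\<integral>z. sin (\<psi> z + b / a\<^sup>2 * (a\<^sup>2 * f z)) \<partial>\<mu>)"
      using lims[of sin \<psi> b, OF _ sin_lipschitz abs_sin_le_one psi] unfolding exponent by simp
    then have "(\<integral>z. sin (\<psi> z + b / a\<^sup>2 * (a\<^sup>2 * f z)) \<partial>\<mu>) = 0"
      unfolding dual_sin[OF d] by (simp add: LIMSEQ_const_iff)
    then show "(\<integral>z. sin (\<psi> z + b * f z) \<partial>\<mu>) = 0" using a by simp
  qed simp
  then show ?thesis using a by (simp add: f_def scaleR_right_distrib add.commute mult.commute)
qed

text \<open>By \<open>dual_mixed_moment\<close> the centred squares are pairwise uncorrelated, which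
  is all that the law of large numbers uses; the value 2 is the fourth moment 3 minus 1.\<close>

lemma cross_moments:
  "integrable \<mu> (\<lambda>z. ((c i z)\<^sup>2 - 1) * ((c j z)\<^sup>2 - 1))"
  "(\<integral>z. ((c i z)\<^sup>2 - 1) * ((c j z)\<^sup>2 - 1) \<partial>\<mu>) = (if i = j then 2 else 0)"
proof -
  have eq: "((c i z)\<^sup>2 - 1) * ((c j z)\<^sup>2 - 1) = (c i z)\<^sup>2 * (c j z)\<^sup>2 - (c i z)\<^sup>2 - (c j z)\<^sup>2 + 1" for z
    by (simp add: algebra_simps)
  note int = dual_mixed_moment(1)[OF c_dual c_dual, of i j] dual_integrable_power[OF c_dual, of i 2] dual_integrable_power[OF c_dual, of j 2]
  have sq: "(\<integral>z. (c k z)\<^sup>2 \<partial>\<mu>) = 1" for k using ip_c[of k k] by (simp add: ip_def power2_eq_square)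
  show "integrable \<mu> (\<lambda>z. ((c i z)\<^sup>2 - 1) * ((c j z)\<^sup>2 - 1))" unfolding eq using int by simp
  show "(\<integral>z. ((c i z)\<^sup>2 - 1) * ((c j z)\<^sup>2 - 1) \<partial>\<mu>) = (if i = j then 2 else 0)"
    unfolding eq using int dual_mixed_moment(2)[OF c_dual c_dual, of i j]
    by (simp add: sq ip_c prob_space[unfolded space_mu])
qed

text \<open>The sum of \<open>n\<close> centred squares has second moment \<open>2 n\<close>, so its
  average along \<open>n = k^2\<close> has second moment \<open>2 / k^2\<close>. This is summable
  and gives almost sure convergence along squares; the gaps are filled by
  \<open>averages_along_squares\<close>.\<close>

theorem square_average_tendsto:
  "AE z in \<mu>. square_average c z \<longlonglongrightarrow> 1"
proof -
  define T where "T n z = (\<Sum>i<n. (c i z)\<^sup>2 - 1)" for n z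
  have T2: "(T n z)\<^sup>2 = (\<Sum>i<n. \<Sum>j<n. ((c i z)\<^sup>2 - 1) * ((c j z)\<^sup>2 - 1))" for n z
    by (simp add: T_def power2_eq_square sum_product)
  have T2_int: "integrable \<mu> (\<lambda>z. (T n z)\<^sup>2)" for n
    unfolding T2 using cross_moments(1) by (intro Bochner_Integration.integrable_sum) auto
  have T2_exp: "(\<integral>z. (T n z)\<^sup>2 \<partial>\<mu>) = 2 * real n" for n
    unfolding T2 using cross_moments by (simp add: Bochner_Integration.integral_sum Bochner_Integration.integrable_sum)
  have [measurable]: "c i \<in> borel_measurable \<mu>" for i by (rule dual_meas[OF c_dual])
  have [measurable]: "T n \<in> borel_measurable \<mu>" for n unfolding T_def by measurable
  have "AE z in \<mu>. summable (\<lambda>k. (T (k\<^sup>2) z / real (k\<^sup>2))\<^sup>2)"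
  proof (rule AE_summable_of_nn_integral)
    show "summable (\<lambda>k. 2 * inverse (real k ^ 2))"
      by (intro summable_mult inverse_power_summable) simp
    fix k
    have "(\<integral>\<^sup>+z. ennreal ((T (k\<^sup>2) z / real (k\<^sup>2))\<^sup>2) \<partial>\<mu>) = ennreal (\<integral>z. (T (k\<^sup>2) z / real (k\<^sup>2))\<^sup>2 \<partial>\<mu>)"
      using T2_int by (intro nn_integral_eq_integral) (auto simp: power_divide)
    also have "(\<integral>z. (T (k\<^sup>2) z / real (k\<^sup>2))\<^sup>2 \<partial>\<mu>) = 2 * real (k\<^sup>2) / (real (k\<^sup>2))\<^sup>2"
      by (simp add: power_divide T2_exp)
    also have "\<dots> = 2 * inverse (real k ^ 2)" by (simp add: power2_eq_square field_simps)
    finally show "(\<integral>\<^sup>+z. ennreal ((T (k\<^sup>2) z / real (k\<^sup>2))\<^sup>2) \<partial>\<mu>) \<le> ennreal (2 * inverse (real k ^ 2))" by simp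
  qed auto
  then show ?thesis
  proof eventually_elim
    case (elim z)
    have "(\<lambda>k. sqrt ((T (k\<^sup>2) z / real (k\<^sup>2))\<^sup>2)) \<longlonglongrightarrow> sqrt 0"
      by (intro tendsto_intros summable_LIMSEQ_zero elim)
    then have "(\<lambda>k. \<bar>T (k\<^sup>2) z / real (k\<^sup>2)\<bar>) \<longlonglongrightarrow> 0" by simp
    then have T0: "(\<lambda>k. T (k\<^sup>2) z / real (k\<^sup>2)) \<longlonglongrightarrow> 0" by (rule tendsto_rabs_zero_cancel)
    have "(\<lambda>k. (\<Sum>i<k\<^sup>2. (c i z)\<^sup>2) / real (k\<^sup>2)) \<longlonglongrightarrow> 1"
    proof (rule Lim_transform_eventually)
      show "(\<lambda>k. T (k\<^sup>2) z / real (k\<^sup>2) + 1) \<longlonglongrightarrow> 1" using tendsto_add[OF T0 tendsto_const[of 1]] by simp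
      show "\<forall>\<^sub>F k in sequentially. T (k\<^sup>2) z / real (k\<^sup>2) + 1 = (\<Sum>i<k\<^sup>2. (c i z)\<^sup>2) / real (k\<^sup>2)"
        by (rule eventually_mono[OF eventually_gt_at_top[of 0]]) (simp add: T_def sum_subtractf field_simps)
    qed
    then have "(\<lambda>n. (\<Sum>i<n. (c i z)\<^sup>2) / real n) \<longlonglongrightarrow> 1"
      by (intro averages_along_squares) (auto intro!: monoI sum_mono2 sum_nonneg)
    then show ?case by (simp add: square_average_def[abs_def])
  qed
qed

lemma noise_level_scaled:
  assumes a: "0 < a"
  shows "AE z in \<mu>. noise_level_positive c (a *\<^sub>R z) \<and> noise_level c (a *\<^sub>R z) = a"
  using square_average_tendsto
proof eventually_elim
  case (elim z)
  have "square_average c (a *\<^sub>R z) n = a\<^sup>2 * square_average c z n" for n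
    by (simp add: square_average_def top_dual_simps[OF c_dual] power_mult_distrib sum_distrib_left)
  then have "square_average c (a *\<^sub>R z) = (\<lambda>n. a\<^sup>2 * square_average c z n)" by blast
  then have "square_average c (a *\<^sub>R z) \<longlonglongrightarrow> a\<^sup>2" using tendsto_mult_left[OF elim, of "a\<^sup>2"] by simp
  then have "convergent (square_average c (a *\<^sub>R z))" "lim (square_average c (a *\<^sub>R z)) = a\<^sup>2"
    by (auto simp: convergent_def limI)
  then show ?case using a by (simp add: noise_level_positive_def noise_level_def)
qed

end

section \<open>A measurable extension of the duality\<close>

context cm_basis
begin

text \<open>The series \<open>\<Sum>i. c i h * c i y\<close> converges in \<open>L\<^sup>2\<close>; along the partial sums with indices
  \<open>index k h\<close> it converges almost everywhere, and \<open>index\<close> depends measurably on \<open>h\<close>.\<close>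

definition index :: "nat \<Rightarrow> 'a \<Rightarrow> nat" where
  "index k h = (LEAST n. tail n h \<le> (1 / 4) ^ k)"

definition pairing :: "'a \<Rightarrow> 'a \<Rightarrow> real" where
  "pairing h y = lim (\<lambda>k. S (index k h) h y)"

lemma tail_index:
  assumes h: "h \<in> cm_space \<mu>" shows "tail (index k h) h \<le> (1 / 4) ^ k"
proof -
  have "\<forall>\<^sub>F n in sequentially. tail n h < (1 / 4) ^ k"
    by (rule order_tendstoD(2)[OF tail_tendsto[OF h]]) simp
  then obtain n where "tail n h < (1 / 4) ^ k" by (auto simp: eventually_sequentially)
  then show ?thesis unfolding index_def using LeastI[of "\<lambda>n. tail n h \<le> (1 / 4) ^ k" n] by simp
qed

lemma index_mono:
  assumes h: "h \<in> cm_space \<mu>" shows "index k h \<le> index (Suc k) h"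
proof -
  have "tail (index (Suc k) h) h \<le> (1 / 4) ^ Suc k" by (rule tail_index[OF h])
  also have "\<dots> \<le> (1 / 4) ^ k" by simp
  finally show ?thesis unfolding index_def[of k] by (rule Least_le)
qed

lemma nn_integral_S_diff:
  assumes h: "h \<in> cm_space \<mu>"
  shows "(\<integral>\<^sup>+z. ennreal ((S m h z - S n h z)\<^sup>2) \<partial>\<mu>) \<le> ennreal (tail (min m n) h)"
proof -
  have *: "(\<integral>\<^sup>+z. ennreal ((S m h z - S n h z)\<^sup>2) \<partial>\<mu>) \<le> ennreal (tail n h)" if mn: "n \<le> m" for m n
  proof -
    have "(\<integral>\<^sup>+z. ennreal ((S m h z - S n h z)\<^sup>2) \<partial>\<mu>) = ennreal (\<integral>z. (S m h z - S n h z)\<^sup>2 \<partial>\<mu>)"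
      by (intro nn_integral_eq_integral dual_integrable_power[OF S_diff_dual]) auto
    also have "(\<integral>z. (S m h z - S n h z)\<^sup>2 \<partial>\<mu>) = (\<Sum>i=n..<m. (c i h)\<^sup>2)"
      unfolding ip_S_diff[OF mn, symmetric] by (simp add: ip_def power2_eq_square)
    also have "ennreal \<dots> \<le> ennreal (tail n h)" by (intro ennreal_leI partial_le_tail[OF h mn])
    finally show ?thesis .
  qed
  show ?thesis
  proof (cases "n \<le> m")
    case True
    then show ?thesis using *[OF True] by (simp add: min_absorb2)
  next
    case False
    then show ?thesis using *[of m n] by (simp add: min_absorb1 power2_commute)
  qed
qed

lemma S_index_convergent:
  assumes h: "h \<in> cm_space \<mu>"
  shows "AE z in \<mu>. convergent (\<lambda>k. S (index k h) h z)"
proof -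
  let ?\<Delta> = "\<lambda>k z. S (index (Suc k) h) h z - S (index k h) h z"
  have [measurable]: "?\<Delta> k \<in> borel_measurable \<mu>" for k by (rule dual_meas[OF S_diff_dual])
  have "AE z in \<mu>. summable (\<lambda>k. \<bar>?\<Delta> k z\<bar>)"
  proof (rule AE_summable_of_nn_integral)
    show "summable (\<lambda>k. (1 / 2 :: real) ^ k)" by (rule summable_geometric) simp
    fix k
    have "(\<integral>\<^sup>+z. ennreal ((?\<Delta> k z)\<^sup>2) \<partial>\<mu>) \<le> ennreal (tail (index k h) h)"
      using nn_integral_S_diff[OF h, of "index (Suc k) h" "index k h"] index_mono[OF h, of k] by (simp add: min_absorb2)
    also have "\<dots> \<le> ennreal ((1 / 4) ^ k)" by (intro ennreal_leI tail_index[OF h])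
    finally have sq: "(\<integral>\<^sup>+z. ennreal ((?\<Delta> k z)\<^sup>2) \<partial>\<mu>) \<le> ennreal ((1 / 4) ^ k)" .
    have e: "ennreal (p * q + r) = ennreal p * ennreal q + ennreal r" if "0 \<le> p" "0 \<le> q" "0 \<le> r" for p q r
      using that by (simp add: ennreal_mult)
    \<comment> \<open>A weighted arithmetic-geometric inequality: with weight \<open>2 ^ k\<close>,
      a squared L2 norm of at most \<open>(1 / 4) ^ k\<close> becomes an L1 norm of at most
      \<open>(1 / 2) ^ k\<close>, which is summable.\<close>
    have "(\<integral>\<^sup>+z. ennreal \<bar>?\<Delta> k z\<bar> \<partial>\<mu>) \<le> (\<integral>\<^sup>+z. ennreal (2 ^ k / 2) * ennreal ((?\<Delta> k z)\<^sup>2) + ennreal ((1 / 2) ^ k / 2) \<partial>\<mu>)"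
    proof (rule nn_integral_mono)
      fix z
      have "0 \<le> (2 ^ k * \<bar>?\<Delta> k z\<bar> - 1)\<^sup>2" by simp
      then have "2 * (2 ^ k * \<bar>?\<Delta> k z\<bar>) \<le> (2 ^ k)\<^sup>2 * (?\<Delta> k z)\<^sup>2 + 1"
        by (simp add: power2_diff power_mult_distrib)
      then have "\<bar>?\<Delta> k z\<bar> \<le> ((2 ^ k)\<^sup>2 * (?\<Delta> k z)\<^sup>2 + 1) / (2 * 2 ^ k)"
        by (simp add: field_simps)
      also have "\<dots> = 2 ^ k / 2 * (?\<Delta> k z)\<^sup>2 + (1 / 2) ^ k / 2"
        by (simp add: add_divide_distrib power2_eq_square power_one_over)
      finally have "ennreal \<bar>?\<Delta> k z\<bar> \<le> ennreal (2 ^ k / 2 * (?\<Delta> k z)\<^sup>2 + (1 / 2) ^ k / 2)" by (rule ennreal_leI)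
      then show "ennreal \<bar>?\<Delta> k z\<bar> \<le> ennreal (2 ^ k / 2) * ennreal ((?\<Delta> k z)\<^sup>2) + ennreal ((1 / 2) ^ k / 2)"
        by (subst (asm) e) auto
    qed
    also have "\<dots> = ennreal (2 ^ k / 2) * (\<integral>\<^sup>+z. ennreal ((?\<Delta> k z)\<^sup>2) \<partial>\<mu>) + ennreal ((1 / 2) ^ k / 2)"
      by (simp add: nn_integral_add nn_integral_cmult emeasure_space_1[unfolded space_mu])
    also have "\<dots> \<le> ennreal (2 ^ k / 2) * ennreal ((1 / 4) ^ k) + ennreal ((1 / 2) ^ k / 2)"
      by (intro add_mono mult_left_mono sq) auto
    also have "\<dots> = ennreal (2 ^ k / 2 * (1 / 4) ^ k + (1 / 2) ^ k / 2)"
      by (rule e[symmetric]) auto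
    also have "2 ^ k / 2 * (1 / 4) ^ k + (1 / 2) ^ k / 2 = (1 / 2 :: real) ^ k"
    proof -
      have "(1 / 4 :: real) ^ k = (1 / 2) ^ k * (1 / 2) ^ k" "(2 :: real) ^ k * (1 / 2) ^ k = 1"
        by (simp_all flip: power_mult_distrib)
      then have "2 ^ k * (1 / 4 :: real) ^ k = (1 / 2) ^ k" by (simp flip: mult.assoc)
      then show ?thesis by simp
    qed
    finally show "(\<integral>\<^sup>+z. ennreal \<bar>?\<Delta> k z\<bar> \<partial>\<mu>) \<le> ennreal ((1 / 2) ^ k)" .
  qed auto
  then show ?thesis
  proof eventually_elim
    case (elim z)
    then have "summable (\<lambda>k. ?\<Delta> k z)" by (rule summable_rabs_cancel)
    then have "convergent (\<lambda>n. \<Sum>k<n. ?\<Delta> k z)" by (simp add: summable_iff_convergent)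
    then have "convergent (\<lambda>n. S (index n h) h z - S (index 0 h) h z)"
      using sum_lessThan_telescope[of "\<lambda>k. S (index k h) h z"] by simp
    from convergent_add[OF this convergent_const[of "S (index 0 h) h z"]] show ?case by simp
  qed
qed

lemma S_scaleR: "S n h (a *\<^sub>R y) = a * S n h y"
  by (simp add: S_def top_dual_simps[OF c_dual] sum_distrib_left mult.left_commute)

lemma pairing_measurable: "pairing h \<in> borel_measurable borel"
  unfolding pairing_def using top_dual_measurable[OF S_dual] by measurable

text \<open>Fatou's lemma along \<open>index k h\<close>; homogeneity moves the scaling into the
  factor \<open>a\<^sup>2\<close>. As \<open>index k h\<close> may stay below \<open>n\<close>, the
  bound is the tail at the smaller of the two indices: either \<open>tail n h\<close> or, for
  \<open>k \<ge> n\<close>, at most \<open>(1 / 4) ^ n\<close>.\<close>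

lemma pairing_L2:
  assumes h: "h \<in> cm_space \<mu>" and a: "0 < a"
  shows "(\<lambda>n. \<integral>\<^sup>+y. ennreal ((S n h y - pairing h y)\<^sup>2) \<partial>distr \<mu> borel (\<lambda>z. a *\<^sub>R z)) \<longlonglongrightarrow> 0"
proof -
  note [measurable] = pairing_measurable top_dual_measurable[OF S_dual] dual_meas[OF S_dual]
  have bound: "(\<integral>\<^sup>+y. ennreal ((S n h y - pairing h y)\<^sup>2) \<partial>distr \<mu> borel (\<lambda>z. a *\<^sub>R z))
      \<le> ennreal (a\<^sup>2 * (tail n h + (1 / 4) ^ n))" for n
  proof -
    let ?u = "\<lambda>k z. ennreal (a\<^sup>2) * ennreal ((S n h z - S (index k h) h z)\<^sup>2)"
    have "(\<integral>\<^sup>+y. ennreal ((S n h y - pairing h y)\<^sup>2) \<partial>distr \<mu> borel (\<lambda>z. a *\<^sub>R z))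
        = (\<integral>\<^sup>+z. ennreal ((S n h (a *\<^sub>R z) - pairing h (a *\<^sub>R z))\<^sup>2) \<partial>\<mu>)"
      by (rule nn_integral_scaled) measurable
    also have "\<dots> = (\<integral>\<^sup>+z. liminf (\<lambda>k. ?u k z) \<partial>\<mu>)"
    proof (rule nn_integral_cong_AE)
      show "AE z in \<mu>. ennreal ((S n h (a *\<^sub>R z) - pairing h (a *\<^sub>R z))\<^sup>2) = liminf (\<lambda>k. ?u k z)"
        using S_index_convergent[OF h]
      proof eventually_elim
        case (elim z)
        then obtain l where l: "(\<lambda>k. S (index k h) h z) \<longlonglongrightarrow> l" by (auto simp: convergent_def)
        have "(\<lambda>k. S (index k h) h (a *\<^sub>R z)) \<longlonglongrightarrow> a * l"
          unfolding S_scaleR by (intro tendsto_intros l)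
        then have p: "pairing h (a *\<^sub>R z) = a * l" unfolding pairing_def by (rule limI)
        have "(\<lambda>k. ?u k z) \<longlonglongrightarrow> ennreal (a\<^sup>2) * ennreal ((S n h z - l)\<^sup>2)"
          by (intro tendsto_intros l ennreal_tendsto_cmult) auto
        then have "liminf (\<lambda>k. ?u k z) = ennreal (a\<^sup>2) * ennreal ((S n h z - l)\<^sup>2)"
          by (intro lim_imp_Liminf) auto
        then show ?case
          by (simp add: p S_scaleR power_mult_distrib ennreal_mult flip: right_diff_distrib)
      qed
    qed
    also have "\<dots> \<le> liminf (\<lambda>k. \<integral>\<^sup>+z. ?u k z \<partial>\<mu>)"
      by (rule nn_integral_liminf) measurable
    also have "\<dots> \<le> ennreal (a\<^sup>2 * (tail n h + (1 / 4) ^ n))"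
    proof (rule Liminf_le)
      show "\<forall>\<^sub>F k in sequentially. (\<integral>\<^sup>+z. ?u k z \<partial>\<mu>) \<le> ennreal (a\<^sup>2 * (tail n h + (1 / 4) ^ n))"
      proof (rule eventually_sequentiallyI)
        fix k assume k: "n \<le> k"
        have "(\<integral>\<^sup>+z. ?u k z \<partial>\<mu>) = ennreal (a\<^sup>2) * (\<integral>\<^sup>+z. ennreal ((S n h z - S (index k h) h z)\<^sup>2) \<partial>\<mu>)"
          by (rule nn_integral_cmult) measurable
        also have "\<dots> \<le> ennreal (a\<^sup>2) * ennreal (tail (min n (index k h)) h)"
          by (intro mult_left_mono nn_integral_S_diff[OF h]) auto
        also have "\<dots> = ennreal (a\<^sup>2 * tail (min n (index k h)) h)"
          by (rule ennreal_mult[symmetric]) (auto intro: tail_nonneg[OF h])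
        also have "\<dots> \<le> ennreal (a\<^sup>2 * (tail n h + (1 / 4) ^ n))"
        proof (intro ennreal_leI mult_left_mono)
          have "(1 / 4 :: real) ^ k \<le> (1 / 4) ^ n" using k by (intro power_decreasing) auto
          then show "tail (min n (index k h)) h \<le> tail n h + (1 / 4) ^ n"
            using tail_index[OF h, of k] tail_nonneg[OF h, of n] zero_le_power[of "1 / 4 :: real" n]
            unfolding min_def by (cases "n \<le> index k h") (simp_all only: if_True if_False, linarith+)
        qed simp
        finally show "(\<integral>\<^sup>+z. ?u k z \<partial>\<mu>) \<le> ennreal (a\<^sup>2 * (tail n h + (1 / 4) ^ n))" .
      qed
    qed simp
    finally show ?thesis .
  qed
  show ?thesis
  proof (rule tendsto_sandwich[OF _ _ tendsto_const])
    have "(\<lambda>n. a\<^sup>2 * (tail n h + (1 / 4) ^ n)) \<longlonglongrightarrow> a\<^sup>2 * (0 + 0)"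
      by (intro tendsto_intros tail_tendsto[OF h] LIMSEQ_realpow_zero) auto
    then have "(\<lambda>n. ennreal (a\<^sup>2 * (tail n h + (1 / 4) ^ n))) \<longlonglongrightarrow> ennreal 0"
      by (intro tendsto_ennrealI) simp
    then show "(\<lambda>n. ennreal (a\<^sup>2 * (tail n h + (1 / 4) ^ n))) \<longlonglongrightarrow> 0" by simp
  qed (use bound in auto)
qed

context
  fixes L :: "'b::topological_space \<Rightarrow> 'a"
  assumes L: "L \<in> measurable borel borel" and L_range: "range L \<subseteq> cm_space \<mu>"
begin

lemma c_L_measurable [measurable]: "(\<lambda>x. c i (L x)) \<in> borel_measurable borel"
  by (rule measurable_compose[OF L top_dual_measurable[OF c_dual]])

lemma cm_norm_L_measurable: "(\<lambda>x. (cm_norm \<mu> (L x))\<^sup>2) \<in> borel_measurable borel"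
proof -
  have "(cm_norm \<mu> (L x))\<^sup>2 = (\<Sum>i. (c i (L x))\<^sup>2)" for x
  proof -
    have "L x \<in> cm_space \<mu>" using L_range by blast
    then show ?thesis using cm_norm_sums by (simp add: sums_iff)
  qed
  then show ?thesis by simp
qed

text \<open>The truncation index depends on \<open>x\<close> only and takes countably many values,
  so inserting it into the jointly measurable partial sums preserves joint measurability, as does
  the pointwise limit.\<close>

lemma pairing_jointly_measurable:
  "(\<lambda>(x, y). pairing (L x) y) \<in> borel_measurable (borel \<Otimes>\<^sub>M borel)"
proof -
  note [measurable] = cm_norm_L_measurable top_dual_measurable[OF c_dual]
  have [measurable]: "(\<lambda>x. tail n (L x)) \<in> borel_measurable borel" for n unfolding tail_def by measurable
  have index: "(\<lambda>x. index k (L x)) \<in> measurable borel (count_space UNIV)" for k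
    unfolding index_def by measurable
  have S: "(\<lambda>p. S n (L (fst p)) (snd p)) \<in> borel_measurable (borel \<Otimes>\<^sub>M borel)" for n
    unfolding S_def by measurable
  have "(\<lambda>p. S (index k (L (fst p))) (L (fst p)) (snd p)) \<in> borel_measurable (borel \<Otimes>\<^sub>M borel)" for k
    using S measurable_compose[OF measurable_fst index] by (rule measurable_compose_countable)
  then show ?thesis unfolding split_beta pairing_def by measurable
qed

theorem duality_version_pairing: "duality_version \<mu> L pairing"
  unfolding duality_version_def
proof (intro conjI ballI pairing_jointly_measurable pairing_measurable)
  fix h assume h: "h \<in> cm_space \<mu>"
  show "\<exists>\<phi>. (\<forall>n. \<phi> n \<in> top_dual) \<and> tendsto_cov_inv \<mu> \<phi> h \<and>
      (\<forall>a>0. (\<lambda>n. \<integral>\<^sup>+y. ennreal ((\<phi> n y - pairing h y)\<^sup>2) \<partial>distr \<mu> borel (\<lambda>z. a *\<^sub>R z)) \<longlonglongrightarrow> 0)"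
    by (intro exI[of _ "\<lambda>n. S n h"] conjI allI impI S_dual S_tendsto_cov_inv pairing_L2 h)
qed

end

end

section \<open>Bayes formula\<close>

text \<open>Independence gives the product formula on threefold rectangles. Uniqueness of product
  measures is used twice, because the outer use asks for arbitrary measurable sets in the last two
  coordinates.\<close>

theorem indep_rvs3_distr:
  fixes U :: "'w \<Rightarrow> 'a::topological_space" and V :: "'w \<Rightarrow> 'b::topological_space" and W :: "'w \<Rightarrow> 'c::topological_space"
  assumes M: "prob_space M"
    and [measurable]: "U \<in> measurable M borel" "V \<in> measurable M borel" "W \<in> measurable M borel"
    and indep: "indep_rvs3 M U V W"
  shows "distr M (borel \<Otimes>\<^sub>M (borel \<Otimes>\<^sub>M borel)) (\<lambda>\<omega>. (U \<omega>, V \<omega>, W \<omega>)) =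
    distr M borel U \<Otimes>\<^sub>M (distr M borel V \<Otimes>\<^sub>M distr M borel W)"
proof -
  interpret prob_space M by fact
  interpret U: prob_space "distr M borel U" by (rule prob_space_distr) simp
  interpret V: prob_space "distr M borel V" by (rule prob_space_distr) simp
  interpret W: prob_space "distr M borel W" by (rule prob_space_distr) simp
  interpret VW: pair_prob_space "distr M borel V" "distr M borel W" ..
  have rect: "emeasure M ((U -` A \<inter> space M) \<inter> ((V -` B \<inter> space M) \<inter> (W -` C \<inter> space M))) =
      emeasure (distr M borel U) A * (emeasure (distr M borel V) B * emeasure (distr M borel W) C)"
    if [measurable]: "A \<in> sets borel" "B \<in> sets borel" "C \<in> sets borel" for A B C
  proof -
    let ?F = "\<lambda>i::nat. [{U -` A \<inter> space M | A. A \<in> sets borel}, {V -` A \<inter> space M | A. A \<in> sets borel},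
           {W -` A \<inter> space M | A. A \<in> sets borel}] ! i"
    let ?A = "\<lambda>i::nat. [U -` A \<inter> space M, V -` B \<inter> space M, W -` C \<inter> space M] ! i"
    have "prob (\<Inter>i\<in>{0,1,2}. ?A i) = (\<Prod>i\<in>{0,1,2}. prob (?A i))"
    proof (rule indep_setsD)
      show "indep_sets ?F {0,1,2}" using indep by (simp add: indep_rvs3_def)
      show "\<forall>i\<in>{0,1,2}. ?A i \<in> ?F i" using that by auto
    qed auto
    then show ?thesis
      by (simp add: emeasure_distr emeasure_eq_measure Int_assoc flip: ennreal_mult)
  qed
  show ?thesis
  proof (rule pair_measure_eqI[symmetric])
    show "sigma_finite_measure (distr M borel U)" by unfold_locales
    show "sigma_finite_measure (distr M borel V \<Otimes>\<^sub>M distr M borel W)" by unfold_locales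
    show "sets (distr M borel U \<Otimes>\<^sub>M (distr M borel V \<Otimes>\<^sub>M distr M borel W)) =
        sets (distr M (borel \<Otimes>\<^sub>M (borel \<Otimes>\<^sub>M borel)) (\<lambda>\<omega>. (U \<omega>, V \<omega>, W \<omega>)))"
      by (simp cong: sets_pair_measure_cong)
    fix A E
    assume "A \<in> sets (distr M borel U)" and "E \<in> sets (distr M borel V \<Otimes>\<^sub>M distr M borel W)"
    then have A[measurable]: "A \<in> sets borel" and E[measurable]: "E \<in> sets (borel \<Otimes>\<^sub>M borel)"
      by (simp_all cong: sets_pair_measure_cong)
    define a where "a = emeasure (distr M borel U) A"
    \<comment> \<open>The law of \<open>V\<close> and \<open>W\<close> on the event that
      \<open>U\<close> lies in \<open>A\<close>. The inner uniqueness identifies it with a product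
      in which the mass \<open>a\<close> is absorbed as a constant density, so that
      \<open>a = 0\<close> is no exception.\<close>
    define \<nu> where "\<nu> = distr (density M (indicator (U -` A \<inter> space M))) (borel \<Otimes>\<^sub>M borel) (\<lambda>\<omega>. (V \<omega>, W \<omega>))"
    have \<nu>: "emeasure \<nu> E = emeasure M ((U -` A \<inter> space M) \<inter> ((\<lambda>\<omega>. (V \<omega>, W \<omega>)) -` E \<inter> space M))"
      if [measurable]: "E \<in> sets (borel \<Otimes>\<^sub>M borel)" for E
    proof -
      have "emeasure \<nu> E = (\<integral>\<^sup>+\<omega>. indicator (U -` A \<inter> space M) \<omega> * indicator ((\<lambda>\<omega>. (V \<omega>, W \<omega>)) -` E \<inter> space M) \<omega> \<partial>M)"
        unfolding \<nu>_def by (subst emeasure_distr) (auto simp: emeasure_density)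
      also have "\<dots> = (\<integral>\<^sup>+\<omega>. indicator ((U -` A \<inter> space M) \<inter> ((\<lambda>\<omega>. (V \<omega>, W \<omega>)) -` E \<inter> space M)) \<omega> \<partial>M)"
        by (intro nn_integral_cong) (auto simp: indicator_def)
      finally show ?thesis by simp
    qed
    have fin: "finite_measure (density (distr M borel V) (\<lambda>_. a))"
    proof (rule finite_measureI)
      have "emeasure (density (distr M borel V) (\<lambda>_. a)) (space (density (distr M borel V) (\<lambda>_. a))) = a * emeasure (distr M borel V) UNIV"
        by (subst emeasure_density_const) auto
      also have "\<dots> \<noteq> \<infinity>" by (simp add: a_def U.emeasure_eq_measure V.emeasure_eq_measure ennreal_mult_eq_top_iff)
      finally show "emeasure (density (distr M borel V) (\<lambda>_. a)) (space (density (distr M borel V) (\<lambda>_. a))) \<noteq> \<infinity>" .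
    qed
    have "density (distr M borel V) (\<lambda>_. a) \<Otimes>\<^sub>M distr M borel W = \<nu>"
    proof (rule pair_measure_eqI)
      show "sigma_finite_measure (density (distr M borel V) (\<lambda>_. a))"
        using fin by (rule finite_measure.sigma_finite_measure)
      show "sigma_finite_measure (distr M borel W)" by unfold_locales
      show "sets (density (distr M borel V) (\<lambda>_. a) \<Otimes>\<^sub>M distr M borel W) = sets \<nu>"
        by (simp add: \<nu>_def cong: sets_pair_measure_cong)
      fix B C assume "B \<in> sets (density (distr M borel V) (\<lambda>_. a))" "C \<in> sets (distr M borel W)"
      then have [measurable]: "B \<in> sets borel" "C \<in> sets borel" by simp_all
      have "(\<lambda>\<omega>. (V \<omega>, W \<omega>)) -` (B \<times> C) \<inter> space M = (V -` B \<inter> space M) \<inter> (W -` C \<inter> space M)" by auto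
      then have "emeasure \<nu> (B \<times> C) = a * (emeasure (distr M borel V) B * emeasure (distr M borel W) C)"
        using rect[OF A, of B C] by (simp add: \<nu> a_def)
      then show "emeasure (density (distr M borel V) (\<lambda>_. a)) B * emeasure (distr M borel W) C = emeasure \<nu> (B \<times> C)"
        by (simp add: emeasure_density_const mult.assoc)
    qed
    then have "emeasure \<nu> E = emeasure (density (distr M borel V) (\<lambda>_. a) \<Otimes>\<^sub>M distr M borel W) E" by simp
    also have "\<dots> = (\<integral>\<^sup>+x. emeasure (distr M borel W) (Pair x -` E) \<partial>density (distr M borel V) (\<lambda>_. a))"
      by (rule W.emeasure_pair_measure_alt) (simp cong: sets_pair_measure_cong)
    also have "\<dots> = a * (\<integral>\<^sup>+x. emeasure (distr M borel W) (Pair x -` E) \<partial>distr M borel V)"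
    proof -
      have m: "(\<lambda>x. emeasure (distr M borel W) (Pair x -` E)) \<in> borel_measurable (distr M borel V)"
        by (rule W.measurable_emeasure_Pair) (simp cong: sets_pair_measure_cong)
      show ?thesis by (subst nn_integral_density[OF _ m]) (auto intro!: nn_integral_cmult m)
    qed
    also have "(\<integral>\<^sup>+x. emeasure (distr M borel W) (Pair x -` E) \<partial>distr M borel V) = emeasure (distr M borel V \<Otimes>\<^sub>M distr M borel W) E"
      by (rule W.emeasure_pair_measure_alt[symmetric]) (simp cong: sets_pair_measure_cong)
    finally have "a * emeasure (distr M borel V \<Otimes>\<^sub>M distr M borel W) E = emeasure \<nu> E" by simp
    also have "\<dots> = emeasure (distr M (borel \<Otimes>\<^sub>M (borel \<Otimes>\<^sub>M borel)) (\<lambda>\<omega>. (U \<omega>, V \<omega>, W \<omega>))) (A \<times> E)"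
      by (subst emeasure_distr) (auto simp: \<nu> intro!: arg_cong[where f="emeasure M"])
    finally show "emeasure (distr M borel U) A * emeasure (distr M borel V \<Otimes>\<^sub>M distr M borel W) E =
        emeasure (distr M (borel \<Otimes>\<^sub>M (borel \<Otimes>\<^sub>M borel)) (\<lambda>\<omega>. (U \<omega>, V \<omega>, W \<omega>))) (A \<times> E)"
      by (simp add: a_def)
  qed
qed

text \<open>Needed to merge one exceptional null set per event into a single null set. Rational
  half-lines of the countably many functionals \<open>sep n\<close> and their finite intersections
  suffice.\<close>

lemma (in souslin_lcs) countable_Int_stable_generator:
  "\<exists>E. countable E \<and> Int_stable E \<and> UNIV \<in> E \<and> E \<subseteq> sets borel \<and> sets (borel :: 'g measure) = sigma_sets UNIV E"
proof -
  define G where "G = (\<lambda>(n, q). sep n -` {..q}) ` (UNIV \<times> \<rat>)"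
  define E where "E = Inter ` {A. finite A \<and> A \<subseteq> G}"
  have meas: "sep n \<in> borel_measurable borel" for n by (rule top_dual_measurable[OF sep_dual])
  have "countable G" unfolding G_def by (intro countable_image countable_SIGMA countableI_type countable_rat)
  then have cE: "countable E" unfolding E_def by (intro countable_image countable_Collect_finite_subset)
  have GE: "G \<subseteq> E"
  proof
    fix g assume "g \<in> G"
    then show "g \<in> E" unfolding E_def by (intro image_eqI[of _ _ "{g}"]) auto
  qed
  have UE: "UNIV \<in> E" unfolding E_def by (intro image_eqI[of _ _ "{}"]) auto
  have Gm: "g \<in> sets borel" if "g \<in> G" for g
    using that measurable_sets[OF meas, of "{..q}" n for n q] by (auto simp: G_def)
  have Em: "E \<subseteq> sets borel"
  proof
    fix A assume "A \<in> E"
    then obtain B where B: "A = \<Inter>B" "finite B" "B \<subseteq> G" by (auto simp: E_def)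
    show "A \<in> sets borel"
    proof (cases "B = {}")
      case False
      then show ?thesis using B Gm by (auto intro!: sets.finite_INT[of B id borel, simplified])
    qed (simp add: B)
  qed
  have "Int_stable E"
  proof (rule Int_stableI)
    fix A B assume "A \<in> E" "B \<in> E"
    then obtain A' B' where AB: "A = \<Inter>A'" "B = \<Inter>B'" "finite A'" "finite B'" "A' \<subseteq> G" "B' \<subseteq> G"
      by (auto simp: E_def)
    then have "A \<inter> B = \<Inter>(A' \<union> B')" by auto
    then show "A \<inter> B \<in> E" unfolding E_def using AB by (intro image_eqI[of _ _ "A' \<union> B'"]) auto
  qed
  moreover have "sets (borel :: 'g measure) = sigma_sets UNIV E"
  proof
    show "sigma_sets UNIV E \<subseteq> sets borel" using sets.sigma_sets_subset[OF Em] by simp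
    interpret E: sigma_algebra UNIV "sigma_sets UNIV E" by (rule sigma_algebra_sigma_sets) auto
    have sepm: "sep n \<in> borel_measurable (sigma UNIV E)" for n
    proof -
      have sp: "space (sigma UNIV E) = UNIV" "sets (sigma UNIV E) = sigma_sets UNIV E"
        by (auto simp: space_measure_of_conv)
      have "{z \<in> space (sigma UNIV E). sep n z < a} \<in> sets (sigma UNIV E)" for a
      proof -
        have "(\<exists>q. q \<in> \<rat> \<and> q < a \<and> sep n z \<le> q) \<longleftrightarrow> sep n z < a" for z
          using Rats_dense_in_real[of "sep n z" a] by (auto intro: less_imp_le)
        then have "{z \<in> space (sigma UNIV E). sep n z < a} = (\<Union>q\<in>{q \<in> \<rat>. q < a}. sep n -` {..q})"
          by (auto simp: sp(1))
        also have "\<dots> \<in> sets (sigma UNIV E)"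
        proof (rule sets.countable_UN')
          show "countable {q \<in> \<rat>. q < a}" by (rule countable_subset[OF _ countable_rat]) auto
          show "(\<lambda>q. sep n -` {..q}) ` {q \<in> \<rat>. q < a} \<subseteq> sets (sigma UNIV E)"
            using GE by (auto simp: G_def sp(2))
        qed
        finally show ?thesis .
      qed
      then show ?thesis by (simp add: borel_measurable_iff_less)
    qed
    have "{sep n -` S | n S. S \<in> sets borel} \<subseteq> sigma_sets UNIV E"
    proof clarify
      fix n and S :: "real set" assume "S \<in> sets borel"
      from measurable_sets[OF sepm this, of n] show "sep n -` S \<in> sigma_sets UNIV E"
        by (simp add: space_measure_of_conv)
    qed
    then show "sets borel \<subseteq> sigma_sets UNIV E"
      unfolding borel_generated by (rule E.sigma_sets_subset)
  qed
  ultimately show ?thesis using cE UE Em by blast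
qed

text \<open>Two solutions agree almost surely on each event, hence simultaneously on a countable
  generator; where they do, the two probability measures coincide.\<close>

theorem posterior_essentially_unique:
  fixes X :: "'w \<Rightarrow> 'f::locally_convex_tvs" and Y :: "'w \<Rightarrow> 'g::topological_space"
  assumes souslin: "souslin_space (euclidean :: 'f topology)" and M: "prob_space M"
    and Y[measurable]: "Y \<in> measurable M borel" and \<kappa>: "posterior_solution M X Y \<kappa>"
  shows "essentially_unique_posterior M X Y \<kappa>"
  unfolding essentially_unique_posterior_def
proof (intro allI impI)
  fix \<kappa>' assume \<kappa>': "posterior_solution M X Y \<kappa>'"
  interpret souslin_lcs "TYPE('f)" by unfold_locales (rule souslin)
  interpret prob_space M by fact
  let ?\<nu> = "distr M borel Y"
  interpret \<nu>: prob_space ?\<nu> by (rule prob_space_distr) simp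
  obtain E where E: "countable E" "Int_stable E" "UNIV \<in> E" "E \<subseteq> sets borel"
      "sets (borel :: 'f measure) = sigma_sets UNIV E"
    using countable_Int_stable_generator by blast
  define C where "C = {y. \<forall>U\<in>E. measure (\<kappa>' y) U = measure (\<kappa> y) U}"
  have meas: "(\<lambda>y. measure (\<kappa>'' y) U) \<in> borel_measurable (completion ?\<nu>)"
    if "U \<in> E" "posterior_solution M X Y \<kappa>''" for U \<kappa>''
    using that E by (auto simp: posterior_solution_def)
  have "C = (\<Inter>U\<in>E. {y \<in> space (completion ?\<nu>). measure (\<kappa>' y) U = measure (\<kappa> y) U})"
    using E(3) by (auto simp: C_def)
  also have "\<dots> \<in> sets (completion ?\<nu>)"
    using E(1,3) meas \<kappa> \<kappa>' by (intro sets.countable_INT'' borel_measurable_eq) auto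
  finally have C: "C \<in> sets (completion ?\<nu>)" .
  have "AE \<omega> in M. \<forall>U\<in>E. measure (\<kappa>' (Y \<omega>)) U = measure (\<kappa> (Y \<omega>)) U"
    unfolding AE_ball_countable[OF E(1)]
  proof
    fix U assume "U \<in> E"
    then have U: "U \<in> sets borel" using E by auto
    have "AE \<omega> in M. measure (\<kappa>'' (Y \<omega>)) U = real_cond_exp M (vimage_algebra (space M) Y borel) (\<lambda>\<omega>. indicator U (X \<omega>)) \<omega>"
      if "posterior_solution M X Y \<kappa>''" for \<kappa>'' using that U by (auto simp: posterior_solution_def)
    from this[OF \<kappa>] this[OF \<kappa>'] show "AE \<omega> in M. measure (\<kappa>' (Y \<omega>)) U = measure (\<kappa> (Y \<omega>)) U"
      by eventually_elim simp
  qed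
  then have YC: "AE \<omega> in M. Y \<omega> \<in> C" by (simp add: C_def)
  \<comment> \<open>\<open>C\<close> is measurable only for the completion, while the transfer from
    \<open>M\<close> to the law of \<open>Y\<close> needs a Borel set. Up to a Borel null set
    \<open>N'\<close>, \<open>C\<close> is the Borel set \<open>S\<close>.\<close>
  obtain S N N' where SN: "C = S \<union> N" "N \<subseteq> N'" "N' \<in> null_sets ?\<nu>" "S \<in> sets ?\<nu>"
    using C by (rule sets_completionE)
  have "AE y in ?\<nu>. y \<notin> N'" using SN(3) by (rule AE_not_in)
  then have "AE \<omega> in M. Y \<omega> \<notin> N'" by (rule AE_distrD[OF Y])
  with YC have "AE \<omega> in M. Y \<omega> \<in> S" by eventually_elim (use SN in auto)
  then have "AE y in ?\<nu>. y \<in> S" using SN(4) by (subst AE_distr_iff) auto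
  then have S1: "measure ?\<nu> S = 1" using SN(4) by (simp add: \<nu>.prob_eq_1)
  have C1: "measure (completion ?\<nu>) C = 1"
  proof -
    interpret c: prob_space "completion ?\<nu>"
      using \<nu>.emeasure_space_1 by (intro prob_spaceI) (simp add: emeasure_completion)
    have "measure (completion ?\<nu>) S \<le> measure (completion ?\<nu>) C"
      using SN C by (intro c.finite_measure_mono) auto
    then have "1 \<le> measure (completion ?\<nu>) C" using S1 SN(4) by simp
    with c.prob_le_1[of C] show ?thesis by (rule antisym)
  qed
  have "measure (\<kappa>' y) U = measure (\<kappa> y) U" if y: "y \<in> C" and U: "U \<in> sets borel" for y U
  proof -
    have p: "prob_space (\<kappa> y)" "sets (\<kappa> y) = sets borel" "prob_space (\<kappa>' y)" "sets (\<kappa>' y) = sets borel"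
      using \<kappa> \<kappa>' by (auto simp: posterior_solution_def)
    interpret k: prob_space "\<kappa> y" by fact
    interpret k': prob_space "\<kappa>' y" by fact
    have "\<kappa>' y = \<kappa> y"
    proof (rule measure_eqI_generator_eq[OF E(2), of UNIV _ _ "\<lambda>_. UNIV"])
      show "emeasure (\<kappa>' y) A = emeasure (\<kappa> y) A" if "A \<in> E" for A
        using y that by (simp add: C_def k.emeasure_eq_measure k'.emeasure_eq_measure)
    qed (use E p in auto)
    then show ?thesis by simp
  qed
  then show "\<exists>C\<in>sets (completion ?\<nu>). measure (completion ?\<nu>) C = 1 \<and>
      (\<forall>y\<in>C. \<forall>U\<in>sets borel. measure (\<kappa>' y) U = measure (\<kappa> y) U)"
    using C C1 by blast
qed

section \<open>The posterior for the model with random noise amplitude\<close>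

locale inverse_problem = cm_basis TYP \<mu> e c
  for TYP :: "'g::locally_convex_tvs itself" and \<mu> e c +
  fixes M :: "'w measure" and X :: "'w \<Rightarrow> 'f::locally_convex_tvs" and Z :: "'w \<Rightarrow> 'g"
    and \<gamma> :: "'w \<Rightarrow> real" and L :: "'f \<Rightarrow> 'g"
  assumes souslin_F: "souslin_space (euclidean :: 'f topology)"
    and prob: "prob_space M"
    and X [measurable]: "X \<in> measurable M borel"
    and Z [measurable]: "Z \<in> measurable M borel"
    and \<gamma> [measurable]: "\<gamma> \<in> measurable M borel"
    and law_Z: "\<mu> = distr M borel Z"
    and \<gamma>_nonneg: "\<And>\<omega>. \<omega> \<in> space M \<Longrightarrow> 0 \<le> \<gamma> \<omega>"
    and \<gamma>_no_atom: "measure (distr M borel \<gamma>) {0} = 0"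
    and indep: "indep_rvs3 M \<gamma> X Z"
    and L_cont: "continuous_on UNIV L"
    and L_range: "range L \<subseteq> cm_space \<mu>"
begin

abbreviation "\<mu>X \<equiv> distr M borel X"
abbreviation "\<mu>\<gamma> \<equiv> distr M borel \<gamma>"
abbreviation "Y \<equiv> (\<lambda>\<omega>. L (X \<omega>) + \<gamma> \<omega> *\<^sub>R Z \<omega>)"

sublocale M: prob_space M by (rule prob)
sublocale X: prob_space \<mu>X by (rule M.prob_space_distr) simp
sublocale \<gamma>: prob_space \<mu>\<gamma> by (rule M.prob_space_distr) simp
sublocale XZ: pair_prob_space \<mu>X \<mu> ..

lemma L_meas [measurable]: "L \<in> measurable borel borel"
  by (rule borel_measurable_continuous_onI[OF L_cont])

lemma L_cm: "L x \<in> cm_space \<mu>"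
  using L_range by blast

lemma Y_meas [measurable]: "Y \<in> measurable M borel"
  by (intro measurable_add measurable_scaleR measurable_compose[OF X L_meas] \<gamma> Z)

lemma AE_pos: "AE s in \<mu>\<gamma>. 0 < s"
proof -
  have "emeasure \<mu>\<gamma> {0} = 0" using \<gamma>_no_atom by (simp add: \<gamma>.emeasure_eq_measure)
  then have "AE s in \<mu>\<gamma>. s \<notin> {0}" by (intro AE_not_in) (auto simp: null_sets_def)
  moreover have "AE s in \<mu>\<gamma>. 0 \<le> s" using \<gamma>_nonneg by (subst AE_distr_iff) auto
  ultimately show ?thesis by eventually_elim auto
qed

lemma observation_measurable:
  assumes k: "k \<in> borel_measurable (borel \<Otimes>\<^sub>M borel)"
  shows "(\<lambda>(s, x, z). k (x, L x + s *\<^sub>R z)) \<in> borel_measurable (borel \<Otimes>\<^sub>M (borel \<Otimes>\<^sub>M borel))"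
proof -
  have m: "(\<lambda>p :: real \<times> 'f \<times> 'g. L (fst (snd p)) + fst p *\<^sub>R snd (snd p)) \<in> measurable (borel \<Otimes>\<^sub>M (borel \<Otimes>\<^sub>M borel)) borel"
    by (intro measurable_add measurable_scaleR) measurable
  have "(\<lambda>p :: real \<times> 'f \<times> 'g. (fst (snd p), L (fst (snd p)) + fst p *\<^sub>R snd (snd p))) \<in>
      measurable (borel \<Otimes>\<^sub>M (borel \<Otimes>\<^sub>M borel)) (borel \<Otimes>\<^sub>M borel)"
    by (intro measurable_Pair m) measurable
  from measurable_compose[OF this k] show ?thesis by (simp add: split_beta)
qed

lemma nn_integral_observation:
  assumes k: "k \<in> borel_measurable (borel \<Otimes>\<^sub>M borel)"
  shows "(\<integral>\<^sup>+\<omega>. k (X \<omega>, Y \<omega>) \<partial>M) = (\<integral>\<^sup>+s. \<integral>\<^sup>+x. \<integral>\<^sup>+z. k (x, L x + s *\<^sub>R z) \<partial>\<mu> \<partial>\<mu>X \<partial>\<mu>\<gamma>)"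
proof -
  let ?k = "\<lambda>(s, x, z). k (x, L x + s *\<^sub>R z)"
  have km: "?k \<in> borel_measurable (borel \<Otimes>\<^sub>M (borel \<Otimes>\<^sub>M borel))"
    by (rule observation_measurable[OF k])
  then have km': "?k \<in> borel_measurable (\<mu>\<gamma> \<Otimes>\<^sub>M (\<mu>X \<Otimes>\<^sub>M \<mu>))"
    by (simp cong: measurable_cong_sets sets_pair_measure_cong)
  have "(\<integral>\<^sup>+\<omega>. k (X \<omega>, Y \<omega>) \<partial>M) = (\<integral>\<^sup>+\<omega>. ?k (\<gamma> \<omega>, X \<omega>, Z \<omega>) \<partial>M)" by simp
  also have "\<dots> = (\<integral>\<^sup>+p. ?k p \<partial>distr M (borel \<Otimes>\<^sub>M (borel \<Otimes>\<^sub>M borel)) (\<lambda>\<omega>. (\<gamma> \<omega>, X \<omega>, Z \<omega>)))"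
    by (rule nn_integral_distr[symmetric]) (use km in simp_all)
  also have "\<dots> = (\<integral>\<^sup>+p. ?k p \<partial>(\<mu>\<gamma> \<Otimes>\<^sub>M (\<mu>X \<Otimes>\<^sub>M \<mu>)))"
    unfolding indep_rvs3_distr[OF prob \<gamma> X Z indep] law_Z ..
  also have "\<dots> = (\<integral>\<^sup>+s. \<integral>\<^sup>+q. ?k (s, q) \<partial>(\<mu>X \<Otimes>\<^sub>M \<mu>) \<partial>\<mu>\<gamma>)"
    by (rule XZ.P.nn_integral_fst[symmetric, OF km'])
  also have "\<dots> = (\<integral>\<^sup>+s. \<integral>\<^sup>+x. \<integral>\<^sup>+z. k (x, L x + s *\<^sub>R z) \<partial>\<mu> \<partial>\<mu>X \<partial>\<mu>\<gamma>)"
  proof (rule nn_integral_cong)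
    fix s assume "s \<in> space \<mu>\<gamma>"
    then have "(\<lambda>q. ?k (s, q)) \<in> borel_measurable (\<mu>X \<Otimes>\<^sub>M \<mu>)" by (intro measurable_Pair2[OF km'])
    from nn_integral_fst[OF this, symmetric]
    show "(\<integral>\<^sup>+q. ?k (s, q) \<partial>(\<mu>X \<Otimes>\<^sub>M \<mu>)) = (\<integral>\<^sup>+x. \<integral>\<^sup>+z. k (x, L x + s *\<^sub>R z) \<partial>\<mu> \<partial>\<mu>X)" by simp
  qed
  finally show ?thesis .
qed

lemma noise_level_measurable: "noise_level c \<in> borel_measurable borel"
proof -
  note [measurable] = top_dual_measurable[OF c_dual]
  show ?thesis unfolding noise_level_def square_average_def by measurable
qed

lemma noise_level_positive_measurable: "Measurable.pred borel (noise_level_positive c)"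
proof -
  note [measurable] = top_dual_measurable[OF c_dual] noise_level_measurable
  \<comment> \<open>The Cauchy criterion expresses convergence by countable operations on measurable
    functions.\<close>
  show ?thesis unfolding noise_level_positive_def Cauchy_convergent_iff[symmetric] square_average_def by measurable
qed

context
  fixes D :: "'g \<Rightarrow> 'g \<Rightarrow> real"
  assumes D: "duality_version \<mu> L D"
begin

abbreviation "lik \<equiv> (\<lambda>y. likelihood \<mu> L D (noise_level c y) y)"
abbreviation "evidence \<equiv> (\<lambda>y. \<integral>x. lik y x \<partial>\<mu>X)"

definition regular :: "'g \<Rightarrow> bool" where
  "regular y \<longleftrightarrow> noise_level_positive c y \<and> integrable \<mu>X (lik y)"

text \<open>A solution must be a probability measure at every \<open>y\<close>, so the prior serves
  as default where the quotient is not meaningful.\<close>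

definition posterior :: "'g \<Rightarrow> 'f measure" where
  "posterior y = (if regular y then density \<mu>X (\<lambda>x. ennreal (lik y x / evidence y)) else \<mu>X)"

lemma D_measurable: "(\<lambda>(x, y). D (L x) y) \<in> borel_measurable (borel \<Otimes>\<^sub>M borel)"
  using D by (simp add: duality_version_def)

text \<open>The amplitude is a function of \<open>y\<close> here because both the constant
  \<open>s\<close> and the noise level are substituted later.\<close>

lemma likelihood_measurable:
  assumes [measurable]: "g \<in> borel_measurable borel"
  shows "(\<lambda>(x, y). likelihood \<mu> L D (g y) y x) \<in> borel_measurable (borel \<Otimes>\<^sub>M borel)"
proof -
  have [measurable]: "(\<lambda>p. D (L (fst p)) (snd p)) \<in> borel_measurable (borel \<Otimes>\<^sub>M borel)"
    using D_measurable by (simp add: split_beta)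
  note [measurable] = cm_norm_L_measurable[OF L_meas L_range]
  show ?thesis unfolding likelihood_def split_beta by measurable
qed

lemma lik_measurable2 [measurable]: "(\<lambda>p. lik (snd p) (fst p)) \<in> borel_measurable (borel \<Otimes>\<^sub>M borel)"
  using likelihood_measurable[OF noise_level_measurable] by (simp add: split_beta)

lemma lik_measurable [measurable]: "lik y \<in> borel_measurable borel"
proof -
  have "(\<lambda>x. (x, y)) \<in> measurable borel (borel \<Otimes>\<^sub>M borel)" by measurable
  from measurable_compose[OF this lik_measurable2] show ?thesis by simp
qed

lemma lik_measurable_swap: "(\<lambda>(y, x). lik y x) \<in> borel_measurable (borel \<Otimes>\<^sub>M \<mu>X)"
proof -
  have "(\<lambda>p. (snd p, fst p)) \<in> measurable (borel \<Otimes>\<^sub>M borel) (borel \<Otimes>\<^sub>M borel)" by measurable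
  from measurable_compose[OF this lik_measurable2] show ?thesis
    by (simp add: split_beta cong: measurable_cong_sets sets_pair_measure_cong)
qed

lemma lik_pos: "0 < lik y x"
  by (simp add: likelihood_def)

lemma shifted_law:
  assumes s: "0 < s" and g: "g \<in> borel_measurable borel"
  shows "(\<integral>\<^sup>+z. g (L x + s *\<^sub>R z) \<partial>\<mu>) = (\<integral>\<^sup>+z. g (s *\<^sub>R z) * ennreal (likelihood \<mu> L D s (s *\<^sub>R z) x) \<partial>\<mu>)"
proof -
  obtain \<phi> where phi: "\<And>n. \<phi> n \<in> top_dual" "tendsto_cov_inv \<mu> \<phi> (L x)"
      "(\<lambda>n. \<integral>\<^sup>+y. ennreal ((\<phi> n y - D (L x) y)\<^sup>2) \<partial>distr \<mu> borel (\<lambda>z. s *\<^sub>R z)) \<longlonglongrightarrow> 0"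
    and Dm: "D (L x) \<in> borel_measurable borel"
    using D L_cm[of x] s unfolding duality_version_def by blast
  show ?thesis
    unfolding likelihood_def by (rule version_shift[OF L_cm Dm phi(1,2) s phi(3) g])
qed

text \<open>For each \<open>x\<close> the density is first written with the true amplitude
  \<open>s\<close>. Only after Fubini, with \<open>z\<close> as outer variable, is \<open>s\<close>
  replaced by the noise level of \<open>s z\<close>: the two agree off a null set of
  \<open>z\<close> that does not depend on \<open>x\<close>.\<close>

lemma shifted_law_swap:
  assumes s: "0 < s" and k: "k \<in> borel_measurable (borel \<Otimes>\<^sub>M borel)"
  shows "(\<integral>\<^sup>+x. \<integral>\<^sup>+z. k (x, L x + s *\<^sub>R z) \<partial>\<mu> \<partial>\<mu>X) =
    (\<integral>\<^sup>+z. \<integral>\<^sup>+x. k (x, s *\<^sub>R z) * ennreal (lik (s *\<^sub>R z) x) \<partial>\<mu>X \<partial>\<mu>)"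
proof -
  let ?l = "\<lambda>x z. k (x, s *\<^sub>R z) * ennreal (likelihood \<mu> L D s (s *\<^sub>R z) x)"
  have "(\<lambda>z :: 'g. s *\<^sub>R z) \<in> measurable borel borel" by (intro measurable_scaleR) auto
  from measurable_compose[OF measurable_snd this]
  have sc: "(\<lambda>p :: 'f \<times> 'g. (fst p, s *\<^sub>R snd p)) \<in> measurable (borel \<Otimes>\<^sub>M borel) (borel \<Otimes>\<^sub>M borel)"
    by (intro measurable_Pair) auto
  have "(\<lambda>p. ?l (fst p) (snd p)) \<in> borel_measurable (borel \<Otimes>\<^sub>M borel)"
    using measurable_compose[OF sc k] measurable_compose[OF sc likelihood_measurable[of "\<lambda>_. s"]]
    by (simp add: split_beta)
  then have lm: "(\<lambda>(x, z). ?l x z) \<in> borel_measurable (\<mu>X \<Otimes>\<^sub>M \<mu>)"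
    by (simp add: split_beta cong: measurable_cong_sets sets_pair_measure_cong)
  have "(\<integral>\<^sup>+x. \<integral>\<^sup>+z. k (x, L x + s *\<^sub>R z) \<partial>\<mu> \<partial>\<mu>X) = (\<integral>\<^sup>+x. \<integral>\<^sup>+z. ?l x z \<partial>\<mu> \<partial>\<mu>X)"
  proof (rule nn_integral_cong)
    fix x
    have "(\<lambda>y. k (x, y)) \<in> borel_measurable borel"
      by (rule measurable_compose[OF _ k]) measurable
    from shifted_law[OF s this]
    show "(\<integral>\<^sup>+z. k (x, L x + s *\<^sub>R z) \<partial>\<mu>) = (\<integral>\<^sup>+z. ?l x z \<partial>\<mu>)" .
  qed
  also have "\<dots> = (\<integral>\<^sup>+z. \<integral>\<^sup>+x. ?l x z \<partial>\<mu>X \<partial>\<mu>)"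
    by (rule XZ.Fubini'[OF lm, symmetric])
  also have "\<dots> = (\<integral>\<^sup>+z. \<integral>\<^sup>+x. k (x, s *\<^sub>R z) * ennreal (lik (s *\<^sub>R z) x) \<partial>\<mu>X \<partial>\<mu>)"
    by (rule nn_integral_cong_AE) (use noise_level_scaled[OF s] in \<open>eventually_elim; simp\<close>)
  finally show ?thesis .
qed

lemma nn_integral_bayes:
  assumes k: "k \<in> borel_measurable (borel \<Otimes>\<^sub>M borel)"
  shows "(\<integral>\<^sup>+\<omega>. k (X \<omega>, Y \<omega>) \<partial>M) =
    (\<integral>\<^sup>+s. \<integral>\<^sup>+z. \<integral>\<^sup>+x. k (x, s *\<^sub>R z) * ennreal (lik (s *\<^sub>R z) x) \<partial>\<mu>X \<partial>\<mu> \<partial>\<mu>\<gamma>)"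
  unfolding nn_integral_observation[OF k]
  by (rule nn_integral_cong_AE) (use AE_pos in \<open>eventually_elim; simp add: shifted_law_swap[OF _ k]\<close>)

lemma integrable_lik_iff: "integrable \<mu>X (lik y) \<longleftrightarrow> (\<integral>\<^sup>+x. ennreal (lik y x) \<partial>\<mu>X) < \<infinity>"
  using lik_pos[of y] by (auto simp: integrable_iff_bounded less_imp_le abs_of_pos)

lemma nn_lik_measurable [measurable]: "(\<lambda>y. \<integral>\<^sup>+x. ennreal (lik y x) \<partial>\<mu>X) \<in> borel_measurable borel"
  by (rule X.borel_measurable_nn_integral) (use lik_measurable_swap in \<open>simp add: split_beta\<close>)

text \<open>\<open>shifted_law_swap\<close> for the constant 1 says that the evidence has integral 1
  under the law of \<open>s Z\<close>, so it is finite almost everywhere. This holds for every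
  single \<open>s > 0\<close>, not merely for almost every value of \<open>\<gamma>\<close>.\<close>

lemma regular_scaled:
  assumes s: "0 < s"
  shows "AE z in \<mu>. regular (s *\<^sub>R z)"
proof -
  have sc: "(\<lambda>z :: 'g. s *\<^sub>R z) \<in> measurable \<mu> borel" by (rule scaled_measurable)
  have "(\<integral>\<^sup>+z. \<integral>\<^sup>+x. ennreal (lik (s *\<^sub>R z) x) \<partial>\<mu>X \<partial>\<mu>) = 1"
    using shifted_law_swap[OF s, of "\<lambda>_. 1"] X.emeasure_space_1 emeasure_space_1 by simp
  then have "AE z in \<mu>. (\<integral>\<^sup>+x. ennreal (lik (s *\<^sub>R z) x) \<partial>\<mu>X) \<noteq> \<infinity>"
    by (intro nn_integral_PInf_AE measurable_compose[OF sc nn_lik_measurable]) simp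
  with noise_level_scaled[OF s] show ?thesis
    by eventually_elim (unfold regular_def integrable_lik_iff, simp add: less_top)
qed

lemma regular_measurable [measurable]: "Measurable.pred borel regular"
proof -
  note [measurable] = noise_level_positive_measurable
  show ?thesis unfolding regular_def integrable_lik_iff by measurable
qed

lemma evidence_pos: "regular y \<Longrightarrow> 0 < evidence y"
  using X.integral_less_AE_space[of "\<lambda>_. 0" "lik y"] lik_pos[of y] X.emeasure_space_1
  by (simp add: regular_def)

lemma set_integral_lik:
  assumes y: "regular y" and A: "A \<in> sets borel"
  shows "(\<integral>\<^sup>+x. indicator A x * ennreal (lik y x) \<partial>\<mu>X) = ennreal (LINT x:A|\<mu>X. lik y x)"
proof -
  have "(\<integral>\<^sup>+x. indicator A x * ennreal (lik y x) \<partial>\<mu>X) = (\<integral>\<^sup>+x. ennreal (indicator A x *\<^sub>R lik y x) \<partial>\<mu>X)"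
    by (intro nn_integral_cong) (auto simp: indicator_def)
  also have "\<dots> = ennreal (\<integral>x. indicator A x *\<^sub>R lik y x \<partial>\<mu>X)"
    using y A lik_pos[of y]
    by (intro nn_integral_eq_integral integrable_mult_indicator) (auto simp: regular_def less_imp_le)
  finally show ?thesis by (simp add: set_lebesgue_integral_def)
qed

lemma posterior_regular:
  assumes y: "regular y" and A: "A \<in> sets borel"
  shows "emeasure (posterior y) A = ennreal ((LINT x:A|\<mu>X. lik y x) / evidence y)"
    and "measure (posterior y) A = (LINT x:A|\<mu>X. lik y x) / evidence y"
proof -
  note [measurable] = A
  have nn: "0 \<le> (LINT x:A|\<mu>X. lik y x)"
    unfolding set_lebesgue_integral_def using lik_pos[of y] by (intro integral_nonneg_AE) (auto simp: less_imp_le)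
  have "emeasure (posterior y) A = (\<integral>\<^sup>+x. ennreal (lik y x / evidence y) * indicator A x \<partial>\<mu>X)"
    using y by (simp add: posterior_def emeasure_density)
  also have "\<dots> = (\<integral>\<^sup>+x. (indicator A x * ennreal (lik y x)) / ennreal (evidence y) \<partial>\<mu>X)"
    using lik_pos[of y] evidence_pos[OF y]
    by (intro nn_integral_cong) (simp add: divide_ennreal[symmetric] less_imp_le indicator_def)
  also have "\<dots> = (\<integral>\<^sup>+x. indicator A x * ennreal (lik y x) \<partial>\<mu>X) / ennreal (evidence y)"
    by (rule nn_integral_divide) measurable
  also have "\<dots> = ennreal ((LINT x:A|\<mu>X. lik y x) / evidence y)"
    unfolding set_integral_lik[OF y A] by (rule divide_ennreal[OF nn evidence_pos[OF y]])
  finally show *: "emeasure (posterior y) A = ennreal ((LINT x:A|\<mu>X. lik y x) / evidence y)" .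
  show "measure (posterior y) A = (LINT x:A|\<mu>X. lik y x) / evidence y"
    unfolding measure_def * using nn evidence_pos[OF y] by simp
qed

lemma sets_posterior: "sets (posterior y) = sets borel"
  by (simp add: posterior_def)

lemma prob_space_posterior: "prob_space (posterior y)"
proof (cases "regular y")
  case True
  have "space (posterior y) = UNIV" using sets_eq_imp_space_eq[OF sets_posterior] by simp
  moreover have "(LINT x:UNIV|\<mu>X. lik y x) = evidence y" by (simp add: set_lebesgue_integral_def)
  ultimately have "emeasure (posterior y) (space (posterior y)) = 1"
    using posterior_regular(1)[OF True, of UNIV] evidence_pos[OF True] by simp
  then show ?thesis by (rule prob_spaceI)
qed (simp add: posterior_def X.prob_space_axioms)

lemma posterior_measurable:
  assumes A [measurable]: "A \<in> sets borel"
  shows "(\<lambda>y. measure (posterior y) A) \<in> borel_measurable borel"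
proof -
  have "measure (posterior y) A = (if regular y then (LINT x:A|\<mu>X. lik y x) / evidence y else measure \<mu>X A)" for y
    using posterior_regular(2)[OF _ A] by (simp add: posterior_def)
  moreover have "(\<lambda>y. LINT x:B|\<mu>X. lik y x) \<in> borel_measurable borel" if [measurable]: "B \<in> sets borel" for B
    unfolding set_lebesgue_integral_def
    by (rule X.borel_measurable_lebesgue_integral) (use lik_measurable_swap in \<open>simp add: split_beta\<close>)
  from this[OF A] this[of UNIV] have "(\<lambda>y. LINT x:A|\<mu>X. lik y x) \<in> borel_measurable borel" "evidence \<in> borel_measurable borel"
    by (simp_all add: set_lebesgue_integral_def)
  ultimately show ?thesis by simp
qed

text \<open>\<open>nn_integral_bayes\<close> turns both sides into integrals against the likelihood.
  At a regular \<open>y\<close> the integral of the likelihood over \<open>U\<close> is the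
  posterior mass of \<open>U\<close> times the evidence, so the indicator of \<open>U\<close> may be
  replaced by this mass, which is constant in \<open>x\<close>.\<close>

lemma posterior_bayes:
  assumes [measurable]: "U \<in> sets borel" "B \<in> sets borel"
  shows "(\<integral>\<^sup>+\<omega>. indicator B (Y \<omega>) * indicator U (X \<omega>) \<partial>M) =
    (\<integral>\<^sup>+\<omega>. indicator B (Y \<omega>) * ennreal (measure (posterior (Y \<omega>)) U) \<partial>M)"
proof -
  note [measurable] = posterior_measurable[OF assms(1)]
  have "(\<integral>\<^sup>+\<omega>. indicator B (Y \<omega>) * indicator U (X \<omega>) \<partial>M) =
      (\<integral>\<^sup>+s. \<integral>\<^sup>+z. \<integral>\<^sup>+x. (indicator B (s *\<^sub>R z) * indicator U x) * ennreal (lik (s *\<^sub>R z) x) \<partial>\<mu>X \<partial>\<mu> \<partial>\<mu>\<gamma>)"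
    using nn_integral_bayes[of "\<lambda>p. indicator B (snd p) * indicator U (fst p)"] by simp
  also have "\<dots> = (\<integral>\<^sup>+s. \<integral>\<^sup>+z. \<integral>\<^sup>+x. (indicator B (s *\<^sub>R z) * ennreal (measure (posterior (s *\<^sub>R z)) U)) * ennreal (lik (s *\<^sub>R z) x) \<partial>\<mu>X \<partial>\<mu> \<partial>\<mu>\<gamma>)"
  proof (rule nn_integral_cong_AE)
    have "(\<integral>\<^sup>+x. (indicator B y * indicator U x) * ennreal (lik y x) \<partial>\<mu>X) =
        (\<integral>\<^sup>+x. (indicator B y * ennreal (measure (posterior y) U)) * ennreal (lik y x) \<partial>\<mu>X)" if y: "regular y" for y
    proof -
      have "(\<integral>\<^sup>+x. (indicator B y * indicator U x) * ennreal (lik y x) \<partial>\<mu>X) =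
          indicator B y * (\<integral>\<^sup>+x. indicator U x * ennreal (lik y x) \<partial>\<mu>X)"
        unfolding mult.assoc by (rule nn_integral_cmult) measurable
      also have "(\<integral>\<^sup>+x. indicator U x * ennreal (lik y x) \<partial>\<mu>X) = ennreal (measure (posterior y) U * evidence y)"
        using posterior_regular(2)[OF y, of U] evidence_pos[OF y] by (simp add: set_integral_lik[OF y])
      also have "\<dots> = ennreal (measure (posterior y) U) * (\<integral>\<^sup>+x. ennreal (lik y x) \<partial>\<mu>X)"
        using set_integral_lik[OF y, of UNIV] evidence_pos[OF y]
        by (simp add: set_lebesgue_integral_def ennreal_mult less_imp_le)
      also have "indicator B y * \<dots> = (\<integral>\<^sup>+x. (indicator B y * ennreal (measure (posterior y) U)) * ennreal (lik y x) \<partial>\<mu>X)"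
        unfolding mult.assoc[symmetric] by (rule nn_integral_cmult[symmetric]) measurable
      finally show ?thesis .
    qed
    then have eq: "(\<integral>\<^sup>+z. \<integral>\<^sup>+x. (indicator B (s *\<^sub>R z) * indicator U x) * ennreal (lik (s *\<^sub>R z) x) \<partial>\<mu>X \<partial>\<mu>) =
        (\<integral>\<^sup>+z. \<integral>\<^sup>+x. (indicator B (s *\<^sub>R z) * ennreal (measure (posterior (s *\<^sub>R z)) U)) * ennreal (lik (s *\<^sub>R z) x) \<partial>\<mu>X \<partial>\<mu>)"
      if s: "0 < s" for s
      by (intro nn_integral_cong_AE) (use regular_scaled[OF s] in \<open>eventually_elim; simp\<close>)
    show "AE s in \<mu>\<gamma>. (\<integral>\<^sup>+z. \<integral>\<^sup>+x. (indicator B (s *\<^sub>R z) * indicator U x) * ennreal (lik (s *\<^sub>R z) x) \<partial>\<mu>X \<partial>\<mu>) =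
        (\<integral>\<^sup>+z. \<integral>\<^sup>+x. (indicator B (s *\<^sub>R z) * ennreal (measure (posterior (s *\<^sub>R z)) U)) * ennreal (lik (s *\<^sub>R z) x) \<partial>\<mu>X \<partial>\<mu>)"
      using AE_pos by eventually_elim (rule eq)
  qed
  also have "\<dots> = (\<integral>\<^sup>+\<omega>. indicator B (Y \<omega>) * ennreal (measure (posterior (Y \<omega>)) U) \<partial>M)"
    using nn_integral_bayes[of "\<lambda>p. indicator B (snd p) * ennreal (measure (posterior (snd p)) U)"] by simp
  finally show ?thesis .
qed

text \<open>Every set of the sigma-algebra generated by \<open>Y\<close> is the preimage of a Borel
  set, so the characterization of conditional expectation is \<open>posterior_bayes\<close> in terms
  of real integrals.\<close>

theorem posterior_solution_posterior: "posterior_solution M X Y posterior"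
  unfolding posterior_solution_def
proof (intro conjI ballI allI prob_space_posterior sets_posterior)
  fix U :: "'f set" assume U [measurable]: "U \<in> sets borel"
  note [measurable] = posterior_measurable[OF U]
  show "(\<lambda>y. measure (posterior y) U) \<in> borel_measurable (completion (distr M borel Y))"
    by (rule measurable_completion) simp
  let ?F = "vimage_algebra (space M) Y borel"
  interpret F: finite_measure_subalgebra M ?F
  proof
    have "sets ?F \<subseteq> sets M"
      using measurable_sets[OF Y_meas] by (auto simp: sets_vimage_algebra2)
    then show "subalgebra M ?F" by (simp add: subalgebra_def)
  qed
  have "AE \<omega> in M. real_cond_exp M ?F (\<lambda>\<omega>. indicator U (X \<omega>)) \<omega> = measure (posterior (Y \<omega>)) U"
  proof (rule F.real_cond_exp_charact)
    show "integrable M (\<lambda>\<omega>. indicator U (X \<omega>) :: real)"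
      by (intro M.integrable_const_bound[where B=1]) auto
    show "integrable M (\<lambda>\<omega>. measure (posterior (Y \<omega>)) U)"
      using prob_space.prob_le_1[OF prob_space_posterior]
      by (intro M.integrable_const_bound[where B=1]) auto
    show "(\<lambda>\<omega>. measure (posterior (Y \<omega>)) U) \<in> borel_measurable ?F"
      by (rule measurable_compose[OF measurable_vimage_algebra1]) auto
    fix A assume "A \<in> sets ?F"
    then obtain B where B [measurable]: "B \<in> sets borel" and A: "A = Y -` B \<inter> space M"
      by (auto simp: sets_vimage_algebra2)
    have ind: "indicator A \<omega> = (indicator B (Y \<omega>) :: real)" if "\<omega> \<in> space M" for \<omega>
      using that by (simp add: A indicator_def)
    have "(LINT \<omega>:A|M. indicator U (X \<omega>) :: real) = (\<integral>\<omega>. indicator B (Y \<omega>) * indicator U (X \<omega>) \<partial>M)"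
      unfolding set_lebesgue_integral_def by (intro Bochner_Integration.integral_cong) (auto simp: ind)
    also have "\<dots> = enn2real (\<integral>\<^sup>+\<omega>. ennreal (indicator B (Y \<omega>) * indicator U (X \<omega>)) \<partial>M)"
      by (rule integral_eq_nn_integral) auto
    also have "\<dots> = enn2real (\<integral>\<^sup>+\<omega>. indicator B (Y \<omega>) * indicator U (X \<omega>) \<partial>M)"
      by (simp add: ennreal_mult ennreal_indicator)
    also have "\<dots> = enn2real (\<integral>\<^sup>+\<omega>. ennreal (indicator B (Y \<omega>) * measure (posterior (Y \<omega>)) U) \<partial>M)"
      unfolding posterior_bayes[OF U B] by (simp add: ennreal_mult ennreal_indicator)
    also have "\<dots> = (\<integral>\<omega>. indicator B (Y \<omega>) * measure (posterior (Y \<omega>)) U \<partial>M)"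
      by (rule integral_eq_nn_integral[symmetric]) auto
    also have "\<dots> = (LINT \<omega>:A|M. measure (posterior (Y \<omega>)) U)"
      unfolding set_lebesgue_integral_def by (intro Bochner_Integration.integral_cong) (auto simp: ind)
    finally show "(LINT \<omega>:A|M. indicator U (X \<omega>) :: real) = (LINT \<omega>:A|M. measure (posterior (Y \<omega>)) U)" .
  qed
  then show "AE \<omega> in M. measure (posterior (Y \<omega>)) U = real_cond_exp M ?F (\<lambda>\<omega>. indicator U (X \<omega>)) \<omega>"
    by eventually_elim simp
qed

theorem posterior_version:
  "\<exists>\<kappa>. posterior_solution M X Y \<kappa> \<and> essentially_unique_posterior M X Y \<kappa> \<and>
    (\<forall>y. noise_level_positive c y \<and> integrable \<mu>X (lik y) \<longrightarrow>
      (\<forall>A\<in>sets borel. measure (\<kappa> y) A = (LINT x:A|\<mu>X. lik y x) / evidence y))"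
  using posterior_solution_posterior posterior_regular(2)
    posterior_essentially_unique[OF souslin_F prob Y_meas posterior_solution_posterior]
  by (intro exI[of _ posterior]) (auto simp: regular_def)

end

text \<open>Where the normalizing integral of the version \<open>pairing\<close> is infinite, the version is replaced by
  \<open>0\<close>. These points are negligible for each of the scaled measures, not merely for the law of the
  noise.\<close>

theorem normalizable_version:
  "\<exists>D. duality_version \<mu> L D \<and>
    (\<forall>y. noise_level_positive c y \<longrightarrow> integrable \<mu>X (likelihood \<mu> L D (noise_level c y) y))"
proof -
  have D0: "duality_version \<mu> L pairing" by (rule duality_version_pairing[OF L_meas L_range])
  let ?good = "regular pairing"
  define D where "D h y = (if ?good y then pairing h y else 0)" for h y
  note [measurable] = regular_measurable[OF D0] pairing_measurable
  have "duality_version \<mu> L D"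
    unfolding duality_version_def
  proof (intro conjI ballI)
    have [measurable]: "(\<lambda>p. pairing (L (fst p)) (snd p)) \<in> borel_measurable (borel \<Otimes>\<^sub>M borel)"
      using pairing_jointly_measurable[OF L_meas L_range] by (simp add: split_beta)
    show "(\<lambda>(x, y). D (L x) y) \<in> borel_measurable (borel \<Otimes>\<^sub>M borel)"
      unfolding D_def split_beta by measurable
    fix h assume h: "h \<in> cm_space \<mu>"
    show Dm: "D h \<in> borel_measurable borel" unfolding D_def by measurable
    show "\<exists>\<phi>. (\<forall>n. \<phi> n \<in> top_dual) \<and> tendsto_cov_inv \<mu> \<phi> h \<and>
        (\<forall>a>0. (\<lambda>n. \<integral>\<^sup>+y. ennreal ((\<phi> n y - D h y)\<^sup>2) \<partial>distr \<mu> borel (\<lambda>z. a *\<^sub>R z)) \<longlonglongrightarrow> 0)"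
    proof (intro exI[of _ "\<lambda>n. S n h"] conjI allI impI S_dual S_tendsto_cov_inv[OF h])
      fix a :: real assume a: "0 < a"
      have good: "AE y in distr \<mu> borel (\<lambda>z. a *\<^sub>R z). ?good y"
        using regular_scaled[OF D0 a] scaled_measurable[of a] by (subst AE_distr_iff) auto
      have "(\<integral>\<^sup>+y. ennreal ((S n h y - D h y)\<^sup>2) \<partial>distr \<mu> borel (\<lambda>z. a *\<^sub>R z)) =
          (\<integral>\<^sup>+y. ennreal ((S n h y - pairing h y)\<^sup>2) \<partial>distr \<mu> borel (\<lambda>z. a *\<^sub>R z))" for n
      proof (intro nn_integral_cong_AE)
        show "AE y in distr \<mu> borel (\<lambda>z. a *\<^sub>R z). ennreal ((S n h y - D h y)\<^sup>2) = ennreal ((S n h y - pairing h y)\<^sup>2)"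
          using good by eventually_elim (simp add: D_def)
      qed
      then show "(\<lambda>n. \<integral>\<^sup>+y. ennreal ((S n h y - D h y)\<^sup>2) \<partial>distr \<mu> borel (\<lambda>z. a *\<^sub>R z)) \<longlonglongrightarrow> 0"
        using pairing_L2[OF h a] by simp
    qed
  qed
  moreover have "integrable \<mu>X (likelihood \<mu> L D (noise_level c y) y)" if y: "noise_level_positive c y" for y
  proof (cases "?good y")
    case True
    then have "likelihood \<mu> L D (noise_level c y) y = likelihood \<mu> L pairing (noise_level c y) y"
      by (simp add: likelihood_def D_def fun_eq_iff)
    then show ?thesis using True by (simp add: regular_def[OF D0])
  next
    case False
    \<comment> \<open>With the pairing set to 0 the likelihood is at most 1, hence integrable for
      the probability measure \<open>\<mu>X\<close>.\<close>
    then have "likelihood \<mu> L D (noise_level c y) y x = exp (- ((cm_norm \<mu> (L x))\<^sup>2 / (2 * (noise_level c y)\<^sup>2)))" for x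
      by (simp add: likelihood_def D_def)
    then have eq: "likelihood \<mu> L D (noise_level c y) y = (\<lambda>x. exp (- ((cm_norm \<mu> (L x))\<^sup>2 / (2 * (noise_level c y)\<^sup>2))))"
      by blast
    note [measurable] = cm_norm_L_measurable[OF L_meas L_range]
    show ?thesis unfolding eq by (intro X.integrable_const_bound[where B=1]) auto
  qed
  ultimately show ?thesis by blast
qed

end

theorem theorem5p3:
  fixes M :: "'w measure"
    and X :: "'w \<Rightarrow> 'f::locally_convex_tvs"
    and Z :: "'w \<Rightarrow> 'g::locally_convex_tvs"
    and \<gamma> :: "'w \<Rightarrow> real"
    and L :: "'f \<Rightarrow> 'g"
    and e :: "nat \<Rightarrow> 'g"
    and c :: "nat \<Rightarrow> 'g \<Rightarrow> real"
  defines "\<mu>X \<equiv> distr M borel X"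
    and "\<mu>Z \<equiv> distr M borel Z"
    and "Y \<equiv> (\<lambda>\<omega>. L (X \<omega>) + \<gamma> \<omega> *\<^sub>R Z \<omega>)"
  assumes souslin_F: "souslin_space (euclidean :: 'f topology)"
    and souslin_G: "souslin_space (euclidean :: 'g topology)"
    and prob: "prob_space M"
    and complete: "complete_measure M"
    and X: "X \<in> M \<rightarrow>\<^sub>M borel"
    and Z: "Z \<in> M \<rightarrow>\<^sub>M borel"
    and \<gamma>: "\<gamma> \<in> M \<rightarrow>\<^sub>M borel"
    and gaussian: "centered_gaussian \<mu>Z"
    and infinite_dim: "\<not> (\<exists>B. finite B \<and> cm_space \<mu>Z \<subseteq> span B)"
    and \<gamma>_nonneg: "\<And>\<omega>. \<omega> \<in> space M \<Longrightarrow> 0 \<le> \<gamma> \<omega>"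
    and \<gamma>_no_atom: "measure (distr M borel \<gamma>) {0} = 0"
    and indep: "indep_rvs3 M \<gamma> X Z"
    and L_cont: "continuous_on UNIV L"
    and L_range: "range L \<subseteq> cm_space \<mu>Z"
    and basis: "cm_orthonormal_basis \<mu>Z e"
    and basis_dual: "\<And>i. cov_maps \<mu>Z (c i) (e i)"
  shows "(\<exists>D. duality_version \<mu>Z L D \<and>
            (\<exists>\<kappa>. posterior_solution M X Y \<kappa> \<and> essentially_unique_posterior M X Y \<kappa> \<and>
              (\<forall>y. noise_level_positive c y \<longrightarrow>
                integrable \<mu>X (likelihood \<mu>Z L D (noise_level c y) y) \<and>
                (\<forall>A\<in>sets borel. measure (\<kappa> y) A =
                   (LINT x:A|\<mu>X. likelihood \<mu>Z L D (noise_level c y) y x) /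
                   (LINT x|\<mu>X. likelihood \<mu>Z L D (noise_level c y) y x))))) \<and>
         (\<forall>D. duality_version \<mu>Z L D \<longrightarrow>
            (\<exists>\<kappa>. posterior_solution M X Y \<kappa> \<and> essentially_unique_posterior M X Y \<kappa> \<and>
              (\<forall>y. noise_level_positive c y \<and>
                   integrable \<mu>X (likelihood \<mu>Z L D (noise_level c y) y) \<longrightarrow>
                (\<forall>A\<in>sets borel. measure (\<kappa> y) A =
                   (LINT x:A|\<mu>X. likelihood \<mu>Z L D (noise_level c y) y x) /
                   (LINT x|\<mu>X. likelihood \<mu>Z L D (noise_level c y) y x)))))"
proof -
  interpret inverse_problem "TYPE('g)" \<mu>Z e c M X Z \<gamma> L
    by (intro inverse_problem.intro cm_basis.intro souslin_gaussian.intro souslin_lcs.intro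
        souslin_gaussian_axioms.intro cm_basis_axioms.intro inverse_problem_axioms.intro
        souslin_F souslin_G prob X Z \<gamma> gaussian \<gamma>_nonneg \<gamma>_no_atom indep L_cont L_range basis basis_dual
        meta_eq_to_obj_eq[OF \<mu>Z_def])
  \<comment> \<open>Both halves are instances of \<open>posterior_version\<close>; for this
    particular \<open>D\<close> its integrability premise holds at every \<open>y\<close> with
    positive noise level.\<close>
  obtain D where "duality_version \<mu>Z L D"
    "\<And>y. noise_level_positive c y \<Longrightarrow> integrable \<mu>X (likelihood \<mu>Z L D (noise_level c y) y)"
    using normalizable_version unfolding \<mu>X_def by blast
  then show ?thesis
    using posterior_version unfolding \<mu>X_def Y_def by blast
qed

end
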